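(* Let $F:T^{1,0}M\to[0,+\infty)$ be a strongly convex weakly Kähler-Finsler metric on a complex manifold $M$, let $\nabla$ be the Cartan connection associated to $F$, and let $\sigma:[0,1]\to M$ be a smooth regular curve in $M$. Then the following assertions are equivalent: (1) $F$ is a strongly convex Kähler-Berwald metric; (2) the types of complexified vectors in $T_{\mathbb R}M$ are preserved under parallel transport along $\sigma$ with respect to $\nabla$; (3) for any real vector field $V$ along $\sigma$ that is parallel along $\sigma$ with respect to $\nabla$, $JV$ is also parallel along $\sigma$ with respect to $\nabla$; (4) $\nabla_X\mathbf J\equiv0$ for all $X\in\mathcal H_{\mathbb R}$.
   Context: Standing conventions. $M$ is a complex manifold of complex dimension $n\ge 2$ with canonical complex structure $J$ on the real tangent bundle $T_{\mathbb R}M$. Greek indices run over $1,\dots,n$, Latin indices over $1,\dots,2n$, $\alpha^*=\alpha+n$, and repeated indices are summed. Local holomorphic coordinates are $z^\alpha=x^\alpha+ix^{\alpha^*}$, with fiber coordinates $v=v^\alpha\frac{\partial}{\partial z^\alpha}\in T^{1,0}M$, $v^\alpha=y^\alpha+iy^{\alpha^*}$. $T_{\mathbb R}M$ and $T^{1,0}M$ are identified by $y=y^j\frac{\partial}{\partial x^j}\mapsto y_o=\frac12(y-iJy)=v$. $\tilde M$ denotes $T^{1,0}M\setminus\{0\}\cong T_{\mathbb R}M\setminus\{0\}$; $\mathbf J$ is the canonical complex structure on the complex manifold $T^{1,0}M$: $\mathbf J\frac{\partial}{\partial x^\alpha}=\frac{\partial}{\partial x^{\alpha^*}}$, $\mathbf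 J\frac{\partial}{\partial x^{\alpha^*}}=-\frac{\partial}{\partial x^\alpha}$, $\mathbf J\frac{\partial}{\partial y^\alpha}=\frac{\partial}{\partial y^{\alpha^*}}$, $\mathbf J\frac{\partial}{\partial y^{\alpha^*}}=-\frac{\partial}{\partial y^\alpha}$. A strongly convex complex Finsler metric is a function $F:T^{1,0}M\to[0,+\infty)$, positive and $C^\infty$ on $\tilde M$, with $F(z;\lambda v)=|\lambda|F(z;v)$ for $\lambda\in\mathbb C$, such that, viewing $F$ as a function of $(x;y)$, the matrix $g_{jk}=\frac12\frac{\partial^2F^2}{\partial y^j\partial y^k}$ is positive definite on $\tilde M$ (then $G_{\alpha\bar\beta}=\frac{\partial^2F^2}{\partial v^\alpha\partial\bar v^\beta}$ is Hermitian positive definite). Cartan connection. Let $\hat{\mathbb G}^k=\frac14g^{kl}\big(\frac{\partial^2F^2}{\partial x^a\partial y^l}y^a-\frac{\partial F^2}{\partial x^l}\big)$, $\hat\Gamma^k_j=\frac{\partial\hat{\mathbb G}^k}{\partial y^j}$, $\frac{\delta}{\delta x^j}=\frac{\partial}{\partial x^j}-\hat\Gamma^k_j\frac{\partial}{\partial y^k}$; $\mathcal H_{\mathbb R}=\mathrm{span}\{\frac{\delta}{\delta x^j}\}$, $\mathcal V_{\mathbb R}=\mathrm{span}\{\frac{\partial}{\partial y^j}\}$. With $\hat\Gamma^k_{j;l}=\frac{g^{ks}}2\big(\frac{\delta g_{sj}}{\delta x^l}-\frac{\delta g_{jl}}{\delta x^s}+\frac{\delta g_{ls}}{\delta x^j}\big)$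 and $\hat\Gamma^k_{jl}=\frac14g^{ks}\frac{\partial^3F^2}{\partial y^j\partial y^l\partial y^s}$, the Cartan connection $\nabla$ is the linear connection on $\mathcal V_{\mathbb R}\to\tilde M$ with $\nabla_{\frac{\delta}{\delta x^l}}\frac{\partial}{\partial y^j}=\hat\Gamma^k_{j;l}\frac{\partial}{\partial y^k}$, $\nabla_{\frac{\partial}{\partial y^l}}\frac{\partial}{\partial y^j}=\hat\Gamma^k_{jl}\frac{\partial}{\partial y^k}$. For $X\in T_{\mathbb R}\tilde M$, $(\nabla_X\mathbf J)(Y):=\nabla_X(\mathbf JY)-\mathbf J(\nabla_XY)$ for sections $Y$ of $\mathcal V_{\mathbb R}$; $\nabla_X\mathbf J=0$ means this vanishes for all $Y$. Parallelism along $\sigma$. Regular means $\dot\sigma\neq0$. A real vector field $V(t)=V^k(t)\frac{\partial}{\partial x^k}$ along $\sigma$ is parallel along $\sigma$ with respect to $\nabla$ if $\frac{dV^k}{dt}+V^l\hat\Gamma^k_{l;j}(\sigma(t);\dot\sigma(t))\dot\sigma^j(t)=0$ for all $k$. This is a linear ODE; parallel transport of complexified vectors (elements of $T_{\mathbb R}M\otimes\mathbb C=T^{1,0}M\oplus T^{0,1}M$) is defined by $\mathbb C$-linear extension. "Types are preserved" means that the parallel transport of a vector of type $(1,0)$ (resp. $(0,1)$) is of type $(1,0)$ (resp. $(0,1)$) all along $\sigma$. Kähler conditions. With $G^{\bar\tau\alpha}G_{\beta\bar\tau}=\delta^\alpha_\beta$ and $G_\alpha=\frac{\partial F^2}{\partial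 v^\alpha}$, set $\Gamma^\alpha_{;\mu}=G^{\bar\tau\alpha}\frac{\partial^2F^2}{\partial z^\mu\partial\bar v^\tau}$, $\delta_\mu=\frac{\partial}{\partial z^\mu}-\Gamma^\alpha_{;\mu}\frac{\partial}{\partial v^\alpha}$, $\Gamma^\alpha_{\beta;\mu}=G^{\bar\tau\alpha}\delta_\mu(G_{\beta\bar\tau})$. $F$ is Kähler-Finsler if $\Gamma^\alpha_{\beta;\mu}=\Gamma^\alpha_{\mu;\beta}$; weakly Kähler-Finsler if $G_\alpha(\Gamma^\alpha_{\beta;\mu}-\Gamma^\alpha_{\mu;\beta})v^\beta=0$; complex Berwald if each $\Gamma^\alpha_{\beta;\mu}$ depends only on the base point $z$; a strongly convex $F$ is a strongly convex Kähler-Berwald metric if it is both Kähler-Finsler and complex Berwald.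
   Formalization: The curve σ is quantified inside assertions (2) and (3): each is required for all smooth regular curves σ in M. With a single fixed σ the equivalence fails, since (2) and (3) would only constrain F near that curve. *)

theory Defs
  imports "HOL-Analysis.Analysis"
begin

section \<open>Smooth and holomorphic maps\<close>

text \<open>Differentiability is taken within \<open>S\<close>. The predicate is used for open sets \<open>S\<close> and for
  relatively open subsets of \<open>{0..1}\<close>; on both, derivatives within \<open>S\<close> are unique.\<close>

primrec Ck_on :: "nat \<Rightarrow> 'a::euclidean_space set \<Rightarrow> ('a \<Rightarrow> 'b::real_normed_vector) \<Rightarrow> bool" where
  "Ck_on 0 S f \<longleftrightarrow> continuous_on S f"
| "Ck_on (Suc k) S f \<longleftrightarrow>
     f differentiable_on S \<and> (\<forall>h. Ck_on k S (\<lambda>x. frechet_derivative f (at x within S) h))"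

definition smooth_on :: "'a::euclidean_space set \<Rightarrow> ('a \<Rightarrow> 'b::real_normed_vector) \<Rightarrow> bool" where
  "smooth_on S f \<longleftrightarrow> (\<forall>k. Ck_on k S f)"

definition holomorphic_map_on ::
  "(complex^'n::finite) set \<Rightarrow> (complex^'n \<Rightarrow> complex^'m::finite) \<Rightarrow> bool" where
  "holomorphic_map_on S f \<longleftrightarrow>
     (\<forall>z\<in>S. \<exists>D. (f has_derivative D) (at z) \<and> (\<forall>c v. D (c *s v) = c *s D v))"

section \<open>Real and complex coordinates\<close>

text \<open>The Latin indices \<open>1,\<dots>,2n\<close> are the elements of \<open>'n + 'n\<close>: \<open>Inl \<alpha>\<close> stands for \<open>\<alpha>\<close>
  and \<open>Inr \<alpha>\<close> for \<open>\<alpha>\<^sup>* = \<alpha> + n\<close>. The same two maps convert base coordinates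
  (\<open>z = x + i x\<^sup>*\<close>) and fibre coordinates (\<open>v = y + i y\<^sup>*\<close>); in the fibre this
  is the identification \<open>y \<mapsto> (y - i J y) / 2\<close> of the real tangent bundle with the bundle of
  vectors of type \<open>(1,0)\<close>.\<close>

definition z_of :: "real^('n::finite + 'n) \<Rightarrow> complex^'n" where
  "z_of x = (\<chi> \<alpha>. Complex (x $ Inl \<alpha>) (x $ Inr \<alpha>))"

definition x_of :: "complex^'n::finite \<Rightarrow> real^('n + 'n)" where
  "x_of z = (\<chi> j. case j of Inl \<alpha> \<Rightarrow> Re (z $ \<alpha>) | Inr \<alpha> \<Rightarrow> Im (z $ \<alpha>))"

text \<open>The complex structure on component vectors, which maps the frame vector with index \<open>Inl \<alpha>\<close> to the
  one with index \<open>Inr \<alpha>\<close>, and the latter to minus the former. It serves for \<open>J\<close> on real tangent vectors, for its complex linear extension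
  to complexified vectors, and for the restriction of \<open>\<^bold>J\<close> to vertical vectors.\<close>

definition Jop :: "('a::group_add)^('n::finite + 'n) \<Rightarrow> 'a^('n + 'n)" where
  "Jop w = (\<chi> j. case j of Inl \<alpha> \<Rightarrow> - (w $ Inr \<alpha>) | Inr \<alpha> \<Rightarrow> w $ Inl \<alpha>)"

section \<open>Complex manifolds and their tangent bundles\<close>

type_synonym ('m, 'n) cchart = "'m set \<times> ('m \<Rightarrow> complex^'n)"

definition transition :: "('m, 'n::finite) cchart \<Rightarrow> ('m, 'n) cchart \<Rightarrow> complex^'n \<Rightarrow> complex^'n" where
  "transition c d = snd d \<circ> inv_into (fst c) (snd c)"

definition is_cchart :: "('m::topological_space, 'n::finite) cchart \<Rightarrow> bool" where
  "is_cchart c \<longleftrightarrow> open (fst c) \<and> open (snd c ` fst c) \<and>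
     homeomorphism (fst c) (snd c ` fst c) (snd c) (inv_into (fst c) (snd c))"

definition complex_manifold ::
  "('m::{t2_space,second_countable_topology}, 'n::finite) cchart set \<Rightarrow> bool" where
  "complex_manifold A \<longleftrightarrow>
     (\<forall>c\<in>A. is_cchart c) \<and> (\<Union>c\<in>A. fst c) = UNIV \<and>
     (\<forall>c\<in>A. \<forall>d\<in>A. holomorphic_map_on (snd c ` (fst c \<inter> fst d)) (transition c d))"

text \<open>A tangent vector at \<open>p\<close> is the family of its components in all the charts around \<open>p\<close>,
  subject to the transformation law. Components in charts that do not contain \<open>p\<close> are set to
  \<open>0\<close>, so that equality of families is equality of tangent vectors.\<close>

definition T10 :: "('m, 'n::finite) cchart set \<Rightarrow> 'm \<Rightarrow> (('m, 'n) cchart \<Rightarrow> complex^'n) set" where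
  "T10 A p = {\<xi>.
     (\<forall>c\<in>A. \<forall>d\<in>A. p \<in> fst c \<inter> fst d \<longrightarrow>
        \<xi> d = frechet_derivative (transition c d) (at (snd c p)) (\<xi> c)) \<and>
     (\<forall>c. \<not> (c \<in> A \<and> p \<in> fst c) \<longrightarrow> \<xi> c = 0)}"

definition TR :: "('m, 'n::finite) cchart set \<Rightarrow> 'm \<Rightarrow> (('m, 'n) cchart \<Rightarrow> real^('n + 'n)) set" where
  "TR A p = {\<eta>.
     (\<forall>c\<in>A. \<forall>d\<in>A. p \<in> fst c \<inter> fst d \<longrightarrow>
        \<eta> d = frechet_derivative (\<lambda>x. x_of (transition c d (z_of x))) (at (x_of (snd c p))) (\<eta> c)) \<and>
     (\<forall>c. \<not> (c \<in> A \<and> p \<in> fst c) \<longrightarrow> \<eta> c = 0)}"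

text \<open>The vector with components \<open>v\<close> in the chart \<open>c\<close>.\<close>

definition vec10 :: "('m, 'n::finite) cchart set \<Rightarrow> 'm \<Rightarrow> ('m, 'n) cchart \<Rightarrow> complex^'n
    \<Rightarrow> ('m, 'n) cchart \<Rightarrow> complex^'n" where
  "vec10 A p c v = (\<lambda>d. if d \<in> A \<and> p \<in> fst d
     then frechet_derivative (transition c d) (at (snd c p)) v else 0)"

text \<open>The coordinate domain, in real coordinates \<open>(x, y)\<close>, of the slit tangent bundle over \<open>c\<close>.\<close>

definition slit_dom :: "('m, 'n::finite) cchart \<Rightarrow> ((real^('n + 'n)) \<times> (real^('n + 'n))) set" where
  "slit_dom c = {(x, y). z_of x \<in> snd c ` fst c \<and> y \<noteq> 0}"

section \<open>Partial derivatives on the tangent bundle\<close>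

definition dx :: "'i::finite \<Rightarrow> (real^'i \<Rightarrow> real^'i \<Rightarrow> 'b::real_normed_vector)
    \<Rightarrow> real^'i \<Rightarrow> real^'i \<Rightarrow> 'b" where
  "dx j f x y = vector_derivative (\<lambda>t. f (x + t *\<^sub>R axis j 1) y) (at 0)"

definition dy :: "'i::finite \<Rightarrow> (real^'i \<Rightarrow> real^'i \<Rightarrow> 'b::real_normed_vector)
    \<Rightarrow> real^'i \<Rightarrow> real^'i \<Rightarrow> 'b" where
  "dy j f x y = vector_derivative (\<lambda>t. f x (y + t *\<^sub>R axis j 1)) (at 0)"

type_synonym 'n cfun = "real^('n + 'n) \<Rightarrow> real^('n + 'n) \<Rightarrow> complex"

definition dz :: "'n::finite \<Rightarrow> 'n cfun \<Rightarrow> 'n cfun" where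
  "dz \<alpha> f x y = (dx (Inl \<alpha>) f x y - \<i> * dx (Inr \<alpha>) f x y) / 2"

definition dv :: "'n::finite \<Rightarrow> 'n cfun \<Rightarrow> 'n cfun" where
  "dv \<alpha> f x y = (dy (Inl \<alpha>) f x y - \<i> * dy (Inr \<alpha>) f x y) / 2"

definition dvbar :: "'n::finite \<Rightarrow> 'n cfun \<Rightarrow> 'n cfun" where
  "dvbar \<alpha> f x y = (dy (Inl \<alpha>) f x y + \<i> * dy (Inr \<alpha>) f x y) / 2"

section \<open>The Cartan connection in local coordinates\<close>

text \<open>In this section and the next, \<open>L\<close> is the coordinate expression of \<open>F\<^sup>2\<close>.\<close>

type_synonym 'i rfun = "real^'i \<Rightarrow> real^'i \<Rightarrow> real"

definition gmat :: "'i::finite rfun \<Rightarrow> real^'i \<Rightarrow> real^'i \<Rightarrow> real^'i^'i" where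
  "gmat L x y = (\<chi> j k. dy j (dy k L) x y / 2)"

definition ginv :: "'i::finite rfun \<Rightarrow> 'i \<Rightarrow> 'i \<Rightarrow> 'i rfun" where
  "ginv L k l x y = matrix_inv (gmat L x y) $ k $ l"

definition spray :: "'i::finite rfun \<Rightarrow> 'i \<Rightarrow> 'i rfun" where
  "spray L k x y =
     (\<Sum>l\<in>UNIV. ginv L k l x y * ((\<Sum>a\<in>UNIV. dx a (dy l L) x y * y $ a) - dx l L x y)) / 4"

definition nonlin_conn :: "'i::finite rfun \<Rightarrow> 'i \<Rightarrow> 'i \<Rightarrow> 'i rfun" where
  "nonlin_conn L k j = dy j (spray L k)"

definition delta_x :: "'i::finite rfun \<Rightarrow> 'i \<Rightarrow> 'i rfun \<Rightarrow> 'i rfun" where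
  "delta_x L j f x y = dx j f x y - (\<Sum>k\<in>UNIV. nonlin_conn L k j x y * dy k f x y)"

text \<open>\<open>cartan_h L k j l\<close> and \<open>cartan_v L k j l\<close> have upper index \<open>k\<close>; the last index \<open>l\<close> is
  the direction of differentiation.\<close>

definition cartan_h :: "'i::finite rfun \<Rightarrow> 'i \<Rightarrow> 'i \<Rightarrow> 'i \<Rightarrow> 'i rfun" where
  "cartan_h L k j l x y = (\<Sum>s\<in>UNIV. ginv L k s x y / 2 *
     (delta_x L l (\<lambda>x y. gmat L x y $ s $ j) x y
      - delta_x L s (\<lambda>x y. gmat L x y $ j $ l) x y
      + delta_x L j (\<lambda>x y. gmat L x y $ l $ s) x y))"

definition cartan_v :: "'i::finite rfun \<Rightarrow> 'i \<Rightarrow> 'i \<Rightarrow> 'i \<Rightarrow> 'i rfun" where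
  "cartan_v L k j l x y = (\<Sum>s\<in>UNIV. ginv L k s x y * dy j (dy l (dy s L)) x y) / 4"

text \<open>A tangent vector of the tangent bundle is given by its components \<open>X = (a, b)\<close> with respect
  to the coordinate frame of \<open>(x, y)\<close>. Its components with respect to the adapted frame (the
  \<open>\<delta>/\<delta>x\<^sup>l\<close> and the vertical coordinate vectors) are \<open>a\<close> and \<open>vert_comp L x y X\<close>.\<close>

definition horizontal_space :: "'i::finite rfun \<Rightarrow> real^'i \<Rightarrow> real^'i \<Rightarrow> ((real^'i) \<times> (real^'i)) set" where
  "horizontal_space L x y = span (range (\<lambda>j. (axis j 1, \<chi> k. - nonlin_conn L k j x y)))"

definition vert_comp :: "'i::finite rfun \<Rightarrow> real^'i \<Rightarrow> real^'i \<Rightarrow> (real^'i) \<times> (real^'i) \<Rightarrow> real^'i" where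
  "vert_comp L x y X = (\<chi> l. snd X $ l + (\<Sum>j\<in>UNIV. nonlin_conn L l j x y * fst X $ j))"

text \<open>The covariant derivative at \<open>(x, y)\<close>, in the direction \<open>X\<close>, of a section of the vertical
  bundle with component functions \<open>Y\<close>.\<close>

definition cartan_nabla :: "'i::finite rfun \<Rightarrow> real^'i \<Rightarrow> real^'i \<Rightarrow> (real^'i) \<times> (real^'i)
    \<Rightarrow> ((real^'i) \<times> (real^'i) \<Rightarrow> real^'i) \<Rightarrow> real^'i" where
  "cartan_nabla L x y X Y = frechet_derivative Y (at (x, y)) X +
     (\<chi> k. \<Sum>j\<in>UNIV. Y (x, y) $ j *
        (\<Sum>l\<in>UNIV. fst X $ l * cartan_h L k j l x y + vert_comp L x y X $ l * cartan_v L k j l x y))"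

definition nabla_J :: "('n::finite + 'n) rfun \<Rightarrow> real^('n + 'n) \<Rightarrow> real^('n + 'n)
    \<Rightarrow> (real^('n + 'n)) \<times> (real^('n + 'n))
    \<Rightarrow> ((real^('n + 'n)) \<times> (real^('n + 'n)) \<Rightarrow> real^('n + 'n)) \<Rightarrow> real^('n + 'n)" where
  "nabla_J L x y X Y = cartan_nabla L x y X (\<lambda>q. Jop (Y q)) - Jop (cartan_nabla L x y X Y)"

section \<open>The complex connection coefficients in local coordinates\<close>

definition cplx :: "('n::finite + 'n) rfun \<Rightarrow> 'n cfun" where
  "cplx L x y = complex_of_real (L x y)"

text \<open>Row \<open>\<beta>\<close>, column \<open>\<tau>\<close> of \<open>Gmat\<close> is the Levi matrix entry with holomorphic index \<open>\<beta>\<close> and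
  conjugate index \<open>\<tau>\<close>; in \<open>Ginv L \<tau> \<alpha>\<close> the conjugate index comes first.\<close>

definition Gmat :: "('n::finite + 'n) rfun \<Rightarrow> real^('n + 'n) \<Rightarrow> real^('n + 'n) \<Rightarrow> complex^'n^'n" where
  "Gmat L x y = (\<chi> \<beta> \<tau>. dv \<beta> (dvbar \<tau> (cplx L)) x y)"

definition Ginv :: "('n::finite + 'n) rfun \<Rightarrow> 'n \<Rightarrow> 'n \<Rightarrow> 'n cfun" where
  "Ginv L \<tau> \<alpha> x y = matrix_inv (Gmat L x y) $ \<tau> $ \<alpha>"

definition cnonlin_conn :: "('n::finite + 'n) rfun \<Rightarrow> 'n \<Rightarrow> 'n \<Rightarrow> 'n cfun" where
  "cnonlin_conn L \<alpha> \<mu> x y = (\<Sum>\<tau>\<in>UNIV. Ginv L \<tau> \<alpha> x y * dz \<mu> (dvbar \<tau> (cplx L)) x y)"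

definition delta_z :: "('n::finite + 'n) rfun \<Rightarrow> 'n \<Rightarrow> 'n cfun \<Rightarrow> 'n cfun" where
  "delta_z L \<mu> f x y = dz \<mu> f x y - (\<Sum>\<alpha>\<in>UNIV. cnonlin_conn L \<alpha> \<mu> x y * dv \<alpha> f x y)"

text \<open>\<open>ccoeff L \<alpha> \<beta> \<mu>\<close> has upper index \<open>\<alpha>\<close>; the last index \<open>\<mu>\<close> is the direction of
  differentiation.\<close>

definition ccoeff :: "('n::finite + 'n) rfun \<Rightarrow> 'n \<Rightarrow> 'n \<Rightarrow> 'n \<Rightarrow> 'n cfun" where
  "ccoeff L \<alpha> \<beta> \<mu> x y =
     (\<Sum>\<tau>\<in>UNIV. Ginv L \<tau> \<alpha> x y * delta_z L \<mu> (\<lambda>x y. Gmat L x y $ \<beta> $ \<tau>) x y)"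

section \<open>Strongly convex complex Finsler metrics\<close>

type_synonym ('m, 'n) finsler_fun = "'m \<Rightarrow> (('m, 'n) cchart \<Rightarrow> complex^'n) \<Rightarrow> real"

definition local_F :: "('m, 'n::finite) cchart set \<Rightarrow> ('m, 'n) finsler_fun \<Rightarrow> ('m, 'n) cchart
    \<Rightarrow> ('n + 'n) rfun" where
  "local_F A F c x y =
     (let p = inv_into (fst c) (snd c) (z_of x) in F p (vec10 A p c (z_of y)))"

definition local_L :: "('m, 'n::finite) cchart set \<Rightarrow> ('m, 'n) finsler_fun \<Rightarrow> ('m, 'n) cchart
    \<Rightarrow> ('n + 'n) rfun" where
  "local_L A F c x y = (local_F A F c x y)\<^sup>2"

definition strongly_convex_finsler ::
  "('m, 'n::finite) cchart set \<Rightarrow> ('m, 'n) finsler_fun \<Rightarrow> bool" where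
  "strongly_convex_finsler A F \<longleftrightarrow>
     (\<forall>p. \<forall>\<xi>\<in>T10 A p. 0 \<le> F p \<xi>) \<and>
     (\<forall>p. \<forall>\<xi>\<in>T10 A p. \<xi> \<noteq> (\<lambda>_. 0) \<longrightarrow> 0 < F p \<xi>) \<and>
     (\<forall>p. \<forall>\<xi>\<in>T10 A p. \<forall>a. F p (\<lambda>c. a *s \<xi> c) = cmod a * F p \<xi>) \<and>
     (\<forall>c\<in>A. smooth_on (slit_dom c) (\<lambda>(x, y). local_F A F c x y)) \<and>
     (\<forall>c\<in>A. \<forall>(x, y)\<in>slit_dom c. \<forall>u. u \<noteq> 0 \<longrightarrow> 0 < u \<bullet> (gmat (local_L A F c) x y *v u))"

definition kahler_finsler :: "('m, 'n::finite) cchart set \<Rightarrow> ('m, 'n) finsler_fun \<Rightarrow> bool" where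
  "kahler_finsler A F \<longleftrightarrow> (\<forall>c\<in>A. \<forall>(x, y)\<in>slit_dom c. \<forall>\<alpha> \<beta> \<mu>.
     ccoeff (local_L A F c) \<alpha> \<beta> \<mu> x y = ccoeff (local_L A F c) \<alpha> \<mu> \<beta> x y)"

definition weakly_kahler_finsler :: "('m, 'n::finite) cchart set \<Rightarrow> ('m, 'n) finsler_fun \<Rightarrow> bool" where
  "weakly_kahler_finsler A F \<longleftrightarrow> (\<forall>c\<in>A. \<forall>(x, y)\<in>slit_dom c. \<forall>\<mu>.
     (\<Sum>\<alpha>\<in>UNIV. \<Sum>\<beta>\<in>UNIV. dv \<alpha> (cplx (local_L A F c)) x y *
        (ccoeff (local_L A F c) \<alpha> \<beta> \<mu> x y - ccoeff (local_L A F c) \<alpha> \<mu> \<beta> x y) * z_of y $ \<beta>) = 0)"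

definition complex_berwald :: "('m, 'n::finite) cchart set \<Rightarrow> ('m, 'n) finsler_fun \<Rightarrow> bool" where
  "complex_berwald A F \<longleftrightarrow>
     (\<forall>c\<in>A. \<forall>x y y'. (x, y) \<in> slit_dom c \<and> (x, y') \<in> slit_dom c \<longrightarrow>
        (\<forall>\<alpha> \<beta> \<mu>. ccoeff (local_L A F c) \<alpha> \<beta> \<mu> x y = ccoeff (local_L A F c) \<alpha> \<beta> \<mu> x y'))"

definition strongly_convex_kahler_berwald ::
  "('m, 'n::finite) cchart set \<Rightarrow> ('m, 'n) finsler_fun \<Rightarrow> bool" where
  "strongly_convex_kahler_berwald A F \<longleftrightarrow>
     strongly_convex_finsler A F \<and> kahler_finsler A F \<and> complex_berwald A F"

text \<open>\<open>\<nabla>\<^sub>X \<^bold>J \<equiv> 0\<close> for horizontal \<open>X\<close>. The sections \<open>Y\<close> are local smooth sections of the vertical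
  bundle, given by their components over open subsets of a coordinate domain.\<close>

definition J_horizontally_parallel :: "('m, 'n::finite) cchart set \<Rightarrow> ('m, 'n) finsler_fun \<Rightarrow> bool" where
  "J_horizontally_parallel A F \<longleftrightarrow>
     (\<forall>c\<in>A. \<forall>W Y. open W \<and> W \<subseteq> slit_dom c \<and> smooth_on W Y \<longrightarrow>
        (\<forall>(x, y)\<in>W. \<forall>X\<in>horizontal_space (local_L A F c) x y.
           nabla_J (local_L A F c) x y X Y = 0))"

section \<open>Parallel transport along curves\<close>

definition curve_coord :: "('m, 'n::finite) cchart \<Rightarrow> (real \<Rightarrow> 'm) \<Rightarrow> real \<Rightarrow> real^('n + 'n)" where
  "curve_coord c \<sigma> t = x_of (snd c (\<sigma> t))"

definition velocity :: "('m, 'n::finite) cchart \<Rightarrow> (real \<Rightarrow> 'm) \<Rightarrow> real \<Rightarrow> real^('n + 'n)" where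
  "velocity c \<sigma> t = vector_derivative (curve_coord c \<sigma>) (at t within {0..1})"

definition smooth_regular_curve ::
  "('m::topological_space, 'n::finite) cchart set \<Rightarrow> (real \<Rightarrow> 'm) \<Rightarrow> bool" where
  "smooth_regular_curve A \<sigma> \<longleftrightarrow> continuous_on {0..1} \<sigma> \<and>
     (\<forall>c\<in>A. smooth_on {t \<in> {0..1}. \<sigma> t \<in> fst c} (curve_coord c \<sigma>) \<and>
        (\<forall>t\<in>{0..1}. \<sigma> t \<in> fst c \<longrightarrow> velocity c \<sigma> t \<noteq> 0))"

definition parallel_along :: "('m, 'n::finite) cchart set \<Rightarrow> ('m, 'n) finsler_fun \<Rightarrow> (real \<Rightarrow> 'm)
    \<Rightarrow> (real \<Rightarrow> ('m, 'n) cchart \<Rightarrow> real^('n + 'n)) \<Rightarrow> bool" where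
  "parallel_along A F \<sigma> V \<longleftrightarrow>
     (\<forall>t\<in>{0..1}. V t \<in> TR A (\<sigma> t)) \<and>
     (\<forall>c\<in>A. \<forall>t\<in>{0..1}. \<sigma> t \<in> fst c \<longrightarrow>
        (\<exists>D. ((\<lambda>s. V s c) has_vector_derivative D) (at t within {0..1}) \<and>
          (\<forall>k. D $ k + (\<Sum>l\<in>UNIV. \<Sum>j\<in>UNIV. V t c $ l *
             cartan_h (local_L A F c) k l j (curve_coord c \<sigma> t) (velocity c \<sigma> t) *
             velocity c \<sigma> t $ j) = 0)))"

definition parallel_transport :: "('m, 'n::finite) cchart set \<Rightarrow> ('m, 'n) finsler_fun \<Rightarrow> (real \<Rightarrow> 'm)
    \<Rightarrow> real \<Rightarrow> real \<Rightarrow> (('m, 'n) cchart \<Rightarrow> real^('n + 'n)) \<Rightarrow> (('m, 'n) cchart \<Rightarrow> real^('n + 'n)) \<Rightarrow> bool" where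
  "parallel_transport A F \<sigma> s t a b \<longleftrightarrow> (\<exists>V. parallel_along A F \<sigma> V \<and> V s = a \<and> V t = b)"

text \<open>A complexified tangent vector is the family of its complex components in all charts; its real
  and imaginary parts (with respect to real tangent vectors) are taken componentwise.\<close>

definition Re_part :: "(('m, 'n::finite) cchart \<Rightarrow> complex^('n + 'n)) \<Rightarrow> ('m, 'n) cchart \<Rightarrow> real^('n + 'n)" where
  "Re_part Z c = (\<chi> j. Re (Z c $ j))"

definition Im_part :: "(('m, 'n::finite) cchart \<Rightarrow> complex^('n + 'n)) \<Rightarrow> ('m, 'n) cchart \<Rightarrow> real^('n + 'n)" where
  "Im_part Z c = (\<chi> j. Im (Z c $ j))"

definition TC :: "('m, 'n::finite) cchart set \<Rightarrow> 'm \<Rightarrow> (('m, 'n) cchart \<Rightarrow> complex^('n + 'n)) set" where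
  "TC A p = {Z. Re_part Z \<in> TR A p \<and> Im_part Z \<in> TR A p}"

definition type10 :: "('m, 'n::finite) cchart set \<Rightarrow> 'm \<Rightarrow> (('m, 'n) cchart \<Rightarrow> complex^('n + 'n)) set" where
  "type10 A p = {Z \<in> TC A p. \<forall>c. Jop (Z c) = \<i> *s Z c}"

definition type01 :: "('m, 'n::finite) cchart set \<Rightarrow> 'm \<Rightarrow> (('m, 'n) cchart \<Rightarrow> complex^('n + 'n)) set" where
  "type01 A p = {Z \<in> TC A p. \<forall>c. Jop (Z c) = - \<i> *s Z c}"

text \<open>The complex linear extension of parallel transport.\<close>

definition complex_parallel_transport :: "('m, 'n::finite) cchart set \<Rightarrow> ('m, 'n) finsler_fun
    \<Rightarrow> (real \<Rightarrow> 'm) \<Rightarrow> real \<Rightarrow> real \<Rightarrow> (('m, 'n) cchart \<Rightarrow> complex^('n + 'n))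
    \<Rightarrow> (('m, 'n) cchart \<Rightarrow> complex^('n + 'n)) \<Rightarrow> bool" where
  "complex_parallel_transport A F \<sigma> s t Z W \<longleftrightarrow>
     parallel_transport A F \<sigma> s t (Re_part Z) (Re_part W) \<and>
     parallel_transport A F \<sigma> s t (Im_part Z) (Im_part W)"

definition types_preserved_along ::
  "('m, 'n::finite) cchart set \<Rightarrow> ('m, 'n) finsler_fun \<Rightarrow> (real \<Rightarrow> 'm) \<Rightarrow> bool" where
  "types_preserved_along A F \<sigma> \<longleftrightarrow>
     (\<forall>s\<in>{0..1}. \<forall>t\<in>{0..1}. \<forall>Z W. complex_parallel_transport A F \<sigma> s t Z W \<longrightarrow>
        (Z \<in> type10 A (\<sigma> s) \<longrightarrow> W \<in> type10 A (\<sigma> t)) \<and>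
        (Z \<in> type01 A (\<sigma> s) \<longrightarrow> W \<in> type01 A (\<sigma> t)))"

definition J_preserves_parallel_along ::
  "('m, 'n::finite) cchart set \<Rightarrow> ('m, 'n) finsler_fun \<Rightarrow> (real \<Rightarrow> 'm) \<Rightarrow> bool" where
  "J_preserves_parallel_along A F \<sigma> \<longleftrightarrow>
     (\<forall>V. parallel_along A F \<sigma> V \<longrightarrow> parallel_along A F \<sigma> (\<lambda>t c. Jop (V t c)))"

end

theory Submission
  imports Defs "HOL-Complex_Analysis.Complex_Analysis"
begin

text \<open>
  The equivalences hold because each of the four conditions amounts to one property of the real
  nonlinear connection \<open>N\<close>, the fibre derivative of the spray \<open>S\<close>: for every nonzero tangent
  vector \<open>y\<close> at \<open>x\<close> the map \<open>u \<mapsto> N u x y\<close> is complex linear. The proof goes round the circle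
  (1) \<open>\<Longrightarrow>\<close> (4) \<open>\<Longrightarrow>\<close> \<open>N\<close> complex linear \<open>\<Longrightarrow>\<close> (3) \<open>\<Longrightarrow>\<close> (2) \<open>\<Longrightarrow>\<close> \<open>N\<close> complex linear
  \<open>\<Longrightarrow>\<close> (1).

  Three facts of real Finsler geometry about the square \<open>L\<close> of the metric are used. The horizontal
  distribution annihilates \<open>L\<close> (\<open>horizontal_L\<close>). The Cartan coefficients contracted with the base
  point \<open>y\<close> are \<open>N\<close> (\<open>cartan_contraction\<close>); this gives the second step, and it turns the equation
  of parallel fields along \<open>\<sigma>\<close> into \<open>V' = - N V \<sigma> \<sigma>'\<close>. A symmetric bilinear form on
  a fibre whose horizontal lift annihilates \<open>L\<close> is the Cartan connection on that fibre
  (\<open>symmetric_form_cartan\<close>).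

  (1) \<open>\<Longrightarrow>\<close> (4): the complex horizontal lift annihilates \<open>L\<close> (\<open>complex_horizontal_L\<close>), and the complex
  nonlinear connection is the contraction of the complex coefficients with \<open>v\<close>
  (\<open>ccoeff_contraction\<close>). If these coefficients are symmetric and independent of \<open>v\<close>, they form a
  bilinear form as in \<open>symmetric_form_cartan\<close>. So the Cartan connection is complex bilinear, and
  commutes with \<open>J\<close>.

  \<open>N\<close> complex linear \<open>\<Longrightarrow>\<close> (1): the spray is holomorphic on the punctured fibre, so its second
  fibre derivatives are holomorphic and homogeneous of degree \<open>0\<close>. They are bounded by their values on
  the unit sphere, hence constant on every complex line that avoids the origin, by Liouville's
  theorem; for \<open>n \<ge> 2\<close> such lines connect any two points. So the spray is quadratic and
  \<open>N u x y = B y u\<close> with \<open>B\<close> complex bilinear and symmetric. By \<open>horizontal_L\<close> the lift defined by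
  \<open>B\<close> annihilates \<open>L\<close>, and two differentiations along the fibre identify the coefficients of \<open>B\<close>
  with those of the complex connection (\<open>ccoeff_determined\<close>).

  \<open>N\<close> complex linear \<open>\<Longrightarrow>\<close> (3) is immediate from the equation of parallel fields. For (3) \<open>\<Longrightarrow>\<close> (2),
  \<open>V\<^sub>1 + i V\<^sub>2\<close> has type \<open>(1,0)\<close> when \<open>J V\<^sub>1 + V\<^sub>2 = 0\<close>; by (3) the left-hand side is parallel, and
  a parallel field that vanishes at one time vanishes always (\<open>parallel_unique\<close>). For
  (2) \<open>\<Longrightarrow>\<close> \<open>N\<close> complex linear, take along a short coordinate segment the parallel fields with initial
  values \<open>e\<close> and \<open>- J e\<close>: preservation of types gives \<open>J V\<^sub>1 + V\<^sub>2 = 0\<close>, and the derivative at time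
  \<open>0\<close> is the assertion. These fields are constructed in one chart, and they are parallel in
  the other charts by the transformation laws of the spray and of \<open>N\<close> (\<open>spray_change\<close>,
  \<open>nonlinear_connection_change\<close>). The second derivatives of the transition maps that occur there exist
  since the derivative of a holomorphic map in a fixed direction is again holomorphic
  (\<open>holomorphic_map_on_frechet_derivative\<close>).
\<close>

unbundle no Formal_Power_Series.fps_syntax

section \<open>Calculus of smooth functions on open sets\<close>

text \<open>Derivatives within an open set are ordinary derivatives, so each closure property of \<open>smooth_on\<close> on
  open sets follows from the corresponding rule for derivatives by induction on the order.\<close>

lemma Ck_on_cong:
  assumes "Ck_on k S f" "\<And>x. x \<in> S \<Longrightarrow> f x = g x"
  shows "Ck_on k S g"
  using assms
proof (induction k arbitrary: f g)
  case 0
  then show ?case by (auto cong: continuous_on_cong)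
next
  case (Suc k)
  have eq: "(f has_derivative D) (at x within S) \<longleftrightarrow> (g has_derivative D) (at x within S)"
    if "x \<in> S" for x D
    using has_derivative_transform[of x S f g D] has_derivative_transform[of x S g f D]
    by (metis Suc.prems(2) that)
  then have "frechet_derivative f (at x within S) = frechet_derivative g (at x within S)"
    if "x \<in> S" for x
    using that unfolding frechet_derivative_def by simp
  moreover have "g differentiable_on S"
    using Suc.prems(1) eq by (auto simp: differentiable_on_def differentiable_def)
  moreover have "Ck_on k S (\<lambda>x. frechet_derivative g (at x within S) h)" for h
    using Suc.prems(1) calculation(1)
    by - (rule Suc.IH[of "\<lambda>x. frechet_derivative f (at x within S) h"], auto)
  ultimately show ?case by simp
qed

lemma Ck_on_SucI:
  assumes "\<And>x. x \<in> S \<Longrightarrow> (f has_derivative D x) (at x)"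
    and "open S" "\<And>h. Ck_on k S (\<lambda>x. D x h)"
  shows "Ck_on (Suc k) S f"
proof -
  have "frechet_derivative f (at x within S) = D x" if "x \<in> S" for x
    by (simp only: at_within_open[OF that assms(2)] frechet_derivative_at[OF assms(1)[OF that], symmetric])
  moreover have "f differentiable_on S"
    using assms(1) by (auto simp: differentiable_on_def differentiable_def intro: has_derivative_at_withinI)
  moreover from calculation(1) have "Ck_on k S (\<lambda>x. frechet_derivative f (at x within S) h)" for h
    by - (rule Ck_on_cong[OF assms(3)[of h]], simp)
  ultimately show ?thesis by simp
qed

lemma Ck_on_SucD:
  assumes "Ck_on (Suc k) S f" "open S"
  shows "\<And>x. x \<in> S \<Longrightarrow> (f has_derivative frechet_derivative f (at x)) (at x)"
    and "\<And>h. Ck_on k S (\<lambda>x. frechet_derivative f (at x) h)"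
proof -
  have "f differentiable_on S" using assms(1) by simp
  then have "f differentiable at x" if "x \<in> S" for x
    using that assms(2) by (metis differentiable_on_def at_within_open)
  then show "\<And>x. x \<in> S \<Longrightarrow> (f has_derivative frechet_derivative f (at x)) (at x)"
    by (simp add: frechet_derivative_works)
  fix h
  have "Ck_on k S (\<lambda>x. frechet_derivative f (at x within S) h)"
    using assms(1) by simp
  then show "Ck_on k S (\<lambda>x. frechet_derivative f (at x) h)"
    by (rule Ck_on_cong) (metis at_within_open assms(2))
qed

lemma Ck_on_pred:
  assumes "Ck_on (Suc k) S f" "open S"
  shows "Ck_on k S f"
  using assms(1)
proof (induction k arbitrary: f)
  case 0
  then show ?case by (auto intro: differentiable_imp_continuous_on)
next
  case (Suc k)
  show ?case
    by (rule Ck_on_SucI[OF Ck_on_SucD(1)[OF Suc.prems assms(2)] assms(2)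
          Suc.IH[OF Ck_on_SucD(2)[OF Suc.prems assms(2)]]])
qed

lemma Ck_on_const: "open S \<Longrightarrow> Ck_on k S (\<lambda>x. c)"
proof (induction k arbitrary: c)
  case (Suc k)
  show ?case
    by (rule Ck_on_SucI[where D = "\<lambda>x h. 0"]) (use Suc in auto)
qed simp

lemma Ck_on_add: "Ck_on k S f \<Longrightarrow> Ck_on k S g \<Longrightarrow> open S \<Longrightarrow> Ck_on k S (\<lambda>x. f x + g x)"
proof (induction k arbitrary: f g)
  case (Suc k)
  show ?case
    by (rule Ck_on_SucI[OF has_derivative_add[OF Ck_on_SucD(1)[OF Suc.prems(1,3)]
            Ck_on_SucD(1)[OF Suc.prems(2,3)]] Suc.prems(3)]; (assumption | intro Suc.IH Ck_on_SucD(2)[OF Suc.prems(1)] Ck_on_SucD(2)[OF Suc.prems(2)] Suc.prems(3))+)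
qed (auto intro: continuous_intros)

lemma Ck_on_bounded_linear:
  assumes "bounded_linear l" "open S" "Ck_on k S f"
  shows "Ck_on k S (\<lambda>x. l (f x))"
  using assms(3)
proof (induction k arbitrary: f)
  case 0
  then show ?case by (auto intro: bounded_linear.continuous_on[OF assms(1)])
next
  case (Suc k)
  show ?case
    by (rule Ck_on_SucI[OF bounded_linear.has_derivative[OF assms(1)] assms(2) Suc.IH])
       (auto intro: Ck_on_SucD[OF Suc.prems assms(2)])
qed

lemma Ck_on_bounded_bilinear:
  assumes "bounded_bilinear mu" "open S" "Ck_on k S f" "Ck_on k S g"
  shows "Ck_on k S (\<lambda>x. mu (f x) (g x))"
  using assms(3,4)
proof (induction k arbitrary: f g)
  case 0
  then show ?case by (auto intro: bounded_bilinear.continuous_on[OF assms(1)])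
next
  case (Suc k)
  note f = Suc.prems(1) and g = Suc.prems(2)
  show ?case
    by (rule Ck_on_SucI[OF bounded_bilinear.FDERIV[OF assms(1) Ck_on_SucD(1)[OF f assms(2)]
            Ck_on_SucD(1)[OF g assms(2)]] assms(2)];
        (assumption | intro Ck_on_add Suc.IH Ck_on_SucD(2)[OF f] Ck_on_SucD(2)[OF g] Ck_on_pred[OF f] Ck_on_pred[OF g] assms(2))+)
qed

lemma Ck_on_inverse:
  fixes f :: "'a::euclidean_space \<Rightarrow> real"
  assumes "open S" "Ck_on k S f" "\<And>x. x \<in> S \<Longrightarrow> f x \<noteq> 0"
  shows "Ck_on k S (\<lambda>x. inverse (f x))"
  using assms(2)
proof (induction k)
  case 0
  then show ?case using assms(3) by (auto intro: continuous_intros)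
next
  case (Suc k)
  note m = Ck_on_bounded_bilinear[OF bounded_bilinear_mult assms(1)]
  have i: "Ck_on k S (\<lambda>x. inverse (f x))"
    by (rule Suc.IH[OF Ck_on_pred[OF Suc.prems assms(1)]])
  have D: "((\<lambda>x. inverse (f x)) has_derivative
      (\<lambda>h. - (inverse (f x) * frechet_derivative f (at x) h * inverse (f x)))) (at x)" if "x \<in> S" for x
    using Deriv.has_derivative_inverse[OF assms(3)[OF that] Ck_on_SucD(1)[OF Suc.prems assms(1) that]]
    by simp
  show ?case
    by (rule Ck_on_SucI[OF D assms(1)]; (assumption | intro Ck_on_bounded_linear[OF bounded_linear_minus[OF bounded_linear_ident] assms(1)] m i
          Ck_on_SucD(2)[OF Suc.prems assms(1)])+)
qed

lemma smooth_on_cong: "smooth_on S f \<Longrightarrow> (\<And>x. x \<in> S \<Longrightarrow> f x = g x) \<Longrightarrow> smooth_on S g"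
  unfolding smooth_on_def using Ck_on_cong by blast

lemma smooth_on_const: "open S \<Longrightarrow> smooth_on S (\<lambda>x. c)"
  by (simp add: smooth_on_def Ck_on_const)

lemma smooth_on_add: "smooth_on S f \<Longrightarrow> smooth_on S g \<Longrightarrow> open S \<Longrightarrow> smooth_on S (\<lambda>x. f x + g x)"
  by (simp add: smooth_on_def Ck_on_add)

lemma smooth_on_bounded_linear:
  "bounded_linear l \<Longrightarrow> smooth_on S f \<Longrightarrow> open S \<Longrightarrow> smooth_on S (\<lambda>x. l (f x))"
  by (simp add: smooth_on_def Ck_on_bounded_linear)

lemma smooth_on_mult:
  fixes f g :: "'a::euclidean_space \<Rightarrow> 'b::real_normed_algebra"
  shows "smooth_on S f \<Longrightarrow> smooth_on S g \<Longrightarrow> open S \<Longrightarrow> smooth_on S (\<lambda>x. f x * g x)"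
  by (simp add: smooth_on_def Ck_on_bounded_bilinear[OF bounded_bilinear_mult])

lemma smooth_on_scaleR:
  "smooth_on S f \<Longrightarrow> smooth_on S g \<Longrightarrow> open S \<Longrightarrow> smooth_on S (\<lambda>x. f x *\<^sub>R g x)"
  by (simp add: smooth_on_def Ck_on_bounded_bilinear[OF bounded_bilinear_scaleR])

lemma smooth_on_divide:
  fixes f g :: "'a::euclidean_space \<Rightarrow> real"
  assumes "smooth_on S f" "smooth_on S g" "open S" "\<And>x. x \<in> S \<Longrightarrow> g x \<noteq> 0"
  shows "smooth_on S (\<lambda>x. f x / g x)"
  unfolding divide_inverse
  by (rule smooth_on_mult) (use assms in \<open>auto simp: smooth_on_def intro: Ck_on_inverse\<close>)

lemma smooth_on_minus: "smooth_on S f \<Longrightarrow> open S \<Longrightarrow> smooth_on S (\<lambda>x. - f x)"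
  by (rule smooth_on_bounded_linear[OF bounded_linear_minus[OF bounded_linear_ident]])

lemma smooth_on_diff: "smooth_on S f \<Longrightarrow> smooth_on S g \<Longrightarrow> open S \<Longrightarrow> smooth_on S (\<lambda>x. f x - g x)"
  using smooth_on_add[of S f "\<lambda>x. - g x"] smooth_on_minus[of S g] by simp

lemma smooth_on_sum:
  "(\<And>i. i \<in> I \<Longrightarrow> smooth_on S (f i)) \<Longrightarrow> open S \<Longrightarrow> smooth_on S (\<lambda>x. \<Sum>i\<in>I. f i x)"
  by (induction I rule: infinite_finite_induct) (auto intro: smooth_on_const smooth_on_add)

lemma smooth_on_prod:
  fixes f :: "'i \<Rightarrow> 'a::euclidean_space \<Rightarrow> real"
  shows "(\<And>i. i \<in> I \<Longrightarrow> smooth_on S (f i)) \<Longrightarrow> open S \<Longrightarrow> smooth_on S (\<lambda>x. \<Prod>i\<in>I. f i x)"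
  by (induction I rule: infinite_finite_induct) (auto intro: smooth_on_const smooth_on_mult)

lemma smooth_on_has_derivative:
  assumes "smooth_on S f" "open S" "x \<in> S"
  shows "(f has_derivative frechet_derivative f (at x)) (at x)"
  using assms Ck_on_SucD(1) unfolding smooth_on_def by blast

lemma smooth_on_frechet_derivative:
  assumes "smooth_on S f" "open S"
  shows "smooth_on S (\<lambda>x. frechet_derivative f (at x) h)"
  using assms Ck_on_SucD(2) unfolding smooth_on_def by blast

lemma smooth_on_continuous_on: "smooth_on S f \<Longrightarrow> continuous_on S f"
  unfolding smooth_on_def by (metis Ck_on.simps(1))

lemma smooth_on_if_linear: "linear l \<Longrightarrow> open S \<Longrightarrow> smooth_on S l"
proof -
  assume l: "linear l" "open S"
  have "Ck_on k S l" for k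
  proof (cases k)
    case 0
    then show ?thesis using l by (simp add: linear_continuous_on linear_conv_bounded_linear)
  next
    case (Suc j)
    show ?thesis unfolding Suc
      by (rule Ck_on_SucI[where D = "\<lambda>x. l"])
         (use l in \<open>auto simp: linear_conv_bounded_linear bounded_linear_imp_has_derivative Ck_on_const\<close>)
  qed
  then show ?thesis by (simp add: smooth_on_def)
qed

lemma smooth_on_compose_linear:
  fixes l :: "'a::euclidean_space \<Rightarrow> 'b::euclidean_space"
  assumes l: "linear l" and f: "smooth_on S f" and S: "open S"
  shows "smooth_on {x. l x \<in> S} (\<lambda>x. f (l x))"
proof -
  have bl: "bounded_linear l" using l by (simp add: linear_conv_bounded_linear)
  have o: "open {x. l x \<in> S}"
    using open_vimage[OF S linear_continuous_on[OF bl, of UNIV]] by (simp add: vimage_def)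
  have "Ck_on k {x. l x \<in> S} (\<lambda>x. f (l x))" for k
    using f
  proof (induction k arbitrary: f)
    case 0
    show ?case
      using continuous_on_compose2[OF smooth_on_continuous_on[OF 0] linear_continuous_on[OF bl],
          of "{x. l x \<in> S}"]
      by (simp add: image_subset_iff)
  next
    case (Suc k)
    have D: "((\<lambda>x. f (l x)) has_derivative (\<lambda>h. frechet_derivative f (at (l x)) (l h))) (at x)" if "x \<in> {x. l x \<in> S}" for x
      by (rule has_derivative_compose[OF bounded_linear_imp_has_derivative[OF bl] smooth_on_has_derivative[OF Suc.prems S]])
         (use that in simp)
    show ?case
      by (rule Ck_on_SucI[OF D o Suc.IH[OF smooth_on_frechet_derivative[OF Suc.prems S]]])
  qed
  then show ?thesis by (simp add: smooth_on_def)
qed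

subsection \<open>Symmetry of second derivatives\<close>

text \<open>Two applications of the mean value theorem to the second difference
  \<open>f (p + t h + t k) - f (p + t h) - f (p + t k) + f p\<close>, which is symmetric in \<open>h\<close> and \<open>k\<close>.\<close>

lemma second_difference_mean_value:
  fixes f :: "'a::euclidean_space \<Rightarrow> real"
  assumes sm: "smooth_on S f" "open S" and t: "0 < t"
    and B: "\<And>s r. 0 \<le> s \<Longrightarrow> s \<le> t \<Longrightarrow> 0 \<le> r \<Longrightarrow> r \<le> t \<Longrightarrow> p + s *\<^sub>R h + r *\<^sub>R k \<in> S"
  shows "\<exists>s r. 0 < s \<and> s < t \<and> 0 < r \<and> r < t \<and>
    f (p + t *\<^sub>R h + t *\<^sub>R k) - f (p + t *\<^sub>R h) - f (p + t *\<^sub>R k) + f p =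
    t\<^sup>2 * frechet_derivative (\<lambda>q. frechet_derivative f (at q) h) (at (p + s *\<^sub>R h + r *\<^sub>R k)) k"
proof -
  define fh where "fh = (\<lambda>q. frechet_derivative f (at q) h)"
  have smh: "smooth_on S fh"
    unfolding fh_def by (rule smooth_on_frechet_derivative[OF sm])
  have d: "((\<lambda>s. g (q + s *\<^sub>R e)) has_real_derivative frechet_derivative g (at (q + s *\<^sub>R e)) e) (at s)"
    if g: "smooth_on S g" "q + s *\<^sub>R e \<in> S" for g :: "'a \<Rightarrow> real" and q e s
  proof -
    have D: "(g has_derivative frechet_derivative g (at (q + s *\<^sub>R e))) (at (q + s *\<^sub>R e))"
      using smooth_on_has_derivative[OF g(1) sm(2) g(2)] .
    have "((\<lambda>s. q + s *\<^sub>R e) has_derivative (\<lambda>r. r *\<^sub>R e)) (at s)"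
      by (auto intro!: derivative_eq_intros)
    from has_derivative_compose[OF this D]
    have "((\<lambda>s. g (q + s *\<^sub>R e)) has_derivative (\<lambda>r. frechet_derivative g (at (q + s *\<^sub>R e)) (r *\<^sub>R e))) (at s)" .
    moreover have "(\<lambda>r. frechet_derivative g (at (q + s *\<^sub>R e)) (r *\<^sub>R e)) =
        (*) (frechet_derivative g (at (q + s *\<^sub>R e)) e)"
      using linear_scale[OF has_derivative_linear[OF D]] by (auto simp: mult.commute)
    ultimately show ?thesis by (simp add: has_field_derivative_def)
  qed
  have "\<exists>s>0. s < t \<and> (f (p + t *\<^sub>R k + t *\<^sub>R h) - f (p + t *\<^sub>R h)) - (f (p + t *\<^sub>R k + 0 *\<^sub>R h) - f (p + 0 *\<^sub>R h))
      = (t - 0) * (fh (p + t *\<^sub>R k + s *\<^sub>R h) - fh (p + s *\<^sub>R h))"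
    using B[of _ t] B[of _ 0] t unfolding fh_def
    by (intro MVT2 DERIV_diff d[OF sm(1)]) (auto simp: algebra_simps)
  then obtain s where s: "0 < s" "s < t"
    "f (p + t *\<^sub>R h + t *\<^sub>R k) - f (p + t *\<^sub>R h) - f (p + t *\<^sub>R k) + f p
      = t * (fh (p + s *\<^sub>R h + t *\<^sub>R k) - fh (p + s *\<^sub>R h))"
    by (auto simp: algebra_simps)
  have "\<exists>r>0. r < t \<and> fh (p + s *\<^sub>R h + t *\<^sub>R k) - fh (p + s *\<^sub>R h + 0 *\<^sub>R k)
      = (t - 0) * frechet_derivative fh (at (p + s *\<^sub>R h + r *\<^sub>R k)) k"
    using B[of s] s t by (intro MVT2 d[OF smh]) auto
  then obtain r where "0 < r" "r < t"
    "fh (p + s *\<^sub>R h + t *\<^sub>R k) - fh (p + s *\<^sub>R h) = t * frechet_derivative fh (at (p + s *\<^sub>R h + r *\<^sub>R k)) k"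
    by auto
  with s show ?thesis
    by (intro exI[of _ s] exI[of _ r]) (simp add: fh_def power2_eq_square)
qed

text \<open>Divided by \<open>t\<^sup>2\<close>, the second difference tends to either mixed derivative as \<open>t\<close> tends to \<open>0\<close>.\<close>

lemma second_derivative_symmetric_real:
  fixes f :: "'a::euclidean_space \<Rightarrow> real"
  assumes sm: "smooth_on S f" "open S" and p: "p \<in> S"
  shows "frechet_derivative (\<lambda>q. frechet_derivative f (at q) h) (at p) k =
         frechet_derivative (\<lambda>q. frechet_derivative f (at q) k) (at p) h"
proof -
  define D where "D = (\<lambda>h k q. frechet_derivative (\<lambda>q. frechet_derivative f (at q) h) (at q) k)"
  have cont: "continuous (at p) (D h k)" for h k
    using smooth_on_continuous_on[OF smooth_on_frechet_derivative[OF smooth_on_frechet_derivative[OF sm] sm(2)]]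
      sm(2) p unfolding D_def by (auto simp: continuous_on_eq_continuous_at)
  have "dist (D h k p) (D k h p) < e" if e: "0 < e" for e :: real
  proof -
    obtain d0 where d0: "0 < d0" "ball p d0 \<subseteq> S"
      using sm(2) p openE by blast
    obtain d1 where d1: "0 < d1" "\<And>q. dist q p < d1 \<Longrightarrow> dist (D h k q) (D h k p) < e / 2"
      using cont[of h k] e by (auto simp: continuous_at_eps_delta dest!: spec[of _ "e / 2"])
    obtain d2 where d2: "0 < d2" "\<And>q. dist q p < d2 \<Longrightarrow> dist (D k h q) (D k h p) < e / 2"
      using cont[of k h] e by (auto simp: continuous_at_eps_delta dest!: spec[of _ "e / 2"])
    define d where "d = min d0 (min d1 d2)"
    define M where "M = norm h + norm k + 1"
    define t where "t = d / (2 * M)"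
    have dp: "0 < d" using d0 d1 d2 by (simp add: d_def)
    have n: "0 < M" by (simp add: M_def add_nonneg_pos)
    have t: "0 < t" using dp n by (simp add: t_def)
    have near: "dist (p + s *\<^sub>R h + r *\<^sub>R k) p < d" if "0 \<le> s" "s \<le> t" "0 \<le> r" "r \<le> t" for s r
    proof -
      have "dist (p + s *\<^sub>R h + r *\<^sub>R k) p = norm (s *\<^sub>R h + r *\<^sub>R k)"
        by (simp add: dist_norm)
      also have "\<dots> \<le> s * norm h + r * norm k"
        using norm_triangle_ineq[of "s *\<^sub>R h" "r *\<^sub>R k"] that by simp
      also have "\<dots> \<le> t * norm h + t * norm k"
        using that by (intro add_mono mult_right_mono) auto
      also have "\<dots> \<le> t * M" using t by (simp add: M_def algebra_simps)
      also have "\<dots> = d / 2" using n by (simp add: t_def)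
      also have "\<dots> < d" using dp by simp
      finally show ?thesis .
    qed
    have inS: "p + s *\<^sub>R h + r *\<^sub>R k \<in> S" if "0 \<le> s" "s \<le> t" "0 \<le> r" "r \<le> t" for s r
      using near[OF that] d0 by (auto simp: d_def dist_commute)
    have inS': "p + s *\<^sub>R k + r *\<^sub>R h \<in> S" if "0 \<le> s" "s \<le> t" "0 \<le> r" "r \<le> t" for s r
      using inS[OF that(3,4,1,2)] by (simp add: algebra_simps)
    obtain s r where 1: "0 < s" "s < t" "0 < r" "r < t"
      "f (p + t *\<^sub>R h + t *\<^sub>R k) - f (p + t *\<^sub>R h) - f (p + t *\<^sub>R k) + f p = t\<^sup>2 * D h k (p + s *\<^sub>R h + r *\<^sub>R k)"
      using second_difference_mean_value[OF sm t inS] unfolding D_def by blast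
    obtain s' r' where 2: "0 < s'" "s' < t" "0 < r'" "r' < t"
      "f (p + t *\<^sub>R k + t *\<^sub>R h) - f (p + t *\<^sub>R k) - f (p + t *\<^sub>R h) + f p = t\<^sup>2 * D k h (p + s' *\<^sub>R k + r' *\<^sub>R h)"
      using second_difference_mean_value[OF sm t inS'] unfolding D_def by blast
    have "t\<^sup>2 * D h k (p + s *\<^sub>R h + r *\<^sub>R k) = t\<^sup>2 * D k h (p + s' *\<^sub>R k + r' *\<^sub>R h)"
      using 1(5) 2(5) by (simp add: algebra_simps)
    then have eq: "D h k (p + s *\<^sub>R h + r *\<^sub>R k) = D k h (p + s' *\<^sub>R k + r' *\<^sub>R h)"
      using t by simp
    have "dist (D h k (p + s *\<^sub>R h + r *\<^sub>R k)) (D h k p) < e / 2"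
      using d1(2) near[of s r] 1 by (simp add: d_def)
    moreover have "dist (D k h (p + s' *\<^sub>R k + r' *\<^sub>R h)) (D k h p) < e / 2"
      using d2(2) near[of r' s'] 2 by (simp add: d_def algebra_simps)
    ultimately show ?thesis
      unfolding eq by (metis dist_commute dist_triangle_half_r)
  qed
  then show ?thesis
    unfolding D_def by (metis dist_pos_lt less_irrefl)
qed

lemma second_derivative_symmetric:
  fixes f :: "'a::euclidean_space \<Rightarrow> 'b::euclidean_space"
  assumes sm: "smooth_on S f" "open S" and p: "p \<in> S"
  shows "frechet_derivative (\<lambda>q. frechet_derivative f (at q) h) (at p) k =
         frechet_derivative (\<lambda>q. frechet_derivative f (at q) k) (at p) h"
proof (rule euclidean_eqI)
  fix b :: 'b assume "b \<in> Basis"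
  have sb: "smooth_on S (\<lambda>q. g q \<bullet> b)" and
    db: "q \<in> S \<Longrightarrow> frechet_derivative (\<lambda>q. g q \<bullet> b) (at q) = (\<lambda>h. frechet_derivative g (at q) h \<bullet> b)"
    if "smooth_on S g" for g :: "'a \<Rightarrow> 'b" and q
  proof -
    show "smooth_on S (\<lambda>q. g q \<bullet> b)"
      by (rule smooth_on_bounded_linear[OF bounded_linear_inner_left that sm(2)])
    show "frechet_derivative (\<lambda>q. g q \<bullet> b) (at q) = (\<lambda>h. frechet_derivative g (at q) h \<bullet> b)" if "q \<in> S"
      by (rule frechet_derivative_at[symmetric]
          has_derivative_inner_left smooth_on_has_derivative[OF \<open>smooth_on S g\<close> sm(2) that])+
  qed
  have *: "frechet_derivative (\<lambda>q. frechet_derivative f (at q) h) (at p) k \<bullet> b =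
      frechet_derivative (\<lambda>q. frechet_derivative (\<lambda>q. f q \<bullet> b) (at q) h) (at p) k" for h k
  proof -
    have "frechet_derivative (\<lambda>q. frechet_derivative (\<lambda>q. f q \<bullet> b) (at q) h) (at p) =
        frechet_derivative (\<lambda>q. frechet_derivative f (at q) h \<bullet> b) (at p)"
    proof (rule frechet_derivative_transform_within_open[OF _ sm(2) p])
      show "(\<lambda>q. frechet_derivative (\<lambda>q. f q \<bullet> b) (at q) h) differentiable at p"
        using smooth_on_has_derivative[OF smooth_on_frechet_derivative[OF sb[OF sm(1)] sm(2)] sm(2) p]
        by (rule differentiableI)
    qed (simp add: db[OF sm(1)])
    then show ?thesis
      by (simp add: db[OF smooth_on_frechet_derivative[OF sm] p])
  qed
  show "frechet_derivative (\<lambda>q. frechet_derivative f (at q) h) (at p) k \<bullet> b =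
      frechet_derivative (\<lambda>q. frechet_derivative f (at q) k) (at p) h \<bullet> b"
    unfolding * by (rule second_derivative_symmetric_real[OF sb[OF sm(1)] sm(2) p])
qed

section \<open>Holomorphic maps in several variables\<close>

text \<open>The scalar case of \<open>holomorphic_map_on\<close>, for the components of a holomorphic map.\<close>

definition complex_differentiable_on :: "(complex^'n::finite) set \<Rightarrow> (complex^'n \<Rightarrow> complex) \<Rightarrow> bool" where
  "complex_differentiable_on S g \<longleftrightarrow>
     (\<forall>z\<in>S. \<exists>D. (g has_derivative D) (at z) \<and> (\<forall>c v. D (c *s v) = c * D v))"

lemma bounded_bilinear_vector_scalar_mult:
  "bounded_bilinear (\<lambda>c (v::complex^'n::finite). c *s v)"
proof -
  have "bilinear (\<lambda>c (v::complex^'n::finite). c *s v)"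
    unfolding bilinear_def linear_iff
    by (auto simp: vec_eq_iff algebra_simps scaleR_conv_of_real[where 'a = complex])
  then show ?thesis by (simp add: bilinear_conv_bounded_bilinear)
qed

lemmas has_derivative_vector_scalar_mult [derivative_intros] =
  bounded_bilinear.FDERIV[OF bounded_bilinear_vector_scalar_mult]
lemmas continuous_on_vector_scalar_mult [continuous_intros] =
  bounded_bilinear.continuous_on[OF bounded_bilinear_vector_scalar_mult]

lemma complex_differentiable_onD:
  assumes "complex_differentiable_on S g" "z \<in> S"
  shows "(g has_derivative frechet_derivative g (at z)) (at z)"
    and "frechet_derivative g (at z) (c *s v) = c * frechet_derivative g (at z) v"
  using assms frechet_derivative_at unfolding complex_differentiable_on_def by metis+

lemma complex_differentiable_on_line:
  assumes "complex_differentiable_on S g" "z + \<zeta> *s u \<in> S"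
  shows "((\<lambda>\<zeta>. g (z + \<zeta> *s u)) has_field_derivative frechet_derivative g (at (z + \<zeta> *s u)) u) (at \<zeta>)"
proof -
  have "((\<lambda>\<zeta>. z + \<zeta> *s u) has_derivative (\<lambda>h. h *s u)) (at \<zeta>)"
    by (auto intro!: derivative_eq_intros)
  from has_derivative_compose[OF this complex_differentiable_onD(1)[OF assms]]
  have "((\<lambda>\<zeta>. g (z + \<zeta> *s u)) has_derivative (\<lambda>h. h * frechet_derivative g (at (z + \<zeta> *s u)) u)) (at \<zeta>)"
    by (simp only: complex_differentiable_onD(2)[OF assms])
  moreover have "(\<lambda>h. h * c) = (*) c" for c :: complex
    by (simp add: fun_eq_iff mult.commute)
  ultimately show ?thesis
    by (simp only: has_field_derivative_def)
qed

definition circ :: "real \<Rightarrow> real \<Rightarrow> complex" where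
  "circ r t = of_real r * exp (2 * of_real pi * \<i> * of_real t)"

lemma circ_facts:
  "continuous_on X (circ r)" "0 < r \<Longrightarrow> circ r t \<noteq> 0" "0 \<le> r \<Longrightarrow> cmod (circ r t) = r"
  by (auto simp: circ_def norm_mult intro!: continuous_intros)

text \<open>The one-variable Cauchy formula for the derivative at the centre of a circle in the complex line
  through \<open>z\<close> in the direction \<open>u\<close>.\<close>

lemma Cauchy_formula_directional_derivative:
  assumes g: "complex_differentiable_on S g" and r: "0 < r"
    and S: "\<And>\<zeta>. cmod \<zeta> \<le> r \<Longrightarrow> z + \<zeta> *s u \<in> S"
  shows "((\<lambda>t. g (z + circ r t *s u) / circ r t) has_integral frechet_derivative g (at z) u) {0..1}"
proof -
  define G where "G = (\<lambda>\<zeta>. g (z + \<zeta> *s u))"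
  have d: "(G has_field_derivative frechet_derivative g (at (z + \<zeta> *s u)) u) (at \<zeta>)" if "cmod \<zeta> \<le> r" for \<zeta>
    unfolding G_def by (rule complex_differentiable_on_line[OF g S[OF that]])
  have dG: "deriv G 0 = frechet_derivative g (at z) u"
    using DERIV_imp_deriv[OF d[of 0]] r by simp
  have "((\<lambda>w. G w / (w - 0) ^ Suc 1) has_contour_integral 2 * pi * \<i> / fact 1 * (deriv ^^ 1) G 0) (circlepath 0 r)"
  proof (rule Cauchy_has_contour_integral_higher_derivative_circlepath)
    show "continuous_on (cball 0 r) G"
      using d by (intro continuous_at_imp_continuous_on ballI DERIV_isCont) (auto simp: dist_norm)
    show "G holomorphic_on ball 0 r"
      unfolding holomorphic_on_def field_differentiable_def
      by (rule ballI, rule exI, rule has_field_derivative_at_within, rule d) (simp add: dist_norm)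
  qed (use r in auto)
  then have "((\<lambda>t. G (circlepath 0 r t) / circlepath 0 r t ^ 2 *
      vector_derivative (circlepath 0 r) (at t within {0..1})) has_integral 2 * pi * \<i> * deriv G 0) {0..1}"
    by (simp add: has_contour_integral_def power2_eq_square)
  moreover have "G (circlepath 0 r t) / circlepath 0 r t ^ 2 * vector_derivative (circlepath 0 r) (at t within {0..1})
      = (2 * pi * \<i>) * (g (z + circ r t *s u) / circ r t)" if "t \<in> {0..1}" for t
  proof -
    have "circlepath 0 r t = circ r t" by (simp add: circlepath circ_def)
    moreover have "vector_derivative (circlepath 0 r) (at t within {0..1}) = 2 * pi * \<i> * circ r t"
      using that by (simp add: vector_derivative_circlepath01 circ_def)
    ultimately show ?thesis
      using circ_facts(2)[OF r, of t] by (simp add: G_def power2_eq_square)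
  qed
  ultimately have "((\<lambda>t. (2 * pi * \<i>) * (g (z + circ r t *s u) / circ r t)) has_integral 2 * pi * \<i> * deriv G 0) {0..1}"
    by (rule has_integral_eq[rotated])
  moreover have "inverse (2 * pi * \<i>) * ((2 * pi * \<i>) * x) = x" for x
    by (simp add: field_simps)
  ultimately show ?thesis
    using has_integral_mult_right[of _ "2 * pi * \<i> * deriv G 0" "{0..1}" "inverse (2 * pi * \<i>)"]
    unfolding dG by fastforce
qed

text \<open>One radius serves in the Cauchy formula for all base points near \<open>z0\<close>.\<close>

lemma uniform_disc:
  fixes S :: "(complex^'n::finite) set"
  assumes "open S" "z0 \<in> S"
  obtains r d where "0 < r" "0 < d" "\<And>z \<zeta>. z \<in> ball z0 d \<Longrightarrow> cmod \<zeta> \<le> r \<Longrightarrow> z + \<zeta> *s u \<in> S"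
proof -
  obtain e where e: "0 < e" "ball z0 e \<subseteq> S"
    using assms openE by blast
  obtain K where K: "0 < K" "\<And>c v. norm (c *s (v::complex^'n)) \<le> norm c * norm v * K"
    using bounded_bilinear.pos_bounded[OF bounded_bilinear_vector_scalar_mult] by blast
  define M where "M = norm u * K + 1"
  define r where "r = e / (2 * M)"
  have pos: "0 < M" using K by (simp add: M_def add_nonneg_pos)
  have r: "0 < r" using e pos by (simp add: r_def)
  have "z + \<zeta> *s u \<in> S" if "z \<in> ball z0 (e / 2)" "cmod \<zeta> \<le> r" for z \<zeta>
  proof -
    have "norm (\<zeta> *s u) \<le> cmod \<zeta> * (norm u * K)" using K(2)[of \<zeta> u] by (simp add: mult.assoc)
    also have "\<dots> \<le> r * (norm u * K)" using that K by (intro mult_right_mono) auto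
    also have "\<dots> < r * M" using r by (simp add: M_def)
    also have "\<dots> = e / 2" using pos by (simp add: r_def)
    finally have "norm (\<zeta> *s u) < e / 2" .
    moreover have "dist z0 (z + \<zeta> *s u) \<le> dist z0 z + norm (\<zeta> *s u)"
      using dist_triangle[of z0 "z + \<zeta> *s u" z] by (simp add: dist_norm)
    ultimately have "dist z0 (z + \<zeta> *s u) < e" using that by auto
    then show ?thesis using e by auto
  qed
  then show ?thesis using r e that[of r "e / 2"] by auto
qed

text \<open>The Cauchy formula expresses the derivative by values of the function, which depend continuously on
  the base point.\<close>

lemma continuous_on_directional_derivative:
  assumes g: "complex_differentiable_on S g" and S: "open S"
  shows "continuous_on S (\<lambda>z. frechet_derivative g (at z) u)"
proof (rule continuous_at_imp_continuous_on, rule ballI)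
  fix z0 assume z0: "z0 \<in> S"
  obtain r d where rd: "0 < r" "0 < d" "\<And>z \<zeta>. z \<in> ball z0 d \<Longrightarrow> cmod \<zeta> \<le> r \<Longrightarrow> z + \<zeta> *s u \<in> S"
    using uniform_disc[OF S z0] by blast
  have eq: "integral (cbox 0 1) (\<lambda>t. g (z + circ r t *s u) / circ r t) = frechet_derivative g (at z) u"
    if "z \<in> ball z0 d" for z
    using Cauchy_formula_directional_derivative[OF g rd(1) rd(3)[OF that]] by (simp add: integral_unique)
  have cg: "continuous_on S g"
    using complex_differentiable_onD(1)[OF g] by (intro continuous_at_imp_continuous_on ballI has_derivative_continuous) auto
  have "continuous_on (ball z0 d) (\<lambda>z. integral (cbox 0 1) (\<lambda>t. g (z + circ r t *s u) / circ r t))"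
  proof (rule integral_continuous_on_param)
    have "continuous_on (ball z0 d \<times> cbox 0 1) (\<lambda>p. g (fst p + circ r (snd p) *s u) / circ r (snd p))"
      by (intro continuous_intros continuous_on_compose2[OF cg] continuous_on_compose2[OF circ_facts(1)[of UNIV]])
         (use rd in \<open>auto simp: circ_facts\<close>)
    then show "continuous_on (ball z0 d \<times> cbox 0 1) (\<lambda>(z, t). g (z + circ r t *s u) / circ r t)"
      by (simp add: case_prod_unfold)
  qed
  then have "continuous_on (ball z0 d) (\<lambda>z. frechet_derivative g (at z) u)"
    by (rule continuous_on_eq) (rule eq)
  then show "continuous (at z0) (\<lambda>z. frechet_derivative g (at z) u)"
    using rd(2) by (simp add: continuous_on_eq_continuous_at)
qed

text \<open>Differentiation under the integral sign in the Cauchy formula.\<close>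

lemma complex_differentiable_on_directional_derivative:
  fixes g :: "complex^'n::finite \<Rightarrow> complex"
  assumes g: "complex_differentiable_on S g" and S: "open S"
  shows "complex_differentiable_on S (\<lambda>z. frechet_derivative g (at z) u)"
  unfolding complex_differentiable_on_def
proof
  fix z0 assume z0: "z0 \<in> S"
  obtain r d where rd: "0 < r" "0 < d" "\<And>z \<zeta>. z \<in> ball z0 d \<Longrightarrow> cmod \<zeta> \<le> r \<Longrightarrow> z + \<zeta> *s u \<in> S"
    using uniform_disc[OF S z0] by blast
  have inS: "z + circ r t *s u \<in> S" if "z \<in> ball z0 d" for z t
    using rd that by (auto simp: circ_facts)
  define fx where "fx = (\<lambda>z t. Blinfun (\<lambda>h. frechet_derivative g (at (z + circ r t *s u)) h / circ r t))"
  have fx: "blinfun_apply (fx z t) = (\<lambda>h. frechet_derivative g (at (z + circ r t *s u)) h / circ r t)"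
    if "z \<in> ball z0 d" for z t
    unfolding fx_def
    by (rule bounded_linear_Blinfun_apply)
       (rule bounded_linear_compose[OF bounded_linear_divide
          has_derivative_bounded_linear[OF complex_differentiable_onD(1)[OF g inS[OF that]]]])
  have cg: "continuous_on S g"
    using complex_differentiable_onD(1)[OF g] by (intro continuous_at_imp_continuous_on ballI has_derivative_continuous) auto
  have cfx: "continuous_on (ball z0 d \<times> cbox 0 1) (\<lambda>(z, t). fx z t)"
  proof (rule continuous_on_blinfun_componentwise)
    fix i :: "complex^'n" assume "i \<in> Basis"
    have "continuous_on (ball z0 d \<times> cbox 0 1)
        (\<lambda>p. frechet_derivative g (at (fst p + circ r (snd p) *s u)) i / circ r (snd p))"
      by (intro continuous_intros continuous_on_compose2[OF continuous_on_directional_derivative[OF g S]]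
            continuous_on_compose2[OF circ_facts(1)[of UNIV]])
         (use rd inS in \<open>auto simp: circ_facts\<close>)
    then show "continuous_on (ball z0 d \<times> cbox 0 1) (\<lambda>p. blinfun_apply (case p of (z, t) \<Rightarrow> fx z t) i)"
      by (rule continuous_on_eq) (auto simp: fx)
  qed
  have D: "((\<lambda>z. integral (cbox 0 1) (\<lambda>t. g (z + circ r t *s u) / circ r t)) has_derivative
      blinfun_apply (integral (cbox 0 1) (fx z0))) (at z0 within ball z0 d)"
  proof (rule leibniz_rule[where fx = fx and U = "ball z0 d"])
    fix z t assume z: "z \<in> ball z0 d" 
    have "((\<lambda>z. g (z + circ r t *s u)) has_derivative frechet_derivative g (at (z + circ r t *s u))) (at z)"
      by (rule has_derivative_compose[where f = "\<lambda>z. z + circ r t *s u" and f' = "\<lambda>h. h",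
            OF _ complex_differentiable_onD(1)[OF g inS[OF z, of t]]])
         (auto intro!: derivative_eq_intros)
    then have "((\<lambda>z. g (z + circ r t *s u) / circ r t) has_derivative blinfun_apply (fx z t)) (at z)"
      unfolding fx[OF z] by (rule bounded_linear.has_derivative[OF bounded_linear_divide])
    then show "((\<lambda>z. g (z + circ r t *s u) / circ r t) has_derivative blinfun_apply (fx z t)) (at z within ball z0 d)"
      by (rule has_derivative_at_withinI)
  next
    fix z assume z: "z \<in> ball z0 d"
    show "(\<lambda>t. g (z + circ r t *s u) / circ r t) integrable_on cbox 0 1"
      by (intro integrable_continuous continuous_intros continuous_on_compose2[OF cg] circ_facts)
         (use z rd in \<open>auto simp: circ_facts\<close>)
  qed (use rd cfx in auto)
  have D': "((\<lambda>z. frechet_derivative g (at z) u) has_derivative blinfun_apply (integral (cbox 0 1) (fx z0))) (at z0)"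
  proof (rule has_derivative_transform_within_open[of _ _ _ _ "ball z0 d"])
    show "((\<lambda>z. integral (cbox 0 1) (\<lambda>t. g (z + circ r t *s u) / circ r t)) has_derivative
      blinfun_apply (integral (cbox 0 1) (fx z0))) (at z0)"
      using D unfolding at_within_open[OF iffD2[OF centre_in_ball rd(2)] open_ball] .
    show "integral (cbox 0 1) (\<lambda>t. g (z + circ r t *s u) / circ r t) = frechet_derivative g (at z) u"
      if "z \<in> ball z0 d" for z
      using Cauchy_formula_directional_derivative[OF g rd(1) rd(3)[OF that]] by (simp add: integral_unique)
  qed (use rd in auto)
  have ifx: "fx z0 integrable_on cbox 0 1"
  proof (rule integrable_continuous)
    have "continuous_on (cbox 0 1) (\<lambda>t. case (z0, t) of (z, t) \<Rightarrow> fx z t)"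
      by (rule continuous_on_compose2[OF cfx]) (use rd(2) in \<open>auto intro!: continuous_intros\<close>)
    then show "continuous_on (cbox 0 1) (fx z0)" by simp
  qed
  have "blinfun_apply (integral (cbox 0 1) (fx z0)) (c *s v) = c * blinfun_apply (integral (cbox 0 1) (fx z0)) v" for c v
    unfolding blinfun_apply_integral[OF ifx]
    using rd(2) integral_mult_right[of "cbox 0 1" c "\<lambda>t. blinfun_apply (fx z0 t) v", symmetric]
    by (simp add: fx complex_differentiable_onD(2)[OF g inS])
  with D' show "\<exists>D. ((\<lambda>z. frechet_derivative g (at z) u) has_derivative D) (at z0) \<and> (\<forall>c v. D (c *s v) = c * D v)"
    by blast
qed

lemma holomorphic_map_onD:
  assumes "holomorphic_map_on S f" "z \<in> S"
  shows "(f has_derivative frechet_derivative f (at z)) (at z)"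
    and "frechet_derivative f (at z) (c *s v) = c *s frechet_derivative f (at z) v"
  using assms frechet_derivative_at unfolding holomorphic_map_on_def by metis+

lemma has_derivative_vec_nth:
  "(f has_derivative D) F \<Longrightarrow> ((\<lambda>z. f z $ i) has_derivative (\<lambda>h. D h $ i)) F"
  by (rule bounded_linear.has_derivative[OF bounded_linear_vec_nth])

lemma has_derivative_vecI:
  fixes f :: "'a::real_normed_vector \<Rightarrow> 'b::euclidean_space^'n::finite"
  assumes "\<And>i. ((\<lambda>z. f z $ i) has_derivative (\<lambda>h. D h $ i)) (at z within S)"
  shows "(f has_derivative D) (at z within S)"
  by (subst has_derivative_componentwise_within)
     (auto simp: Basis_vec_def inner_axis intro!: has_derivative_inner_left assms)

lemma holomorphic_map_on_nth:
  assumes f: "holomorphic_map_on S f"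
  shows "complex_differentiable_on S (\<lambda>z. f z $ i)"
  unfolding complex_differentiable_on_def
proof
  fix z assume z: "z \<in> S"
  show "\<exists>D. ((\<lambda>z. f z $ i) has_derivative D) (at z) \<and> (\<forall>c v. D (c *s v) = c * D v)"
    by (rule exI[of _ "\<lambda>h. frechet_derivative f (at z) h $ i"])
       (simp add: has_derivative_vec_nth holomorphic_map_onD[OF f z])
qed

lemma holomorphic_map_on_frechet_derivative:
  fixes f :: "complex^'n::finite \<Rightarrow> complex^'m::finite"
  assumes f: "holomorphic_map_on S f" and S: "open S"
  shows "holomorphic_map_on S (\<lambda>z. frechet_derivative f (at z) u)"
proof -
  note comp = holomorphic_map_on_nth[OF f]
  have eq: "frechet_derivative (\<lambda>z. f z $ i) (at z) u = frechet_derivative f (at z) u $ i" if "z \<in> S" for z i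
    by (simp add: frechet_derivative_at[OF has_derivative_vec_nth[OF holomorphic_map_onD(1)[OF f that]],
          symmetric])
  show ?thesis
    unfolding holomorphic_map_on_def
  proof
    fix z assume z: "z \<in> S"
    let ?G = "\<lambda>i z. frechet_derivative (\<lambda>z. f z $ i) (at z) u"
    note cd = complex_differentiable_on_directional_derivative[OF comp S, where u = u]
    define D where "D = (\<lambda>h. \<chi> i. frechet_derivative (?G i) (at z) h)"
    have "((\<lambda>z. frechet_derivative f (at z) u) has_derivative D) (at z)"
    proof (rule has_derivative_vecI)
      fix i
      show "((\<lambda>z. frechet_derivative f (at z) u $ i) has_derivative (\<lambda>h. D h $ i)) (at z)"
        unfolding D_def vec_lambda_beta
        by (rule has_derivative_transform_within_open[OF complex_differentiable_onD(1)[OF cd z] S z eq])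
    qed
    moreover have "D (c *s v) = c *s D v" for c v
      by (simp add: D_def vec_eq_iff complex_differentiable_onD(2)[OF cd z])
    ultimately show "\<exists>D. ((\<lambda>z. frechet_derivative f (at z) u) has_derivative D) (at z) \<and> (\<forall>c v. D (c *s v) = c *s D v)"
      by blast
  qed
qed

lemma holomorphic_map_on_imp_smooth_on:
  assumes "holomorphic_map_on S f" "open S"
  shows "smooth_on S f"
proof -
  have "Ck_on k S f" for k
    using assms(1)
  proof (induction k arbitrary: f)
    case 0
    then show ?case
      by (auto intro!: continuous_at_imp_continuous_on has_derivative_continuous holomorphic_map_onD(1))
  next
    case (Suc k)
    show ?case
      by (rule Ck_on_SucI[OF holomorphic_map_onD(1)[OF Suc.prems] assms(2)
            Suc.IH[OF holomorphic_map_on_frechet_derivative[OF Suc.prems assms(2)]]])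
  qed
  then show ?thesis by (simp add: smooth_on_def)
qed

section \<open>Directional derivatives on a tangent bundle\<close>

text \<open>Functions on the tangent bundle are curried in the base point \<open>x\<close> and the fibre vector \<open>y\<close>; a direction
  \<open>h\<close> is a pair of a base and a fibre direction.\<close>

definition PD :: "('a::euclidean_space \<times> 'b::euclidean_space) \<Rightarrow> ('a \<Rightarrow> 'b \<Rightarrow> 'c::real_normed_vector) \<Rightarrow> 'a \<Rightarrow> 'b \<Rightarrow> 'c" where
  "PD h f x y = frechet_derivative (case_prod f) (at (x, y)) h"

abbreviation Dx :: "'a::euclidean_space \<Rightarrow> ('a \<Rightarrow> 'b::euclidean_space \<Rightarrow> 'c::real_normed_vector) \<Rightarrow> 'a \<Rightarrow> 'b \<Rightarrow> 'c" where
  "Dx u \<equiv> PD (u, 0)"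

abbreviation Dy :: "'b::euclidean_space \<Rightarrow> ('a::euclidean_space \<Rightarrow> 'b \<Rightarrow> 'c::real_normed_vector) \<Rightarrow> 'a \<Rightarrow> 'b \<Rightarrow> 'c" where
  "Dy w \<equiv> PD (0, w)"

lemma PD_eqI: "(case_prod f has_derivative D) (at (x, y)) \<Longrightarrow> PD h f x y = D h"
  by (simp add: PD_def frechet_derivative_at[symmetric])

lemma PD_const: "PD h (\<lambda>x y. c) x y = 0"
  by (rule PD_eqI) (simp add: case_prod_unfold)

lemma PD_chain:
  assumes "(case_prod f has_derivative D) (at (a, b))" "(H has_derivative H') (at p)" "H p = (a, b)"
  shows "((\<lambda>q. case_prod f (H q)) has_derivative (\<lambda>k. PD (H' k) f a b)) (at p)"
  using has_derivative_compose[OF assms(2), of "case_prod f" D] assms PD_eqI[OF assms(1)] by simp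

lemma linear_axis_expansion:
  fixes f :: "real^'i::finite \<Rightarrow> 'b::real_vector"
  assumes "linear f"
  shows "f u = (\<Sum>j\<in>UNIV. u $ j *\<^sub>R f (axis j 1))"
proof -
  have "f u = f (\<Sum>j\<in>UNIV. u $ j *\<^sub>R axis j 1)"
    using basis_expansion[of u] by (simp add: scalar_mult_eq_scaleR)
  also have "\<dots> = (\<Sum>j\<in>UNIV. u $ j *\<^sub>R f (axis j 1))"
    by (simp add: linear_sum[OF assms] linear_scale[OF assms])
  finally show ?thesis .
qed

locale open_region =
  fixes \<Omega> :: "('a::euclidean_space \<times> 'b::euclidean_space) set"
  assumes open_region: "open \<Omega>"
begin

abbreviation sm :: "('a \<Rightarrow> 'b \<Rightarrow> 'c::real_normed_vector) \<Rightarrow> bool" where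
  "sm f \<equiv> smooth_on \<Omega> (case_prod f)"

lemma PD_has_derivative:
  "sm f \<Longrightarrow> (x, y) \<in> \<Omega> \<Longrightarrow> (case_prod f has_derivative (\<lambda>h. PD h f x y)) (at (x, y))"
  unfolding PD_def by (rule smooth_on_has_derivative[OF _ open_region])

lemma sm_PD: "sm f \<Longrightarrow> sm (PD h f)"
  using smooth_on_frechet_derivative[OF _ open_region, of "case_prod f" h]
  by (simp add: PD_def case_prod_unfold)

lemma linear_PD: "sm f \<Longrightarrow> (x, y) \<in> \<Omega> \<Longrightarrow> linear (\<lambda>h. PD h f x y)"
  using PD_has_derivative has_derivative_linear by blast

lemma PD_cong:
  assumes "(x, y) \<in> \<Omega>" "\<And>x y. (x, y) \<in> \<Omega> \<Longrightarrow> f x y = g x y" "sm f"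
  shows "PD h f x y = PD h g x y"
proof (rule PD_eqI[symmetric])
  show "(case_prod g has_derivative (\<lambda>h. PD h f x y)) (at (x, y))"
    by (rule has_derivative_transform_within_open[OF PD_has_derivative[OF assms(3,1)] open_region assms(1)])
       (use assms(2) in auto)
qed

lemma PD_add: "sm f \<Longrightarrow> sm g \<Longrightarrow> (x, y) \<in> \<Omega> \<Longrightarrow> PD h (\<lambda>x y. f x y + g x y) x y = PD h f x y + PD h g x y"
  by (rule PD_eqI)
     (use has_derivative_add[OF PD_has_derivative PD_has_derivative] in \<open>auto simp: case_prod_unfold\<close>)

lemma PD_diff: "sm f \<Longrightarrow> sm g \<Longrightarrow> (x, y) \<in> \<Omega> \<Longrightarrow> PD h (\<lambda>x y. f x y - g x y) x y = PD h f x y - PD h g x y"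
  by (rule PD_eqI)
     (use has_derivative_diff[OF PD_has_derivative PD_has_derivative] in \<open>auto simp: case_prod_unfold\<close>)

lemma PD_bounded_linear:
  "bounded_linear l \<Longrightarrow> sm f \<Longrightarrow> (x, y) \<in> \<Omega> \<Longrightarrow> PD h (\<lambda>x y. l (f x y)) x y = l (PD h f x y)"
  by (rule PD_eqI)
     (use bounded_linear.has_derivative[OF _ PD_has_derivative] in \<open>auto simp: case_prod_unfold\<close>)

lemma PD_sum:
  assumes "\<And>i. i \<in> I \<Longrightarrow> sm (f i)" "(x, y) \<in> \<Omega>"
  shows "PD h (\<lambda>x y. \<Sum>i\<in>I. f i x y) x y = (\<Sum>i\<in>I. PD h (f i) x y)"
proof (rule PD_eqI)
  have "((\<lambda>p. \<Sum>i\<in>I. case_prod (f i) p) has_derivative (\<lambda>h. \<Sum>i\<in>I. PD h (f i) x y)) (at (x, y))"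
    by (intro has_derivative_sum PD_has_derivative assms)
  then show "((\<lambda>(x, y). \<Sum>i\<in>I. f i x y) has_derivative (\<lambda>h. \<Sum>i\<in>I. PD h (f i) x y)) (at (x, y))"
    by (simp add: case_prod_unfold)
qed

lemma PD_mult:
  fixes f g :: "'a \<Rightarrow> 'b \<Rightarrow> 'c::real_normed_algebra"
  shows "sm f \<Longrightarrow> sm g \<Longrightarrow> (x, y) \<in> \<Omega> \<Longrightarrow>
    PD h (\<lambda>x y. f x y * g x y) x y = f x y * PD h g x y + PD h f x y * g x y"
  by (rule PD_eqI)
     (use has_derivative_mult[OF PD_has_derivative PD_has_derivative] in \<open>auto simp: case_prod_unfold\<close>)

lemma PD_commute:
  fixes f :: "'a \<Rightarrow> 'b \<Rightarrow> 'c::euclidean_space"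
  assumes "sm f" "(x, y) \<in> \<Omega>"
  shows "PD h (PD k f) x y = PD k (PD h f) x y"
  using second_derivative_symmetric[OF assms(1) open_region assms(2), of k h]
  by (simp add: PD_def case_prod_unfold)

lemma PD_commute3:
  fixes f :: "'a \<Rightarrow> 'b \<Rightarrow> 'c::euclidean_space"
  assumes "sm f" "(x, y) \<in> \<Omega>"
  shows "PD h (PD k (PD l f)) x y = PD h (PD l (PD k f)) x y"
  by (rule PD_cong[OF assms(2) PD_commute]) (auto intro: sm_PD assms)

text \<open>The Leibniz rule for a directional derivative whose direction \<open>E\<close> and base point \<open>\<Phi>\<close> both vary: expand
  the direction in a basis.\<close>

lemma PD_composite_has_derivative:
  fixes f :: "'a \<Rightarrow> 'b \<Rightarrow> 'c::euclidean_space" and \<Phi> E :: "'p::real_normed_vector \<Rightarrow> 'a \<times> 'b"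
  assumes f: "sm f" and p: "\<Phi> p = (x, y)" "(x, y) \<in> \<Omega>"
    and \<Phi>: "(\<Phi> has_derivative \<Phi>') (at p)" and E: "(E has_derivative E') (at p)"
  shows "((\<lambda>q. PD (E q) f (fst (\<Phi> q)) (snd (\<Phi> q))) has_derivative
    (\<lambda>k. PD (\<Phi>' k) (PD (E p) f) x y + PD (E' k) f x y)) (at p)"
proof -
  have expand: "PD h g x y = (\<Sum>b\<in>Basis. (h \<bullet> b) *\<^sub>R PD b g x y)" if "(x, y) \<in> \<Omega>" "sm g"
    for x y h and g :: "'a \<Rightarrow> 'b \<Rightarrow> 'c"
  proof -
    have "PD h g x y = PD (\<Sum>b\<in>Basis. (h \<bullet> b) *\<^sub>R b) g x y" by (simp only: euclidean_representation)
    also have "\<dots> = (\<Sum>b\<in>Basis. (h \<bullet> b) *\<^sub>R PD b g x y)"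
      by (simp only: linear_sum[OF linear_PD[OF that(2,1)]] linear_scale[OF linear_PD[OF that(2,1)]])
    finally show ?thesis .
  qed
  have chain: "((\<lambda>q. case_prod g (\<Phi> q)) has_derivative (\<lambda>k. PD (\<Phi>' k) g x y)) (at p)" if "sm g"
    for g :: "'a \<Rightarrow> 'b \<Rightarrow> 'c"
    by (rule PD_chain[OF PD_has_derivative[OF that p(2)] \<Phi> p(1)])
  obtain d where d: "0 < d" "\<And>q. dist q p < d \<Longrightarrow> \<Phi> q \<in> \<Omega>"
  proof -
    obtain e where e: "0 < e" "ball (\<Phi> p) e \<subseteq> \<Omega>"
      using open_region p openE by metis
    obtain d where "0 < d" "\<And>q. dist q p < d \<Longrightarrow> dist (\<Phi> q) (\<Phi> p) < e"
      using has_derivative_continuous[OF \<Phi>] e(1) unfolding continuous_at_eps_delta by blast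
    with e(2) show ?thesis by (intro that[of d]) (auto simp: dist_commute)
  qed
  have "((\<lambda>q. \<Sum>b\<in>Basis. (E q \<bullet> b) *\<^sub>R case_prod (PD b f) (\<Phi> q)) has_derivative
      (\<lambda>k. \<Sum>b\<in>Basis. (E p \<bullet> b) *\<^sub>R PD (\<Phi>' k) (PD b f) x y + (E' k \<bullet> b) *\<^sub>R case_prod (PD b f) (\<Phi> p))) (at p)"
    by (intro has_derivative_sum has_derivative_scaleR has_derivative_inner_left E chain sm_PD f)
  then have "((\<lambda>q. PD (E q) f (fst (\<Phi> q)) (snd (\<Phi> q))) has_derivative
      (\<lambda>k. \<Sum>b\<in>Basis. (E p \<bullet> b) *\<^sub>R PD (\<Phi>' k) (PD b f) x y + (E' k \<bullet> b) *\<^sub>R case_prod (PD b f) (\<Phi> p))) (at p)"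
  proof (rule has_derivative_transform_within[OF _ d(1)])
    fix q assume "dist q p < d"
    then have "(fst (\<Phi> q), snd (\<Phi> q)) \<in> \<Omega>" using d(2) by simp
    from expand[OF this f, of "E q"]
    show "(\<Sum>b\<in>Basis. (E q \<bullet> b) *\<^sub>R case_prod (PD b f) (\<Phi> q)) = PD (E q) f (fst (\<Phi> q)) (snd (\<Phi> q))"
      by (simp add: case_prod_unfold)
  qed simp
  moreover have "(\<Sum>b\<in>Basis. (E p \<bullet> b) *\<^sub>R PD (\<Phi>' k) (PD b f) x y + (E' k \<bullet> b) *\<^sub>R case_prod (PD b f) (\<Phi> p)) =
      PD (\<Phi>' k) (PD (E p) f) x y + PD (E' k) f x y" for k
    unfolding PD_commute[OF f p(2), of "\<Phi>' k"] expand[OF p(2) sm_PD[OF f], of "E p"] expand[OF p(2) f, of "E' k"] sum.distrib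
    by (simp add: p(1))
  ultimately show ?thesis by simp
qed

lemma PD_varying_direction_has_derivative:
  fixes f :: "'a \<Rightarrow> 'b \<Rightarrow> 'c::euclidean_space"
  assumes f: "sm f" and p: "(x, y) \<in> \<Omega>" and H: "(case_prod H has_derivative H') (at (x, y))"
  shows "(case_prod (\<lambda>x y. PD (H x y) f x y) has_derivative
    (\<lambda>k. PD (H x y) (PD k f) x y + PD (H' k) f x y)) (at (x, y))"
  using PD_composite_has_derivative[OF f refl p has_derivative_ident H]
  by (simp add: case_prod_unfold PD_commute[OF f p, of "H x y"])

lemmas PD_varying_direction = PD_eqI[OF PD_varying_direction_has_derivative]

end

lemma axis_curve_derivative:
  assumes "(case_prod f has_derivative D) (at (x, y))"
  shows "dx j f x y = D (axis j 1, 0)" "dy j f x y = D (0, axis j 1)"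
proof -
  have "((\<lambda>t::real. case_prod f ((x, y) + t *\<^sub>R h)) has_vector_derivative D h) (at 0)" for h
  proof -
    have "((\<lambda>t::real. (x, y) + t *\<^sub>R h) has_derivative (\<lambda>t. t *\<^sub>R h)) (at 0)"
      by (auto intro!: derivative_eq_intros)
    from has_derivative_compose[OF this, of "case_prod f" D] assms
    have "((\<lambda>t::real. case_prod f ((x, y) + t *\<^sub>R h)) has_derivative (\<lambda>t. D (t *\<^sub>R h))) (at 0)"
      by simp
    then show ?thesis
      by (simp add: has_vector_derivative_def linear_scale[OF has_derivative_linear[OF assms]])
  qed
  from this[of "(axis j 1, 0)"] this[of "(0, axis j 1)"]
  show "dx j f x y = D (axis j 1, 0)" "dy j f x y = D (0, axis j 1)"
    unfolding dx_def dy_def by (auto intro!: vector_derivative_at)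
qed

locale real_region = open_region \<Omega> for \<Omega> :: "((real^'i::finite) \<times> (real^'i)) set"
begin

lemma dx_eq:
  assumes "sm g" "\<And>x y. (x, y) \<in> \<Omega> \<Longrightarrow> f x y = g x y" "(x, y) \<in> \<Omega>"
  shows "dx j f x y = Dx (axis j 1) g x y"
proof -
  have "(case_prod f has_derivative (\<lambda>h. PD h g x y)) (at (x, y))"
    by (rule has_derivative_transform_within_open[OF PD_has_derivative[OF assms(1,3)] open_region assms(3)])
       (use assms(2) in auto)
  from axis_curve_derivative(1)[OF this] show ?thesis .
qed

lemma dy_eq:
  assumes "sm g" "\<And>x y. (x, y) \<in> \<Omega> \<Longrightarrow> f x y = g x y" "(x, y) \<in> \<Omega>"
  shows "dy j f x y = Dy (axis j 1) g x y"
proof -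
  have "(case_prod f has_derivative (\<lambda>h. PD h g x y)) (at (x, y))"
    by (rule has_derivative_transform_within_open[OF PD_has_derivative[OF assms(1,3)] open_region assms(3)])
       (use assms(2) in auto)
  from axis_curve_derivative(2)[OF this] show ?thesis .
qed

lemma linear_Dx: "sm f \<Longrightarrow> (x, y) \<in> \<Omega> \<Longrightarrow> linear (\<lambda>u. Dx u f x y)"
  using linear_compose[of "\<lambda>u. (u, 0)" "\<lambda>h. PD h f x y", OF _ linear_PD]
  by (simp add: o_def linear_iff)

lemma linear_Dy: "sm f \<Longrightarrow> (x, y) \<in> \<Omega> \<Longrightarrow> linear (\<lambda>u. Dy u f x y)"
  using linear_compose[of "\<lambda>u. (0, u)" "\<lambda>h. PD h f x y", OF _ linear_PD]
  by (simp add: o_def linear_iff)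

end

section \<open>The Cartan connection of a real Finsler metric\<close>

definition slit :: "'a set \<Rightarrow> ('a \<times> 'b::zero) set" where
  "slit U = {(x, y). x \<in> U \<and> y \<noteq> 0}"

lemma in_slit [simp]: "(x, y) \<in> slit U \<longleftrightarrow> x \<in> U \<and> y \<noteq> 0"
  by (simp add: slit_def)

lemma open_slit: "open U \<Longrightarrow> open (slit U :: ('a::topological_space \<times> 'b::{t1_space,zero}) set)"
proof -
  assume "open U"
  moreover have "slit U = U \<times> - {0::'b}" by (auto simp: slit_def)
  ultimately show ?thesis by (simp add: open_Times open_Compl)
qed

lemma matrix_inv_cancel:
  fixes A :: "'a::semiring_1^'n::finite^'n"
  assumes "invertible A"
  shows "A ** matrix_inv A = mat 1" "matrix_inv A ** A = mat 1"
  using someI_ex[of "\<lambda>B. A ** B = mat 1 \<and> B ** A = mat 1"] assms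
  by (auto simp: invertible_def matrix_inv_def)

text \<open>The function \<open>L\<close> is the square of the metric; the matrix \<open>gmat L\<close> of half its second fibre derivatives is
  the fundamental tensor.\<close>

locale finsler =
  fixes U :: "(real^'i::finite) set" and L :: "'i rfun"
  assumes open_U: "open U"
    and smooth_L: "smooth_on (slit U) (case_prod L)"
    and homogeneous: "\<And>x y t. x \<in> U \<Longrightarrow> y \<noteq> 0 \<Longrightarrow> 0 < t \<Longrightarrow> L x (t *\<^sub>R y) = t\<^sup>2 * L x y"
    and positive: "\<And>x y u. x \<in> U \<Longrightarrow> y \<noteq> 0 \<Longrightarrow> u \<noteq> 0 \<Longrightarrow> 0 < u \<bullet> (gmat L x y *v u)"

sublocale finsler \<subseteq> real_region "slit U"
  by unfold_locales (rule open_slit[OF open_U])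

context finsler
begin

subsection \<open>Euler's relations\<close>

lemma Euler_L:
  assumes "x \<in> U" "y \<noteq> 0"
  shows "Dy y L x y = 2 * L x y"
proof -
  have "((\<lambda>t::real. case_prod L (x, t *\<^sub>R y)) has_derivative (\<lambda>k. PD (0, k *\<^sub>R y) L x (1 *\<^sub>R y))) (at 1)"
    by (rule PD_chain[OF PD_has_derivative[OF smooth_L]])
       (use assms in \<open>auto intro!: derivative_eq_intros\<close>)
  then have 1: "((\<lambda>t::real. L x (t *\<^sub>R y)) has_derivative (\<lambda>k. k *\<^sub>R Dy y L x y)) (at 1)"
    using linear_scale[OF linear_Dy[OF smooth_L, of x y]] assms by simp
  have 2: "((\<lambda>t::real. t\<^sup>2 * L x y) has_derivative (\<lambda>k. k * (2 * L x y))) (at 1)"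
    by (auto intro!: derivative_eq_intros)
  have "((\<lambda>t::real. L x (t *\<^sub>R y)) has_derivative (\<lambda>k. k * (2 * L x y))) (at 1)"
    by (rule has_derivative_transform_within_open[OF 2, of "{0<..}"])
       (use homogeneous assms in auto)
  from fun_cong[OF has_derivative_unique[OF 1 this], of 1] show ?thesis by simp
qed

text \<open>Differentiating \<open>y\<^sup>k \<partial>f/\<partial>y\<^sup>k = c f\<close>.\<close>

lemma Euler_derivative_vector:
  fixes f :: "real^'i \<Rightarrow> real^'i \<Rightarrow> 'c::euclidean_space"
  assumes f: "sm f" and E: "\<And>x y. x \<in> U \<Longrightarrow> y \<noteq> 0 \<Longrightarrow> Dy y f x y = c *\<^sub>R f x y"
    and p: "x \<in> U" "y \<noteq> 0"
  shows "Dy y (PD (a, b) f) x y = c *\<^sub>R PD (a, b) f x y - Dy b f x y"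
proof -
  have H: "(case_prod (\<lambda>x y. (0, y)) has_derivative (\<lambda>(a, b). (0, b))) (at (x, y))"
    by (auto simp: case_prod_unfold intro!: derivative_eq_intros)
  have "(case_prod (\<lambda>x y. c *\<^sub>R f x y) has_derivative (\<lambda>h. c *\<^sub>R PD h f x y)) (at (x, y))"
    using has_derivative_scaleR_right[OF PD_has_derivative[OF f], of x y c] p by (simp add: case_prod_unfold)
  then have 1: "PD (a, b) (\<lambda>x y. c *\<^sub>R f x y) x y = c *\<^sub>R PD (a, b) f x y"
    by (rule PD_eqI)
  have "sm (\<lambda>x y. c *\<^sub>R f x y)"
    using smooth_on_scaleR[OF smooth_on_const[OF open_region] f open_region, of c] by (simp add: case_prod_unfold)
  then have "PD (a, b) (\<lambda>x y. c *\<^sub>R f x y) x y = PD (a, b) (\<lambda>x y. Dy y f x y) x y"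
    by (intro PD_cong) (use E p in auto)
  with 1 PD_varying_direction[OF f _ H, of "(a, b)"] p show ?thesis by (simp add: eq_diff_eq)
qed

lemma Euler_derivative:
  fixes f :: "'i rfun"
  assumes f: "sm f" and E: "\<And>x y. x \<in> U \<Longrightarrow> y \<noteq> 0 \<Longrightarrow> Dy y f x y = c * f x y"
    and p: "x \<in> U" "y \<noteq> 0"
  shows "Dy y (PD (a, b) f) x y = c * PD (a, b) f x y - Dy b f x y"
  using Euler_derivative_vector[OF f _ p, of c a b] E by simp

lemma Euler_PD_L:
  assumes "x \<in> U" "y \<noteq> 0"
  shows "Dy y (Dy w L) x y = Dy w L x y" "Dy y (Dx u L) x y = 2 * Dx u L x y"
  using Euler_derivative[OF smooth_L Euler_L assms, of 0 w] Euler_derivative[OF smooth_L Euler_L assms, of u 0]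
    linear_0[OF linear_Dy[OF smooth_L, of x y]] assms
  by auto

lemma Euler_PD2_L:
  assumes "x \<in> U" "y \<noteq> 0"
  shows "Dy y (Dy v (Dy w L)) x y = 0" "Dy y (Dx u (Dy w L)) x y = Dx u (Dy w L) x y"
proof -
  have E: "Dy y (PD (a, b) (Dy w L)) x y = 1 * PD (a, b) (Dy w L) x y - Dy b (Dy w L) x y" for a b
    by (rule Euler_derivative[OF sm_PD[OF smooth_L]]) (use Euler_PD_L assms in auto)
  show "Dy y (Dy v (Dy w L)) x y = 0" using E[of 0 v] by simp
  show "Dy y (Dx u (Dy w L)) x y = Dx u (Dy w L) x y"
    using E[of u 0] linear_0[OF linear_Dy[OF sm_PD[OF smooth_L], of x y]] assms by simp
qed

subsection \<open>The fundamental tensor\<close>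

lemma dx_L: "x \<in> U \<Longrightarrow> y \<noteq> 0 \<Longrightarrow> dx j L x y = Dx (axis j 1) L x y"
  by (rule dx_eq[OF smooth_L]) auto

lemma dy_L: "x \<in> U \<Longrightarrow> y \<noteq> 0 \<Longrightarrow> dy j L x y = Dy (axis j 1) L x y"
  by (rule dy_eq[OF smooth_L]) auto

lemma dx_dy_L: "x \<in> U \<Longrightarrow> y \<noteq> 0 \<Longrightarrow> dx i (dy j L) x y = Dx (axis i 1) (Dy (axis j 1) L) x y"
  by (rule dx_eq[OF sm_PD[OF smooth_L]]) (auto simp: dy_L)

lemma gmat_nth: "x \<in> U \<Longrightarrow> y \<noteq> 0 \<Longrightarrow> gmat L x y $ j $ k = Dy (axis j 1) (Dy (axis k 1) L) x y / 2"
  using dy_eq[OF sm_PD[OF smooth_L], of "dy k L" "(0, axis k 1)" x y j] by (simp add: gmat_def dy_L)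

lemma linear_PD_snd: "x \<in> U \<Longrightarrow> y \<noteq> 0 \<Longrightarrow> linear (\<lambda>w. PD h (Dy w L) x y)"
  using linear_Dy[OF sm_PD[OF smooth_L], of x y h] PD_commute[OF smooth_L, of x y h] by simp

lemma gmat_inner:
  assumes "x \<in> U" "y \<noteq> 0"
  shows "u \<bullet> (gmat L x y *v w) = Dy u (Dy w L) x y / 2"
proof -
  have "Dy u (Dy w L) x y = (\<Sum>j\<in>UNIV. u $ j * (\<Sum>k\<in>UNIV. w $ k * Dy (axis j 1) (Dy (axis k 1) L) x y))"
    using linear_axis_expansion[OF linear_Dy[OF sm_PD[OF smooth_L], of x y "(0, w)"], of u]
      linear_axis_expansion[OF linear_PD_snd[of x y], of _ w] assms
    by simp
  then show ?thesis
    using assms by (simp add: inner_vec_def matrix_vector_mult_def gmat_nth sum_divide_distrib sum_distrib_left mult.commute)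
qed

text \<open>Vectors are compared below through their products with all \<open>w\<close> in the fundamental tensor.\<close>

lemma nondegenerate:
  assumes "x \<in> U" "y \<noteq> 0" "\<And>w. Dy w (Dy a L) x y = Dy w (Dy b L) x y"
  shows "a = b"
proof (rule ccontr)
  assume "a \<noteq> b"
  then have "0 < (a - b) \<bullet> (gmat L x y *v (a - b))" using positive[OF assms(1,2)] by simp
  also have "\<dots> = (Dy (a - b) (Dy a L) x y - Dy (a - b) (Dy b L) x y) / 2"
    using linear_diff[OF linear_PD_snd[OF assms(1,2)]] by (simp add: gmat_inner assms(1,2))
  finally show False using assms(3) by simp
qed

lemma gmat_invertible:
  assumes "x \<in> U" "y \<noteq> 0"
  shows "invertible (gmat L x y)" "det (gmat L x y) \<noteq> 0"
proof -
  have "u = 0" if "gmat L x y *v u = 0" for u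
    using positive[OF assms, of u] that by force
  then have "\<exists>B. B ** gmat L x y = mat 1"
    using matrix_left_invertible_ker by blast
  then show "invertible (gmat L x y)" using invertible_left_inverse by blast
  then show "det (gmat L x y) \<noteq> 0" by (simp add: invertible_det_nz)
qed

lemma gmat_ginv: "x \<in> U \<Longrightarrow> y \<noteq> 0 \<Longrightarrow> gmat L x y *v (matrix_inv (gmat L x y) *v b) = b"
  using matrix_inv_cancel(1)[OF gmat_invertible(1), of x y] by (simp add: matrix_vector_mul_assoc)

subsection \<open>The spray and the nonlinear connection\<close>

text \<open>Geodesics satisfy \<open>x'' + 2 S x x' = 0\<close>.\<close>

definition S :: "real^'i \<Rightarrow> real^'i \<Rightarrow> real^'i" where
  "S x y = (\<chi> k. spray L k x y)"

lemma Sum_axis_Dx: "x \<in> U \<Longrightarrow> y \<noteq> 0 \<Longrightarrow> sm f \<Longrightarrow> (\<Sum>a\<in>UNIV. Dx (axis a 1) f x y * v $ a) = Dx v f x y" for f :: "'i rfun"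
  using linear_axis_expansion[OF linear_Dx[of f x y], of v] by (simp add: mult.commute)

lemma S_matrix:
  assumes "x \<in> U" "y \<noteq> 0"
  shows "gmat L x y *v S x y = (\<chi> l. (Dx y (Dy (axis l 1) L) x y - Dx (axis l 1) L x y) / 4)"
proof -
  let ?b = "\<chi> l. Dx y (Dy (axis l 1) L) x y - Dx (axis l 1) L x y"
  have "S x y = (1 / 4) *\<^sub>R (matrix_inv (gmat L x y) *v ?b)"
    using assms
    by (simp add: vec_eq_iff S_def spray_def ginv_def matrix_vector_mult_def dx_dy_L dx_L
        Sum_axis_Dx sm_PD smooth_L)
  then have "gmat L x y *v S x y = (1 / 4) *\<^sub>R ?b"
    using gmat_ginv[OF assms, of ?b] by (simp add: matrix_vector_mult_scaleR)
  then show ?thesis by (simp add: vec_eq_iff)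
qed

text \<open>Lowering the index by the fundamental tensor removes the inverse matrix from the definition.\<close>

lemma S_characterization:
  assumes "x \<in> U" "y \<noteq> 0"
  shows "2 * Dy w (Dy (S x y) L) x y = Dx y (Dy w L) x y - Dx w L x y"
proof -
  have "2 * Dy w (Dy (S x y) L) x y = 4 * (w \<bullet> (gmat L x y *v S x y))"
    by (simp add: gmat_inner assms)
  also have "\<dots> = (\<Sum>l\<in>UNIV. w $ l * (Dx y (Dy (axis l 1) L) x y - Dx (axis l 1) L x y))"
    unfolding S_matrix[OF assms] inner_vec_def by (simp add: sum_distrib_left)
  also have "\<dots> = Dx y (Dy w L) x y - Dx w L x y"
    using linear_axis_expansion[OF linear_PD_snd[of x y "(y, 0)"], of w]
      linear_axis_expansion[OF linear_Dx[OF smooth_L, of x y], of w] assms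
    by (simp add: algebra_simps sum_subtractf)
  finally show ?thesis .
qed

lemma S_characterization':
  "x \<in> U \<Longrightarrow> y \<noteq> 0 \<Longrightarrow> Dy (S x y) (Dy w L) x y = (1 / 2) * (Dx y (Dy w L) x y - Dx w L x y)"
  using S_characterization[of x y w] PD_commute[OF smooth_L, of x y "(0, w)" "(0, S x y)"] by simp

lemma smooth_Dx_fibre: "sm (\<lambda>x y. PD (y, 0) (Dy w L) x y)"
proof -
  have "smooth_on (slit U) (\<lambda>p. \<Sum>a\<in>UNIV. case_prod (Dx (axis a 1) (Dy w L)) p * (snd p $ a))"
    by (intro smooth_on_sum smooth_on_mult sm_PD smooth_L open_region
        smooth_on_if_linear[OF _ open_region, of "\<lambda>p::(real^'i) \<times> (real^'i). snd p $ (a::'i)" for a]) (simp add: linear_iff)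
  then show ?thesis
    by (rule smooth_on_cong) (auto simp: Sum_axis_Dx sm_PD smooth_L)
qed

text \<open>Cramer's rule expresses the spray by determinants of second derivatives of \<open>L\<close>.\<close>

lemma smooth_S: "sm S"
proof -
  let ?B = "\<lambda>k p. \<chi> i j. if j = k
    then (Dx (snd p) (Dy (axis i 1) L) (fst p) (snd p) - Dx (axis i 1) L (fst p) (snd p)) / 4
    else gmat L (fst p) (snd p) $ i $ j"
  have d: "smooth_on (slit U) (\<lambda>p. det (A p))"
    if "\<And>i j. smooth_on (slit U) (\<lambda>p. A p $ i $ j)" for A :: "(real^'i) \<times> (real^'i) \<Rightarrow> real^'i^'i"
    unfolding det_def by (intro smooth_on_sum smooth_on_mult smooth_on_const smooth_on_prod that open_region)
  have pd: "smooth_on (slit U) (\<lambda>p. f (fst p) (snd p))" if "sm f" for f :: "'i rfun"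
    using that by (simp add: case_prod_unfold)
  have g: "smooth_on (slit U) (\<lambda>p. gmat L (fst p) (snd p) $ i $ j)" for i j
    by (rule smooth_on_cong[OF smooth_on_divide[OF pd[OF sm_PD[OF sm_PD[OF smooth_L]]]
            smooth_on_const[OF open_region, of 2] open_region]])
       (auto simp: gmat_nth)
  have c: "smooth_on (slit U) (\<lambda>p. Dx (snd p) (Dy w L) (fst p) (snd p))" for w
    using smooth_Dx_fibre[of w] by (simp add: case_prod_unfold)
  have B: "smooth_on (slit U) (\<lambda>p. ?B k p $ i $ j)" for k i j
  proof (cases "j = k")
    case True
    have "smooth_on (slit U) (\<lambda>p. (Dx (snd p) (Dy (axis i 1) L) (fst p) (snd p) - Dx (axis i 1) L (fst p) (snd p)) / 4)"
      by (intro smooth_on_divide smooth_on_diff c pd sm_PD smooth_L smooth_on_const open_region) auto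
    with True show ?thesis by simp
  next
    case False
    with g show ?thesis by simp
  qed
  have "smooth_on (slit U) (\<lambda>p. (\<Sum>k\<in>UNIV. (det (?B k p) / det (gmat L (fst p) (snd p))) *\<^sub>R (axis k 1 :: real^'i)))"
    by (intro smooth_on_sum smooth_on_scaleR smooth_on_divide smooth_on_const d B g open_region)
       (auto simp: gmat_invertible)
  then show ?thesis
  proof (rule smooth_on_cong)
    fix p :: "(real^'i) \<times> (real^'i)" assume p: "p \<in> slit U"
    obtain x y where [simp]: "p = (x, y)" by fastforce
    have xy: "x \<in> U" "y \<noteq> 0" using p by auto
    have "S x y = (\<chi> k. det (?B k p) / det (gmat L x y))"
      using S_matrix[OF xy] unfolding cramer[OF gmat_invertible(2)[OF xy]] \<open>p = (x, y)\<close> fst_conv snd_conv vec_lambda_beta .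
    moreover have "v = (\<Sum>k\<in>UNIV. v $ k *\<^sub>R axis k 1)" for v :: "real^'i"
      using basis_expansion[of v] by (simp add: scalar_mult_eq_scaleR)
    ultimately show "(\<Sum>k\<in>UNIV. (det (?B k p) / det (gmat L (fst p) (snd p))) *\<^sub>R axis k 1) = case_prod S p"
      by (metis (no_types, lifting) \<open>p = (x, y)\<close> case_prod_conv fst_conv snd_conv sum.cong vec_lambda_beta)
  qed
qed

definition N :: "real^'i \<Rightarrow> real^'i \<Rightarrow> real^'i \<Rightarrow> real^'i" where
  "N u x y = Dy u S x y"

lemma linear_N: "x \<in> U \<Longrightarrow> y \<noteq> 0 \<Longrightarrow> linear (\<lambda>u. N u x y)"
  unfolding N_def by (rule linear_Dy[OF smooth_S]) simp

lemma nonlin_conn_eq: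
  assumes "x \<in> U" "y \<noteq> 0"
  shows "nonlin_conn L k j x y = N (axis j 1) x y $ k"
proof -
  have "smooth_on (slit U) (\<lambda>p. case_prod S p $ k)"
    by (rule smooth_on_bounded_linear[OF bounded_linear_vec_nth smooth_S open_region])
  then have "sm (\<lambda>x y. S x y $ k)" by (simp add: case_prod_unfold)
  then have "dy j (spray L k) x y = Dy (axis j 1) (\<lambda>x y. S x y $ k) x y"
    by (rule dy_eq) (use assms in \<open>auto simp: S_def\<close>)
  also have "\<dots> = N (axis j 1) x y $ k"
    unfolding N_def by (rule PD_bounded_linear[OF bounded_linear_vec_nth smooth_S]) (use assms in auto)
  finally show ?thesis by (simp add: nonlin_conn_def)
qed

text \<open>The characterization of the spray, differentiated along the fibre.\<close>

lemma N_characterization: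
  assumes p: "x \<in> U" "y \<noteq> 0"
  shows "2 * Dy w (Dy (N u x y) L) x y + 2 * Dy (S x y) (Dy u (Dy w L)) x y =
    Dx y (Dy u (Dy w L)) x y + Dx u (Dy w L) x y - Dx w (Dy u L) x y"
proof -
  have in_slit': "(x, y) \<in> slit U" using p by simp
  note smw = sm_PD[OF smooth_L, of "(0, w)"]
  have HS: "(case_prod (\<lambda>x y. (0, S x y)) has_derivative (\<lambda>h. (0, PD h S x y))) (at (x, y))"
    using has_derivative_Pair[OF has_derivative_const[of 0] PD_has_derivative[OF smooth_S in_slit']]
    by (simp add: case_prod_unfold)
  have Hy: "(case_prod (\<lambda>x y. (y, 0)) has_derivative (\<lambda>h. (snd h, 0))) (at (x, y))"
    by (auto simp: case_prod_unfold intro!: derivative_eq_intros)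
  have l: "PD (0, u) (\<lambda>x y. PD (0, S x y) (Dy w L) x y) x y = Dy (S x y) (Dy u (Dy w L)) x y + Dy (N u x y) (Dy w L) x y"
    using PD_varying_direction[OF smw in_slit' HS, of "(0, u)"] by (simp add: N_def)
  have r: "PD (0, u) (\<lambda>x y. PD (y, 0) (Dy w L) x y) x y = Dx y (Dy u (Dy w L)) x y + Dx u (Dy w L) x y"
    using PD_varying_direction[OF smw in_slit' Hy, of "(0, u)"] by simp
  note sm1 = smooth_Dx_fibre[of w]
  have smr: "sm (\<lambda>x y. PD (y, 0) (Dy w L) x y - Dx w L x y)"
    using smooth_on_diff[OF sm1 sm_PD[OF smooth_L, of "(w, 0)"] open_region] by (simp add: case_prod_unfold)
  have "PD (0, u) (\<lambda>x y. PD (y, 0) (Dy w L) x y - Dx w L x y) x y =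
      PD (0, u) (\<lambda>x y. 2 * PD (0, S x y) (Dy w L) x y) x y"
    by (rule PD_cong[OF in_slit' _ smr])
       (auto simp: S_characterization')
  moreover have "PD (0, u) (\<lambda>x y. 2 * PD (0, S x y) (Dy w L) x y) x y =
      2 * PD (0, u) (\<lambda>x y. PD (0, S x y) (Dy w L) x y) x y"
  proof (rule PD_bounded_linear[OF bounded_linear_mult_right _ in_slit'])
    have "smooth_on (slit U) (\<lambda>p. (1/2) * case_prod (\<lambda>x y. PD (y, 0) (Dy w L) x y - Dx w L x y) p)"
      by (intro smooth_on_mult smooth_on_const smr open_region)
    then show "sm (\<lambda>x y. PD (0, S x y) (Dy w L) x y)"
      by (rule smooth_on_cong)
         (auto simp: S_characterization')
  qed
  moreover have "PD (0, u) (\<lambda>x y. PD (y, 0) (Dy w L) x y - Dx w L x y) x y =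
      PD (0, u) (\<lambda>x y. PD (y, 0) (Dy w L) x y) x y - Dy u (Dx w L) x y"
    by (rule PD_diff[OF sm1 sm_PD[OF smooth_L] in_slit'])
  ultimately show ?thesis
    using l r PD_commute[OF smooth_L in_slit', of "(0, u)" "(w, 0)"]
      PD_commute[OF smooth_L in_slit', of "(0, w)" "(0, N u x y)"]
    by simp
qed

end

context finsler
begin

lemma PD3_swap:
  assumes "x \<in> U" "y \<noteq> 0"
  shows "PD h (PD k (PD l L)) x y = PD k (PD h (PD l L)) x y"
    and "PD h (PD k (PD l L)) x y = PD h (PD l (PD k L)) x y"
  using PD_commute[OF sm_PD[OF smooth_L]] PD_commute3[OF smooth_L] assms by auto

text \<open>Second fibre derivatives of \<open>L\<close> are homogeneous of degree \<open>0\<close> along the fibre; third derivatives are symmetric.\<close>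

lemma Euler_PD3_L:
  assumes "x \<in> U" "y \<noteq> 0"
  shows "Dy v (Dy y (Dy w L)) x y = 0" "Dy v (Dy w (Dy y L)) x y = 0"
    "Dx u (Dy y (Dy w L)) x y = Dx u (Dy w L) x y" "Dx u (Dy w (Dy y L)) x y = Dx u (Dy w L) x y"
  using Euler_PD2_L[OF assms] PD3_swap[OF assms] by metis+

text \<open>The characterization of \<open>N\<close> for \<open>w = y\<close>; the relations of Euler reduce its third derivatives to first ones.\<close>

lemma horizontal_L:
  assumes "x \<in> U" "y \<noteq> 0"
  shows "Dx u L x y = Dy (N u x y) L x y"
  using N_characterization[OF assms, of y u] Euler_PD_L[OF assms] Euler_PD3_L[OF assms]
    PD_commute[OF smooth_L, of x y "(0, y)"] assms
  by simp

lemma N_fibre: 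
  assumes "x \<in> U" "y \<noteq> 0"
  shows "N y x y = 2 *\<^sub>R S x y"
proof (rule nondegenerate[OF assms])
  fix w
  have "2 * Dy w (Dy (N y x y) L) x y = 2 * (Dx y (Dy w L) x y - Dx w L x y)"
    using N_characterization[OF assms, of w y] Euler_PD_L[OF assms] Euler_PD3_L[OF assms]
      PD_commute[OF smooth_L, of x y "(0, y)"] assms
    by simp
  also have "\<dots> = 2 * (2 * Dy w (Dy (S x y) L) x y)"
    by (simp add: S_characterization[OF assms])
  finally show "Dy w (Dy (N y x y) L) x y = Dy w (Dy (2 *\<^sub>R S x y) L) x y"
    by (simp add: linear_scale[OF linear_PD_snd[OF assms]])
qed

subsection \<open>The horizontal part of the Cartan connection\<close>

definition cartan :: "real^'i \<Rightarrow> real^'i \<Rightarrow> real^'i \<Rightarrow> real^'i \<Rightarrow> real^'i" where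
  "cartan V u x y = (\<chi> k. \<Sum>l\<in>UNIV. \<Sum>j\<in>UNIV. V $ l * cartan_h L k l j x y * u $ j)"

text \<open>The derivative of twice the inner product of \<open>w\<close> and \<open>v\<close> in the horizontal direction over \<open>u\<close>.\<close>

definition T :: "real^'i \<Rightarrow> real^'i \<Rightarrow> real^'i \<Rightarrow> real^'i \<Rightarrow> real^'i \<Rightarrow> real" where
  "T w v u x y = PD (u, - N u x y) (Dy w (Dy v L)) x y"

lemma T_split:
  assumes "x \<in> U" "y \<noteq> 0"
  shows "T w v u x y = Dx u (Dy w (Dy v L)) x y - Dy (N u x y) (Dy w (Dy v L)) x y"
  using linear_diff[OF linear_PD[OF sm_PD[OF sm_PD[OF smooth_L]]], of x y "(u, 0)" "(0, N u x y)"] assms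
  by (simp add: T_def)

lemma linear_T:
  assumes "x \<in> U" "y \<noteq> 0"
  shows "linear (\<lambda>w. T w v u x y)" "linear (\<lambda>v. T w v u x y)" "linear (\<lambda>u. T w v u x y)"
proof -
  have l: "linear (\<lambda>w. PD h (Dy w (Dy v L)) x y)" for h v
    using linear_Dy[OF sm_PD[OF sm_PD[OF smooth_L]], of x y h "(0, v)"] PD3_swap(1)[OF assms, of h] assms
    by simp
  show "linear (\<lambda>w. T w v u x y)" unfolding T_def by (rule l)
  show "linear (\<lambda>v. T w v u x y)" unfolding T_def
    using l[of "(u, - N u x y)" w] PD3_swap(2)[OF assms, of "(u, - N u x y)" "(0, w)"] by simp
  show "linear (\<lambda>u. T w v u x y)"
    unfolding T_split[OF assms]
    using linear_Dx[OF sm_PD[OF sm_PD[OF smooth_L]], of x y "(0, w)" "(0, v)"]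
      linear_compose[OF linear_N[OF assms] linear_Dy[OF sm_PD[OF sm_PD[OF smooth_L]], of x y "(0, w)" "(0, v)"]]
      assms
    by (auto intro: linear_compose_sub simp: o_def)
qed

lemma T_expand:
  assumes "x \<in> U" "y \<noteq> 0"
  shows "T w v u x y = (\<Sum>s\<in>UNIV. w $ s * T (axis s 1) v u x y)"
    "T w v u x y = (\<Sum>s\<in>UNIV. v $ s * T w (axis s 1) u x y)"
    "T w v u x y = (\<Sum>s\<in>UNIV. u $ s * T w v (axis s 1) x y)"
  by (rule linear_axis_expansion[OF linear_T(1)[OF assms], unfolded real_scaleR_def]
      linear_axis_expansion[OF linear_T(2)[OF assms], unfolded real_scaleR_def]
      linear_axis_expansion[OF linear_T(3)[OF assms], unfolded real_scaleR_def])+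

lemma delta_x_eq:
  assumes g: "sm g" "\<And>x y. (x, y) \<in> slit U \<Longrightarrow> f x y = g x y" and p: "x \<in> U" "y \<noteq> 0"
  shows "delta_x L j f x y = PD (axis j 1, - N (axis j 1) x y) g x y"
proof -
  have "delta_x L j f x y = Dx (axis j 1) g x y - (\<Sum>k\<in>UNIV. N (axis j 1) x y $ k * Dy (axis k 1) g x y)"
  proof -
    have "dx j f x y = Dx (axis j 1) g x y" by (rule dx_eq[OF g]) (use p in simp_all)
    moreover have "dy k f x y = Dy (axis k 1) g x y" for k by (rule dy_eq[OF g]) (use p in simp_all)
    ultimately show ?thesis using p by (simp add: delta_x_def nonlin_conn_eq)
  qed
  also have "\<dots> = Dx (axis j 1) g x y - Dy (N (axis j 1) x y) g x y"
    using linear_axis_expansion[OF linear_Dy[OF g(1), of x y], of "N (axis j 1) x y"] p by simp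
  also have "\<dots> = PD (axis j 1, - N (axis j 1) x y) g x y"
    using linear_diff[OF linear_PD[OF g(1)], of x y "(axis j 1, 0)" "(0, N (axis j 1) x y)"] p by simp
  finally show ?thesis .
qed

lemma delta_gmat:
  assumes p: "x \<in> U" "y \<noteq> 0"
  shows "delta_x L l (\<lambda>x y. gmat L x y $ s $ j) x y = T (axis s 1) (axis j 1) (axis l 1) x y / 2"
proof -
  let ?f = "Dy (axis s 1) (Dy (axis j 1) L)"
  have sm2: "sm ?f" by (intro sm_PD smooth_L)
  have "sm (\<lambda>x y. ?f x y * (1 / 2))"
    using smooth_on_mult[OF sm2 smooth_on_const[OF open_region, of "1 / 2"] open_region]
    by (simp add: case_prod_unfold)
  then have "delta_x L l (\<lambda>x y. gmat L x y $ s $ j) x y =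
      PD (axis l 1, - N (axis l 1) x y) (\<lambda>x y. ?f x y * (1 / 2)) x y"
    by (rule delta_x_eq) (use p in \<open>auto simp: gmat_nth\<close>)
  also have "\<dots> = PD (axis l 1, - N (axis l 1) x y) ?f x y * (1 / 2)"
    by (rule PD_bounded_linear[OF bounded_linear_mult_left sm2]) (use p in simp)
  finally show ?thesis by (simp add: T_def)
qed

lemma cartan_matrix:
  assumes p: "x \<in> U" "y \<noteq> 0"
  shows "gmat L x y *v cartan V u x y = (\<chi> s. \<Sum>l\<in>UNIV. \<Sum>j\<in>UNIV. V $ l * u $ j *
    (T (axis s 1) (axis l 1) (axis j 1) x y - T (axis l 1) (axis j 1) (axis s 1) x y
     + T (axis j 1) (axis s 1) (axis l 1) x y) / 4)" (is "_ = ?b")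
proof -
  have "cartan V u x y $ k = (matrix_inv (gmat L x y) *v ?b) $ k" for k
  proof -
    let ?t = "\<lambda>s l j. T (axis s 1) (axis l 1) (axis j 1) x y - T (axis l 1) (axis j 1) (axis s 1) x y
     + T (axis j 1) (axis s 1) (axis l 1) x y"
    have "cartan V u x y $ k =
        (\<Sum>l\<in>UNIV. \<Sum>j\<in>UNIV. \<Sum>s\<in>UNIV. matrix_inv (gmat L x y) $ k $ s * (V $ l * u $ j * ?t s l j / 4))"
      by (simp add: cartan_def cartan_h_def delta_gmat[OF p] ginv_def sum_distrib_left sum_distrib_right field_simps)
    also have "\<dots> = (\<Sum>l\<in>UNIV. \<Sum>s\<in>UNIV. \<Sum>j\<in>UNIV. matrix_inv (gmat L x y) $ k $ s * (V $ l * u $ j * ?t s l j / 4))"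
      by (intro sum.cong refl sum.swap)
    also have "\<dots> = (\<Sum>s\<in>UNIV. \<Sum>l\<in>UNIV. \<Sum>j\<in>UNIV. matrix_inv (gmat L x y) $ k $ s * (V $ l * u $ j * ?t s l j / 4))"
      by (rule sum.swap)
    also have "\<dots> = (matrix_inv (gmat L x y) *v ?b) $ k"
      by (simp add: matrix_vector_mult_def sum_distrib_left)
    finally show ?thesis .
  qed
  then have "cartan V u x y = matrix_inv (gmat L x y) *v ?b" by (simp add: vec_eq_iff)
  then show ?thesis by (simp only: gmat_ginv[OF p])
qed

text \<open>The Koszul formula.\<close>

lemma cartan_characterization:
  assumes p: "x \<in> U" "y \<noteq> 0"
  shows "2 * Dy w (Dy (cartan V u x y) L) x y = T w V u x y - T V u w x y + T u w V x y"
proof -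
  have 1: "T w V u x y = (\<Sum>s\<in>UNIV. w $ s * (\<Sum>l\<in>UNIV. \<Sum>j\<in>UNIV. V $ l * u $ j * T (axis s 1) (axis l 1) (axis j 1) x y))"
    unfolding T_expand(1)[OF p, of w V u] unfolding T_expand(2)[OF p, of _ V u]
    unfolding T_expand(3)[OF p, of _ _ u]
    by (simp only: sum_distrib_left mult.assoc)
  have 2: "T V u w x y = (\<Sum>s\<in>UNIV. w $ s * (\<Sum>l\<in>UNIV. \<Sum>j\<in>UNIV. V $ l * u $ j * T (axis l 1) (axis j 1) (axis s 1) x y))"
    unfolding T_expand(3)[OF p, of V u w] unfolding T_expand(1)[OF p, of V u]
    unfolding T_expand(2)[OF p, of _ u]
    by (simp only: sum_distrib_left mult.assoc)
  have 3: "T u w V x y = (\<Sum>s\<in>UNIV. w $ s * (\<Sum>l\<in>UNIV. \<Sum>j\<in>UNIV. V $ l * u $ j * T (axis j 1) (axis s 1) (axis l 1) x y))"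
    unfolding T_expand(2)[OF p, of u w V] unfolding T_expand(3)[OF p, of u _ V]
    unfolding T_expand(1)[OF p, of u]
    by (simp only: sum_distrib_left mult.assoc)
  have "2 * Dy w (Dy (cartan V u x y) L) x y = 4 * (w \<bullet> (gmat L x y *v cartan V u x y))"
    by (simp add: gmat_inner p)
  also have "\<dots> = T w V u x y - T V u w x y + T u w V x y"
    unfolding cartan_matrix[OF p] 1 2 3 inner_vec_def inner_real_def vec_lambda_beta
      sum_distrib_left sum_subtractf[symmetric] sum.distrib[symmetric]
    by (intro sum.cong refl) (simp add: field_simps)
  finally show ?thesis .
qed

text \<open>For \<open>u = y\<close> the last two terms of the Koszul formula reduce to second derivatives of \<open>L\<close>, and the formula
  becomes the characterization of \<open>N\<close>.\<close>

lemma cartan_contraction: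
  assumes p: "x \<in> U" "y \<noteq> 0"
  shows "cartan V y x y = N V x y"
proof (rule nondegenerate[OF p])
  fix w
  have Nl: "Dy (N y x y) f x y = 2 * Dy (S x y) f x y" if "sm f" for f :: "'i rfun"
    using linear_scale[OF linear_Dy[OF that], of x y 2 "S x y"] p by (simp add: N_fibre)
  have "T w V y x y - T V y w x y + T y w V x y = 2 * Dy w (Dy (N V x y) L) x y"
    using N_characterization[OF p, of w V] PD3_swap(2)[OF p, of _ "(0, w)" "(0, V)"]
    by (simp add: T_split[OF p] Euler_PD3_L[OF p] Euler_PD2_L[OF p] Nl[OF sm_PD[OF sm_PD[OF smooth_L]]])
  then show "Dy w (Dy (cartan V y x y) L) x y = Dy w (Dy (N V x y) L) x y"
    using cartan_characterization[OF p, of w V y] by simp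
qed

subsection \<open>Berwald metrics\<close>

lemma Pair_has_derivative: "(Pair x has_derivative Pair 0) (at y)"
  using has_derivative_Pair[OF has_derivative_const has_derivative_ident] .

lemma fibre_derivative:
  fixes f :: "'i rfun"
  assumes f: "sm f" and p: "x \<in> U" "y \<noteq> 0"
  shows "((\<lambda>y. f x y) has_derivative (\<lambda>w. Dy w f x y)) (at y)"
  using PD_chain[OF PD_has_derivative[OF f] Pair_has_derivative refl] p by simp

lemma fibre_derivative_varying:
  fixes f :: "'i rfun"
  assumes f: "sm f" and p: "x \<in> U" "y \<noteq> 0" and l: "linear E"
  shows "((\<lambda>y. Dy (E y) f x y) has_derivative (\<lambda>w. Dy (E y) (Dy w f) x y + Dy (E w) f x y)) (at y)"
proof -
  have H: "(case_prod (\<lambda>x y. (0::real^'i, E y)) has_derivative (\<lambda>h. (0, E (snd h)))) (at (x, y))"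
  proof -
    have "linear (\<lambda>p::(real^'i) \<times> (real^'i). (0::real^'i, E (snd p)))"
      using l by (simp add: linear_iff)
    then show ?thesis
      unfolding case_prod_unfold linear_conv_bounded_linear by (rule bounded_linear_imp_has_derivative)
  qed
  from has_derivative_compose[OF Pair_has_derivative PD_varying_direction_has_derivative[OF f _ H]] p
  show ?thesis by simp
qed

text \<open>A symmetric bilinear form \<open>C\<close> whose horizontal lift annihilates \<open>L\<close> on the fibre at \<open>x\<close> is metric
  and torsion-free, so it coincides there with the Cartan connection.\<close>

context
  fixes x :: "real^'i" and C :: "real^'i \<Rightarrow> real^'i \<Rightarrow> real^'i"
  assumes x: "x \<in> U"
    and C: "\<And>u. linear (\<lambda>y. C y u)" "\<And>u v. C u v = C v u"
    and horizontal: "\<And>y u. y \<noteq> 0 \<Longrightarrow> Dx u L x y = Dy (C y u) L x y"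
begin

lemma symmetric_form_PD2:
  assumes y: "y \<noteq> 0"
  shows "Dx u (Dy w L) x y = Dy (C y u) (Dy w L) x y + Dy (C w u) L x y"
proof -
  have "((\<lambda>y. Dx u L x y) has_derivative (\<lambda>w. Dy (C y u) (Dy w L) x y + Dy (C w u) L x y)) (at y)"
    by (rule has_derivative_transform_within_open[OF fibre_derivative_varying[OF smooth_L x y C(1)[of u]], of "- {0}"])
       (use y horizontal in auto)
  from fun_cong[OF has_derivative_unique[OF this fibre_derivative[OF sm_PD[OF smooth_L] x y]], of w]
  show ?thesis
    using PD_commute[OF smooth_L, of x y "(u, 0)" "(0, w)"] x y by simp
qed

text \<open>Two differentiations of the horizontality of \<open>L\<close> along the fibre show that \<open>C\<close> is metric.\<close>

lemma symmetric_form_PD3: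
  assumes y: "y \<noteq> 0"
  shows "Dx u (Dy w (Dy v L)) x y = Dy (C y u) (Dy w (Dy v L)) x y + Dy (C w u) (Dy v L) x y + Dy (C v u) (Dy w L) x y"
proof -
  have "((\<lambda>y. Dy (C y u) (Dy v L) x y + Dy (C v u) L x y) has_derivative
      (\<lambda>w. (Dy (C y u) (Dy w (Dy v L)) x y + Dy (C w u) (Dy v L) x y) + Dy w (Dy (C v u) L) x y)) (at y)"
    by (intro has_derivative_add fibre_derivative_varying fibre_derivative sm_PD smooth_L x y C)
  then have "((\<lambda>y. Dx u (Dy v L) x y) has_derivative
      (\<lambda>w. (Dy (C y u) (Dy w (Dy v L)) x y + Dy (C w u) (Dy v L) x y) + Dy w (Dy (C v u) L) x y)) (at y)"
    by (rule has_derivative_transform_within_open[of _ _ _ _ "- {0}"])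
       (use y symmetric_form_PD2 in auto)
  from fun_cong[OF has_derivative_unique[OF this fibre_derivative[OF sm_PD[OF sm_PD[OF smooth_L]] x y]], of w]
  show ?thesis
    using PD_commute[OF smooth_L, of x y "(0, w)" "(0, C v u)"] PD3_swap(1)[OF x y, of "(0, w)" "(u, 0)"] x y by simp
qed

lemma symmetric_form_S: "y \<noteq> 0 \<Longrightarrow> S x y = (1 / 2) *\<^sub>R C y y"
proof -
  assume y: "y \<noteq> 0"
  have "2 *\<^sub>R S x y = C y y"
  proof (rule nondegenerate[OF x y])
    fix w
    have "Dy w (Dy (2 *\<^sub>R S x y) L) x y = 2 * Dy w (Dy (S x y) L) x y"
      by (simp add: linear_scale[OF linear_PD_snd[OF x y]])
    also have "\<dots> = Dy (C y y) (Dy w L) x y"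
      unfolding S_characterization[OF x y] symmetric_form_PD2[OF y] horizontal[OF y] using C(2) by simp
    also have "\<dots> = Dy w (Dy (C y y) L) x y"
      using PD_commute[OF smooth_L, of x y] x y by simp
    finally show "Dy w (Dy (2 *\<^sub>R S x y) L) x y = Dy w (Dy (C y y) L) x y" .
  qed
  then have "(1 / 2) *\<^sub>R (2 *\<^sub>R S x y) = (1 / 2) *\<^sub>R C y y" by simp
  then show ?thesis by simp
qed

lemma symmetric_form_N:
  assumes y: "y \<noteq> 0"
  shows "N u x y = C y u"
proof -
  have bil: "bounded_bilinear C"
    using C by (auto simp: bilinear_conv_bounded_bilinear[symmetric] bilinear_def)
  have 1: "((\<lambda>y. S x y) has_derivative (\<lambda>u. PD (0, u) S x y)) (at y)"
    using PD_chain[OF PD_has_derivative[OF smooth_S] Pair_has_derivative refl] x y by simp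
  have 2: "((\<lambda>y. (1 / 2) *\<^sub>R C y y) has_derivative (\<lambda>u. (1 / 2) *\<^sub>R (C y u + C u y))) (at y)"
    by (intro has_derivative_scaleR_right bounded_bilinear.FDERIV[OF bil] has_derivative_ident)
  have "((\<lambda>y. S x y) has_derivative (\<lambda>u. (1 / 2) *\<^sub>R (C y u + C u y))) (at y)"
    by (rule has_derivative_transform_within_open[OF 2, of "- {0}"]) (use y symmetric_form_S in auto)
  from fun_cong[OF has_derivative_unique[OF 1 this], of u]
  have "N u x y = (1 / 2) *\<^sub>R (C y u + C u y)" by (simp add: N_def)
  also have "\<dots> = C y u" unfolding C(2)[of u y] by (simp add: scaleR_2[symmetric])
  finally show ?thesis .
qed

lemma symmetric_form_cartan:
  assumes y: "y \<noteq> 0"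
  shows "cartan V u x y = C V u"
proof (rule nondegenerate[OF x y])
  fix w
  have T: "T w v u x y = Dy (C w u) (Dy v L) x y + Dy (C v u) (Dy w L) x y" for w v u
    unfolding T_split[OF x y] symmetric_form_PD3[OF y] symmetric_form_N[OF y] by simp
  have c: "Dy a (Dy b L) x y = Dy b (Dy a L) x y" for a b
    using PD_commute[OF smooth_L, of x y] x y by simp
  have "2 * Dy w (Dy (cartan V u x y) L) x y = 2 * Dy w (Dy (C V u) L) x y"
    unfolding cartan_characterization[OF x y] T using C(2)[of w V] C(2)[of u w] C(2)[of u V] c[of w "C V u"] by simp
  then show "Dy w (Dy (cartan V u x y) L) x y = Dy w (Dy (C V u) L) x y" by simp
qed

end

end

section \<open>Real and complex coordinates\<close>

lemma sum_UNIV_Plus: "(\<Sum>j\<in>UNIV. f j) = (\<Sum>\<alpha>\<in>UNIV. f (Inl \<alpha>)) + (\<Sum>\<alpha>\<in>UNIV. f (Inr \<alpha>))"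
  for f :: "'a::finite + 'b::finite \<Rightarrow> 'c::comm_monoid_add"
  using sum.Plus[of UNIV UNIV f] by simp

lemma z_of_nth [simp]: "z_of x $ \<alpha> = Complex (x $ Inl \<alpha>) (x $ Inr \<alpha>)"
  by (simp add: z_of_def)

lemma x_of_nth [simp]: "x_of z $ Inl \<alpha> = Re (z $ \<alpha>)" "x_of z $ Inr \<alpha> = Im (z $ \<alpha>)"
  by (simp_all add: x_of_def)

lemma Jop_nth [simp]: "Jop w $ Inl \<alpha> = - (w $ Inr \<alpha>)" "Jop w $ Inr \<alpha> = w $ Inl \<alpha>"
  by (simp_all add: Jop_def)

lemma vec_eq_Plus_iff: "(v :: 'a^('n::finite + 'm::finite)) = w \<longleftrightarrow>
    (\<forall>\<alpha>. v $ Inl \<alpha> = w $ Inl \<alpha>) \<and> (\<forall>\<alpha>. v $ Inr \<alpha> = w $ Inr \<alpha>)"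
  by (metis sum.exhaust vec_eq_iff)

lemma z_of_x_of [simp]: "z_of (x_of z) = z"
  by (simp add: vec_eq_iff)

lemma x_of_z_of [simp]: "x_of (z_of x) = x"
  by (simp add: vec_eq_Plus_iff)

lemma linear_z_of: "linear z_of"
  by (simp add: linear_iff vec_eq_iff complex_eq_iff)

lemma linear_x_of: "linear x_of"
  by (simp add: linear_iff vec_eq_Plus_iff)

lemma bounded_linear_z_of: "bounded_linear z_of" and bounded_linear_x_of: "bounded_linear x_of"
  using linear_z_of linear_x_of by (simp_all add: linear_conv_bounded_linear)

lemma linear_Jop: "linear (Jop :: real^('n::finite + 'n) \<Rightarrow> _)"
  by (simp add: linear_iff vec_eq_Plus_iff)

lemma bounded_linear_Jop: "bounded_linear (Jop :: real^('n::finite + 'n) \<Rightarrow> _)"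
  using linear_Jop by (simp add: linear_conv_bounded_linear)

lemma z_of_Jop: "z_of (Jop x) = \<i> *s z_of x"
  by (simp add: vec_eq_iff complex_eq_iff)

lemma x_of_ii: "x_of (\<i> *s z) = Jop (x_of z)"
  by (simp add: vec_eq_Plus_iff)

lemma Jop_Jop: "Jop (Jop x) = - x" for x :: "real^('n::finite + 'n)"
  by (simp add: vec_eq_Plus_iff)

lemma z_of_eq_0 [simp]: "z_of y = 0 \<longleftrightarrow> y = 0"
  by (metis x_of_z_of linear_0[OF linear_x_of] linear_0[OF linear_z_of])

lemma x_of_eq_0 [simp]: "x_of v = 0 \<longleftrightarrow> v = 0"
  by (metis z_of_x_of linear_0[OF linear_x_of] linear_0[OF linear_z_of])

section \<open>Wirtinger calculus on the holomorphic tangent bundle\<close>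

context open_region
begin

text \<open>The derivative in the direction of the complexified vector \<open>h + i k\<close>.\<close>

definition CD :: "('a \<times> 'b) \<Rightarrow> ('a \<times> 'b) \<Rightarrow> ('a \<Rightarrow> 'b \<Rightarrow> complex) \<Rightarrow> 'a \<Rightarrow> 'b \<Rightarrow> complex" where
  "CD h k f x y = PD h f x y + \<i> * PD k f x y"

lemma sm_add: "sm f \<Longrightarrow> sm g \<Longrightarrow> sm (\<lambda>x y. f x y + g x y)"
  using smooth_on_add[OF _ _ open_region, of "case_prod f" "case_prod g"] by (simp add: case_prod_unfold)

lemma sm_mult: "sm f \<Longrightarrow> sm g \<Longrightarrow> sm (\<lambda>x y. f x y * g x y)" for f g :: "'a \<Rightarrow> 'b \<Rightarrow> 'c::real_normed_algebra"
  using smooth_on_mult[OF _ _ open_region, of "case_prod f" "case_prod g"] by (simp add: case_prod_unfold)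

lemma sm_const: "sm (\<lambda>x y. c)"
  using smooth_on_const[OF open_region, of c] by (simp add: case_prod_unfold)

lemma sm_sum: "(\<And>i. i \<in> I \<Longrightarrow> sm (f i)) \<Longrightarrow> sm (\<lambda>x y. \<Sum>i\<in>I. f i x y)"
  using smooth_on_sum[OF _ open_region, of I "\<lambda>i. case_prod (f i)"] by (simp add: case_prod_unfold)

lemma sm_bounded_linear: "bounded_linear l \<Longrightarrow> sm f \<Longrightarrow> sm (\<lambda>x y. l (f x y))"
  using smooth_on_bounded_linear[OF _ _ open_region, of l "case_prod f"] by (simp add: case_prod_unfold)

lemma sm_CD: "sm f \<Longrightarrow> sm (CD h k f)"
  unfolding CD_def[abs_def] by (intro sm_add sm_mult sm_const sm_PD)

lemma PD_CD:
  assumes "sm f" "(x, y) \<in> \<Omega>"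
  shows "PD l (CD h k f) x y = CD h k (PD l f) x y"
proof -
  have "PD l (\<lambda>x y. PD h f x y + \<i> * PD k f x y) x y = PD l (PD h f) x y + PD l (\<lambda>x y. \<i> * PD k f x y) x y"
    by (intro PD_add sm_mult sm_const sm_PD assms)
  moreover have "PD l (\<lambda>x y. \<i> * PD k f x y) x y = \<i> * PD l (PD k f) x y"
    by (intro PD_bounded_linear[OF bounded_linear_mult_right] sm_PD assms)
  moreover have "CD h k f = (\<lambda>x y. PD h f x y + \<i> * PD k f x y)"
    by (simp add: CD_def[abs_def])
  ultimately show ?thesis
    by (simp add: CD_def PD_commute[OF assms, of l])
qed

lemma CD_commute:
  assumes "sm f" "(x, y) \<in> \<Omega>"
  shows "CD h k (CD a b f) x y = CD a b (CD h k f) x y"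
  unfolding CD_def[of _ _ "CD _ _ _"] PD_CD[OF assms]
  by (simp add: CD_def algebra_simps PD_commute[OF assms, of h] PD_commute[OF assms, of k])

lemma CD_cong:
  "(x, y) \<in> \<Omega> \<Longrightarrow> (\<And>x y. (x, y) \<in> \<Omega> \<Longrightarrow> f x y = g x y) \<Longrightarrow> sm f \<Longrightarrow> CD h k f x y = CD h k g x y"
  unfolding CD_def using PD_cong[of x y f g] by simp

lemma CD_mult:
  "sm f \<Longrightarrow> sm g \<Longrightarrow> (x, y) \<in> \<Omega> \<Longrightarrow> CD h k (\<lambda>x y. f x y * g x y) x y = f x y * CD h k g x y + CD h k f x y * g x y"
  by (simp add: CD_def PD_mult algebra_simps)

lemma CD_sum:
  "(\<And>i. i \<in> I \<Longrightarrow> sm (f i)) \<Longrightarrow> (x, y) \<in> \<Omega> \<Longrightarrow> CD h k (\<lambda>x y. \<Sum>i\<in>I. f i x y) x y = (\<Sum>i\<in>I. CD h k (f i) x y)"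
  by (simp add: CD_def PD_sum sum.distrib sum_distrib_left)

text \<open>Differentiating an Euler relation \<open>\<Sum>\<beta>. w\<^sub>\<beta> B\<^sub>\<beta> f = f\<close>.\<close>

lemma Euler_shift:
  fixes w :: "'i \<Rightarrow> 'a \<Rightarrow> 'b \<Rightarrow> complex"
  assumes f: "sm f" and w: "\<And>\<beta>. sm (w \<beta>)" and p: "(x, y) \<in> \<Omega>"
    and E: "\<And>x y. (x, y) \<in> \<Omega> \<Longrightarrow> (\<Sum>\<beta>\<in>I. w \<beta> x y * CD (a \<beta>) (b \<beta>) f x y) = f x y"
  shows "(\<Sum>\<beta>\<in>I. w \<beta> x y * CD (a \<beta>) (b \<beta>) (CD h k f) x y) =
    CD h k f x y - (\<Sum>\<beta>\<in>I. CD h k (w \<beta>) x y * CD (a \<beta>) (b \<beta>) f x y)"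
proof -
  have "CD h k (\<lambda>x y. \<Sum>\<beta>\<in>I. w \<beta> x y * CD (a \<beta>) (b \<beta>) f x y) x y = CD h k f x y"
    by (rule CD_cong[OF p E]) (auto intro!: sm_sum sm_mult w sm_CD f)
  moreover have "CD h k (\<lambda>x y. \<Sum>\<beta>\<in>I. w \<beta> x y * CD (a \<beta>) (b \<beta>) f x y) x y =
      (\<Sum>\<beta>\<in>I. w \<beta> x y * CD h k (CD (a \<beta>) (b \<beta>) f) x y + CD h k (w \<beta>) x y * CD (a \<beta>) (b \<beta>) f x y)"
    by (subst CD_sum) (auto intro!: sm_mult w sm_CD f p simp: CD_mult[OF w sm_CD[OF f] p])
  ultimately show ?thesis
    by (simp add: sum.distrib CD_commute[OF f p, of h k] eq_diff_eq)
qed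

end

locale complex_region = real_region \<Omega> for \<Omega> :: "((real^('n::finite + 'n)) \<times> (real^('n + 'n))) set"
begin

text \<open>On smooth functions these are \<open>dz\<close>, \<open>dv\<close> and \<open>dvbar\<close>, as instances of \<open>CD\<close>.\<close>

definition DZ :: "'n \<Rightarrow> 'n cfun \<Rightarrow> 'n cfun" where
  "DZ \<alpha> = CD ((1/2) *\<^sub>R axis (Inl \<alpha>) 1, 0) (- (1/2) *\<^sub>R axis (Inr \<alpha>) 1, 0)"

definition DV :: "'n \<Rightarrow> 'n cfun \<Rightarrow> 'n cfun" where
  "DV \<alpha> = CD (0, (1/2) *\<^sub>R axis (Inl \<alpha>) 1) (0, - (1/2) *\<^sub>R axis (Inr \<alpha>) 1)"

definition DVb :: "'n \<Rightarrow> 'n cfun \<Rightarrow> 'n cfun" where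
  "DVb \<alpha> = CD (0, (1/2) *\<^sub>R axis (Inl \<alpha>) 1) (0, (1/2) *\<^sub>R axis (Inr \<alpha>) 1)"

lemma sm_Wirtinger [intro]: "sm f \<Longrightarrow> sm (DZ \<alpha> f)" "sm f \<Longrightarrow> sm (DV \<alpha> f)" "sm f \<Longrightarrow> sm (DVb \<alpha> f)"
  unfolding DZ_def DV_def DVb_def by (rule sm_CD, assumption)+

lemma Wirtinger_commute:
  assumes "sm f" "(x, y) \<in> \<Omega>"
  shows "DV \<alpha> (DZ \<mu> f) x y = DZ \<mu> (DV \<alpha> f) x y" "DVb \<alpha> (DZ \<mu> f) x y = DZ \<mu> (DVb \<alpha> f) x y"
    "DVb \<alpha> (DV \<mu> f) x y = DV \<mu> (DVb \<alpha> f) x y" "DV \<alpha> (DV \<mu> f) x y = DV \<mu> (DV \<alpha> f) x y"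
  unfolding DZ_def DV_def DVb_def by (rule CD_commute[OF assms])+

lemma Wirtinger_alt:
  assumes "sm f" "(x, y) \<in> \<Omega>"
  shows "DZ \<alpha> f x y = (Dx (axis (Inl \<alpha>) 1) f x y - \<i> * Dx (axis (Inr \<alpha>) 1) f x y) / 2"
    "DV \<alpha> f x y = (Dy (axis (Inl \<alpha>) 1) f x y - \<i> * Dy (axis (Inr \<alpha>) 1) f x y) / 2"
    "DVb \<alpha> f x y = (Dy (axis (Inl \<alpha>) 1) f x y + \<i> * Dy (axis (Inr \<alpha>) 1) f x y) / 2"
proof -
  have x: "Dx (a *\<^sub>R u) f x y = of_real a * Dx u f x y" for a u
    using linear_scale[OF linear_Dx[OF assms]] by (simp add: scaleR_conv_of_real)
  have y: "Dy (a *\<^sub>R u) f x y = of_real a * Dy u f x y" for a u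
    using linear_scale[OF linear_Dy[OF assms]] by (simp add: scaleR_conv_of_real)
  show "DZ \<alpha> f x y = (Dx (axis (Inl \<alpha>) 1) f x y - \<i> * Dx (axis (Inr \<alpha>) 1) f x y) / 2"
    "DV \<alpha> f x y = (Dy (axis (Inl \<alpha>) 1) f x y - \<i> * Dy (axis (Inr \<alpha>) 1) f x y) / 2"
    "DVb \<alpha> f x y = (Dy (axis (Inl \<alpha>) 1) f x y + \<i> * Dy (axis (Inr \<alpha>) 1) f x y) / 2"
    unfolding DZ_def DV_def DVb_def CD_def x y by (simp_all add: field_simps)
qed

lemma dz_eq:
  assumes "sm g" "\<And>x y. (x, y) \<in> \<Omega> \<Longrightarrow> f x y = g x y" "(x, y) \<in> \<Omega>"
  shows "dz \<alpha> f x y = DZ \<alpha> g x y"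
proof -
  have "dx j f x y = Dx (axis j 1) g x y" for j
    by (rule dx_eq[OF assms])
  then show ?thesis
    by (simp add: dz_def Wirtinger_alt[OF assms(1,3)])
qed

lemma dv_eq:
  assumes "sm g" "\<And>x y. (x, y) \<in> \<Omega> \<Longrightarrow> f x y = g x y" "(x, y) \<in> \<Omega>"
  shows "dv \<alpha> f x y = DV \<alpha> g x y" "dvbar \<alpha> f x y = DVb \<alpha> g x y"
proof -
  have "dy j f x y = Dy (axis j 1) g x y" for j
    by (rule dy_eq[OF assms])
  then show "dv \<alpha> f x y = DV \<alpha> g x y" "dvbar \<alpha> f x y = DVb \<alpha> g x y"
    by (simp_all add: dv_def dvbar_def Wirtinger_alt[OF assms(1,3)])
qed

text \<open>The fibre coordinates and their conjugates as functions on the bundle.\<close>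

definition vc :: "'n \<Rightarrow> 'n cfun" where "vc \<beta> x y = z_of y $ \<beta>"

definition vcb :: "'n \<Rightarrow> 'n cfun" where "vcb \<beta> x y = cnj (z_of y $ \<beta>)"

lemma PD_linear: "linear (case_prod f) \<Longrightarrow> PD h f x y = case_prod f h"
  by (rule PD_eqI) (simp add: bounded_linear_imp_has_derivative linear_conv_bounded_linear)

lemma linear_vc: "linear (case_prod (vc \<beta>))" and linear_vcb: "linear (case_prod (vcb \<beta>))"
  by (auto simp: linear_iff vc_def vcb_def complex_eq_iff)

lemma sm_vc: "sm (vc \<beta>)" and sm_vcb: "sm (vcb \<beta>)"
  by (intro smooth_on_if_linear linear_vc linear_vcb open_region)+

lemma derivatives_vc:
  "DZ \<alpha> (vc \<beta>) x y = 0" "DV \<alpha> (vc \<beta>) x y = (if \<alpha> = \<beta> then 1 else 0)" "DVb \<alpha> (vc \<beta>) x y = 0"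
  unfolding DZ_def DV_def DVb_def CD_def PD_linear[OF linear_vc]
  by (auto simp: vc_def complex_eq_iff axis_def)

lemma derivatives_vcb:
  "DZ \<alpha> (vcb \<beta>) x y = 0" "DV \<alpha> (vcb \<beta>) x y = 0"
  unfolding DZ_def DV_def CD_def PD_linear[OF linear_vcb]
  by (auto simp: vcb_def complex_eq_iff axis_def)

text \<open>The holomorphic Euler field is the component of type \<open>(1,0)\<close> of the real field \<open>y\<close>, and its imaginary part
  generates the rotations of the fibre.\<close>

lemma sum_vc_DV:
  assumes "sm f" "(x, y) \<in> \<Omega>"
  shows "(\<Sum>\<beta>\<in>UNIV. vc \<beta> x y * DV \<beta> f x y) = (Dy y f x y - \<i> * Dy (Jop y) f x y) / 2"
    and "(\<Sum>\<beta>\<in>UNIV. vcb \<beta> x y * DVb \<beta> f x y) = (Dy y f x y + \<i> * Dy (Jop y) f x y) / 2"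
  unfolding Wirtinger_alt[OF assms] linear_axis_expansion[OF linear_Dy[OF assms], of y]
    linear_axis_expansion[OF linear_Dy[OF assms], of "Jop y"] sum_UNIV_Plus
  by (simp_all add: vc_def vcb_def Complex_eq scaleR_conv_of_real sum_distrib_left sum.distrib[symmetric]
      sum_subtractf[symmetric] sum_divide_distrib sum_negf[symmetric] algebra_simps
      add_divide_distrib diff_divide_distrib)

lemma Euler_shift_vc:
  assumes f: "sm f" and p: "(x, y) \<in> \<Omega>"
    and E: "\<And>x y. (x, y) \<in> \<Omega> \<Longrightarrow> (\<Sum>\<beta>\<in>UNIV. vc \<beta> x y * DV \<beta> f x y) = f x y"
  shows "(\<Sum>\<beta>\<in>UNIV. vc \<beta> x y * DV \<beta> (DZ \<mu> f) x y) = DZ \<mu> f x y"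
    "(\<Sum>\<beta>\<in>UNIV. vc \<beta> x y * DV \<beta> (DVb \<mu> f) x y) = DVb \<mu> f x y"
    "(\<Sum>\<beta>\<in>UNIV. vc \<beta> x y * DV \<beta> (DV \<mu> f) x y) = 0"
proof -
  have *: "(\<Sum>\<beta>\<in>UNIV. vc \<beta> x y * DV \<beta> (CD h k f) x y) =
      CD h k f x y - (\<Sum>\<beta>\<in>UNIV. CD h k (vc \<beta>) x y * DV \<beta> f x y)" for h k
    unfolding DV_def by (rule Euler_shift[OF f sm_vc p E[unfolded DV_def]])
  note DZ = *[of "((1/2) *\<^sub>R axis (Inl \<mu>) 1, 0)" "(- (1/2) *\<^sub>R axis (Inr \<mu>) 1, 0)", folded DZ_def]
    and DV = *[of "(0, (1/2) *\<^sub>R axis (Inl \<mu>) 1)" "(0, - (1/2) *\<^sub>R axis (Inr \<mu>) 1)", folded DV_def]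
    and DVb = *[of "(0, (1/2) *\<^sub>R axis (Inl \<mu>) 1)" "(0, (1/2) *\<^sub>R axis (Inr \<mu>) 1)", folded DVb_def]
  show "(\<Sum>\<beta>\<in>UNIV. vc \<beta> x y * DV \<beta> (DZ \<mu> f) x y) = DZ \<mu> f x y"
    using DZ by (simp add: derivatives_vc)
  show "(\<Sum>\<beta>\<in>UNIV. vc \<beta> x y * DV \<beta> (DVb \<mu> f) x y) = DVb \<mu> f x y"
    using DVb by (simp add: derivatives_vc)
  show "(\<Sum>\<beta>\<in>UNIV. vc \<beta> x y * DV \<beta> (DV \<mu> f) x y) = 0"
    using DV by (simp add: derivatives_vc if_distrib[of "\<lambda>c. c * _"] cong: if_cong)
qed

lemma Euler_shift_vcb:
  assumes f: "sm f" and p: "(x, y) \<in> \<Omega>"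
    and E: "\<And>x y. (x, y) \<in> \<Omega> \<Longrightarrow> (\<Sum>\<beta>\<in>UNIV. vcb \<beta> x y * DVb \<beta> f x y) = f x y"
  shows "(\<Sum>\<beta>\<in>UNIV. vcb \<beta> x y * DVb \<beta> (DZ \<mu> f) x y) = DZ \<mu> f x y"
    "(\<Sum>\<beta>\<in>UNIV. vcb \<beta> x y * DVb \<beta> (DV \<mu> f) x y) = DV \<mu> f x y"
proof -
  have *: "(\<Sum>\<beta>\<in>UNIV. vcb \<beta> x y * DVb \<beta> (CD h k f) x y) =
      CD h k f x y - (\<Sum>\<beta>\<in>UNIV. CD h k (vcb \<beta>) x y * DVb \<beta> f x y)" for h k
    unfolding DVb_def by (rule Euler_shift[OF f sm_vcb p E[unfolded DVb_def]])
  note DZ = *[of "((1/2) *\<^sub>R axis (Inl \<mu>) 1, 0)" "(- (1/2) *\<^sub>R axis (Inr \<mu>) 1, 0)", folded DZ_def]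
    and DV = *[of "(0, (1/2) *\<^sub>R axis (Inl \<mu>) 1)" "(0, - (1/2) *\<^sub>R axis (Inr \<mu>) 1)", folded DV_def]
  show "(\<Sum>\<beta>\<in>UNIV. vcb \<beta> x y * DVb \<beta> (DZ \<mu> f) x y) = DZ \<mu> f x y"
    using DZ by (simp add: derivatives_vcb)
  show "(\<Sum>\<beta>\<in>UNIV. vcb \<beta> x y * DVb \<beta> (DV \<mu> f) x y) = DV \<mu> f x y"
    using DV by (simp add: derivatives_vcb)
qed

end

section \<open>The complex connection coefficients\<close>

text \<open>Homogeneity under complex scalars is homogeneity under positive scalars together with invariance under
  rotations.\<close>

locale complex_finsler = finsler U L for U :: "(real^('n::finite + 'n)) set" and L +
  assumes circular: "\<And>x y \<theta>. x \<in> U \<Longrightarrow> y \<noteq> 0 \<Longrightarrow> L x (cos \<theta> *\<^sub>R y + sin \<theta> *\<^sub>R Jop y) = L x y"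

sublocale complex_finsler \<subseteq> complex_region "slit U"
  by unfold_locales

context complex_finsler
begin

lemma cplx_alt: "cplx L = (\<lambda>x y. complex_of_real (L x y))"
  by (simp add: cplx_def fun_eq_iff)

lemma sm_cplx: "sm (cplx L)"
  unfolding cplx_alt by (rule sm_bounded_linear[OF bounded_linear_of_real smooth_L])

lemma PD_cplx: "x \<in> U \<Longrightarrow> y \<noteq> 0 \<Longrightarrow> PD h (cplx L) x y = complex_of_real (PD h L x y)"
  unfolding cplx_alt by (rule PD_bounded_linear[OF bounded_linear_of_real smooth_L]) simp

lemma Euler_Jop:
  assumes "x \<in> U" "y \<noteq> 0"
  shows "Dy (Jop y) L x y = 0"
proof -
  have "((\<lambda>\<theta>::real. case_prod L (x, cos \<theta> *\<^sub>R y + sin \<theta> *\<^sub>R Jop y)) has_derivative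
      (\<lambda>k. PD (0, k *\<^sub>R Jop y) L x (cos 0 *\<^sub>R y + sin 0 *\<^sub>R Jop y))) (at 0)"
    by (rule PD_chain[OF PD_has_derivative[OF smooth_L]])
       (use assms in \<open>auto intro!: derivative_eq_intros\<close>)
  then have 1: "((\<lambda>\<theta>::real. L x y) has_derivative (\<lambda>k. k *\<^sub>R Dy (Jop y) L x y)) (at 0)"
    using linear_scale[OF linear_Dy[OF smooth_L, of x y]] assms by (simp add: circular)
  from fun_cong[OF has_derivative_unique[OF 1 has_derivative_const], of 1] show ?thesis by simp
qed

subsection \<open>Complex Euler relations\<close>

text \<open>The function \<open>L\<close> is homogeneous of bidegree \<open>(1, 1)\<close> in \<open>v\<close> and its conjugate.\<close>

lemma complex_Euler:
  assumes "x \<in> U" "y \<noteq> 0"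
  shows "(\<Sum>\<beta>\<in>UNIV. vc \<beta> x y * DV \<beta> (cplx L) x y) = cplx L x y"
    and "(\<Sum>\<beta>\<in>UNIV. vcb \<beta> x y * DVb \<beta> (cplx L) x y) = cplx L x y"
  using sum_vc_DV[OF sm_cplx, of x y] assms
  by (simp_all add: PD_cplx Euler_L Euler_Jop cplx_def)

lemma complex_Euler_DVb:
  assumes "x \<in> U" "y \<noteq> 0"
  shows "(\<Sum>\<beta>\<in>UNIV. vc \<beta> x y * DV \<beta> (DVb \<tau> (cplx L)) x y) = DVb \<tau> (cplx L) x y"
  by (rule Euler_shift_vc(2)[OF sm_cplx]) (use assms complex_Euler(1) in auto)

lemma complex_Euler_second:
  assumes "x \<in> U" "y \<noteq> 0"
  shows "(\<Sum>\<beta>\<in>UNIV. vc \<beta> x y * DV \<beta> (DV \<gamma> (DVb \<tau> (cplx L))) x y) = 0"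
    and "(\<Sum>\<beta>\<in>UNIV. vc \<beta> x y * DV \<beta> (DZ \<mu> (DVb \<tau> (cplx L))) x y) = DZ \<mu> (DVb \<tau> (cplx L)) x y"
  by (rule Euler_shift_vc(3,1)[OF sm_Wirtinger(3)[OF sm_cplx]]; use assms complex_Euler_DVb in auto)+

lemma conjugate_Euler:
  assumes "x \<in> U" "y \<noteq> 0"
  shows "(\<Sum>\<beta>\<in>UNIV. vcb \<beta> x y * DVb \<beta> (DZ \<mu> (cplx L)) x y) = DZ \<mu> (cplx L) x y"
    and "(\<Sum>\<beta>\<in>UNIV. vcb \<beta> x y * DVb \<beta> (DV \<mu> (cplx L)) x y) = DV \<mu> (cplx L) x y"
  by (rule Euler_shift_vcb[OF sm_cplx]; use assms complex_Euler(2) in auto)+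

subsection \<open>The Levi matrix\<close>

lemma dvbar_cplx: "x \<in> U \<Longrightarrow> y \<noteq> 0 \<Longrightarrow> dvbar \<tau> (cplx L) x y = DVb \<tau> (cplx L) x y"
  by (rule dv_eq(2)[OF sm_cplx]) auto

lemma Gmat_nth: "x \<in> U \<Longrightarrow> y \<noteq> 0 \<Longrightarrow> Gmat L x y $ \<beta> $ \<tau> = DV \<beta> (DVb \<tau> (cplx L)) x y"
  unfolding Gmat_def vec_lambda_beta by (rule dv_eq(1)[OF sm_Wirtinger(3)[OF sm_cplx]]) (auto simp: dvbar_cplx)

lemma Gmat_gmat:
  assumes "x \<in> U" "y \<noteq> 0"
  shows "Gmat L x y $ \<beta> $ \<tau> =
    (complex_of_real (gmat L x y $ Inl \<beta> $ Inl \<tau> + gmat L x y $ Inr \<beta> $ Inr \<tau>)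
     + \<i> * complex_of_real (gmat L x y $ Inl \<beta> $ Inr \<tau> - gmat L x y $ Inr \<beta> $ Inl \<tau>)) / 2"
proof -
  have p: "(x, y) \<in> slit U" using assms by simp
  have D: "Dy w (DVb \<tau> (cplx L)) x y =
      (complex_of_real (Dy w (Dy (axis (Inl \<tau>) 1) L) x y) + \<i> * complex_of_real (Dy w (Dy (axis (Inr \<tau>) 1) L) x y)) / 2" for w
  proof -
    have PDc: "Dy a (PD (0, w) (cplx L)) x y = complex_of_real (Dy a (PD (0, w) L) x y)" for a
    proof -
      have "Dy a (PD (0, w) (cplx L)) x y = Dy a (\<lambda>x y. complex_of_real (PD (0, w) L x y)) x y"
        by (rule PD_cong[OF p]) (auto simp: PD_cplx intro: sm_PD sm_cplx)
      also have "\<dots> = complex_of_real (Dy a (PD (0, w) L) x y)"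
        by (rule PD_bounded_linear[OF bounded_linear_of_real sm_PD[OF smooth_L] p])
      finally show ?thesis .
    qed
    show ?thesis
      using PD_CD[OF sm_cplx p, of "(0, w)" "(0, (1/2) *\<^sub>R axis (Inl \<tau>) 1)" "(0, (1/2) *\<^sub>R axis (Inr \<tau>) 1)",
          folded DVb_def]
      by (simp add: Wirtinger_alt[OF sm_PD[OF sm_cplx] p] PDc PD_commute[OF smooth_L p, of "(0, w)"])
  qed
  show ?thesis
    unfolding Gmat_nth[OF assms] Wirtinger_alt[OF sm_Wirtinger(3)[OF sm_cplx] p] D gmat_nth[OF assms]
    by (simp add: scaleR_conv_of_real field_simps)
qed

text \<open>Twice the Levi form is the sum of the fundamental tensor over a vector and its rotation by \<open>J\<close>. The vector is built from
  the conjugate of \<open>w\<close> because the columns of the Levi matrix carry the conjugate index.\<close>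

lemma Gmat_positive:
  assumes "x \<in> U" "y \<noteq> 0"
  defines "u \<equiv> \<lambda>w. x_of (\<chi> \<beta>. cnj (w $ \<beta>))"
  shows "2 * Re (\<Sum>\<beta>\<in>UNIV. cnj (w $ \<beta>) * (Gmat L x y *v w) $ \<beta>) =
    u w \<bullet> (gmat L x y *v u w) + Jop (u w) \<bullet> (gmat L x y *v Jop (u w))"
  unfolding matrix_vector_mult_def vec_lambda_beta Gmat_gmat[OF assms(1,2)] u_def inner_vec_def sum_UNIV_Plus
  by (simp add: sum_distrib_left sum.distrib[symmetric] sum_subtractf[symmetric] sum_negf[symmetric] algebra_simps
      add_divide_distrib diff_divide_distrib)

lemma Gmat_invertible:
  assumes "x \<in> U" "y \<noteq> 0"
  shows "invertible (Gmat L x y)"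
proof -
  have "w = 0" if "Gmat L x y *v w = 0" for w
  proof (rule ccontr)
    define u where "u = x_of (\<chi> \<beta>. cnj (w $ \<beta>))"
    assume "w \<noteq> 0"
    then have "(\<chi> \<beta>. cnj (w $ \<beta>)) \<noteq> 0" by (auto simp: vec_eq_iff)
    then have "u \<noteq> 0" by (simp add: u_def)
    moreover from this have "Jop u \<noteq> 0" by (metis Jop_Jop add.inverse_neutral linear_0[OF linear_Jop] neg_equal_0_iff_equal)
    ultimately have "0 < u \<bullet> (gmat L x y *v u) + Jop u \<bullet> (gmat L x y *v Jop u)"
      using positive[OF assms] by (simp add: add_pos_pos)
    moreover have "\<dots> = 0"
      unfolding u_def Gmat_positive[OF assms, symmetric] that by simp
    ultimately show False by simp
  qed
  then have "\<exists>B. B ** Gmat L x y = mat 1"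
    using matrix_left_invertible_ker by blast
  then show ?thesis using invertible_left_inverse by blast
qed

lemma Ginv_Gmat:
  assumes "x \<in> U" "y \<noteq> 0"
  shows "(\<Sum>\<alpha>\<in>UNIV. Ginv L \<tau> \<alpha> x y * DV \<alpha> (DVb \<sigma> (cplx L)) x y) = (if \<tau> = \<sigma> then 1 else 0)"
    and "(\<Sum>\<tau>\<in>UNIV. Ginv L \<tau> \<alpha> x y * DV \<gamma> (DVb \<tau> (cplx L)) x y) = (if \<gamma> = \<alpha> then 1 else 0)"
proof -
  have "(matrix_inv (Gmat L x y) ** Gmat L x y) $ \<tau> $ \<sigma> = mat 1 $ \<tau> $ \<sigma>"
    "(Gmat L x y ** matrix_inv (Gmat L x y)) $ \<gamma> $ \<alpha> = mat 1 $ \<gamma> $ \<alpha>"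
    by (simp_all add: matrix_inv_cancel[OF Gmat_invertible[OF assms]])
  then show "(\<Sum>\<alpha>\<in>UNIV. Ginv L \<tau> \<alpha> x y * DV \<alpha> (DVb \<sigma> (cplx L)) x y) = (if \<tau> = \<sigma> then 1 else 0)"
    "(\<Sum>\<tau>\<in>UNIV. Ginv L \<tau> \<alpha> x y * DV \<gamma> (DVb \<tau> (cplx L)) x y) = (if \<gamma> = \<alpha> then 1 else 0)"
    by (simp_all add: matrix_matrix_mult_def mat_def Ginv_def Gmat_nth[OF assms] mult.commute)
qed

lemma cnonlin_conn_eq:
  assumes "x \<in> U" "y \<noteq> 0"
  shows "cnonlin_conn L \<alpha> \<mu> x y = (\<Sum>\<tau>\<in>UNIV. Ginv L \<tau> \<alpha> x y * DZ \<mu> (DVb \<tau> (cplx L)) x y)"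
proof -
  have "dz \<mu> (dvbar \<tau> (cplx L)) x y = DZ \<mu> (DVb \<tau> (cplx L)) x y" for \<tau>
    by (rule dz_eq[OF sm_Wirtinger(3)[OF sm_cplx]]) (use assms in \<open>auto simp: dvbar_cplx\<close>)
  then show ?thesis by (simp add: cnonlin_conn_def)
qed

lemma delta_z_Gmat:
  assumes "x \<in> U" "y \<noteq> 0"
  shows "delta_z L \<mu> (\<lambda>x y. Gmat L x y $ \<beta> $ \<tau>) x y = DV \<beta> (DZ \<mu> (DVb \<tau> (cplx L))) x y
    - (\<Sum>\<alpha>\<in>UNIV. cnonlin_conn L \<alpha> \<mu> x y * DV \<beta> (DV \<alpha> (DVb \<tau> (cplx L))) x y)"
proof -
  have p: "(x, y) \<in> slit U" using assms by simp
  have "dz \<mu> (\<lambda>x y. Gmat L x y $ \<beta> $ \<tau>) x y = DZ \<mu> (DV \<beta> (DVb \<tau> (cplx L))) x y"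
    by (rule dz_eq[OF sm_Wirtinger(2)[OF sm_Wirtinger(3)[OF sm_cplx]]]) (use assms in \<open>auto simp: Gmat_nth\<close>)
  moreover have "dv \<alpha> (\<lambda>x y. Gmat L x y $ \<beta> $ \<tau>) x y = DV \<alpha> (DV \<beta> (DVb \<tau> (cplx L))) x y" for \<alpha>
    by (rule dv_eq(1)[OF sm_Wirtinger(2)[OF sm_Wirtinger(3)[OF sm_cplx]]]) (use assms in \<open>auto simp: Gmat_nth\<close>)
  ultimately show ?thesis
    using Wirtinger_commute(1,4)[OF sm_Wirtinger(3)[OF sm_cplx] p, of \<beta>]
    unfolding delta_z_def by simp
qed

text \<open>Derivatives of the Levi matrix in \<open>v\<close> are symmetric in the holomorphic indices and the matrix is homogeneous of
  degree \<open>0\<close> in \<open>v\<close>, so the vertical part of \<open>delta_z\<close> contributes nothing to the contraction.\<close>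

lemma ccoeff_contraction:
  assumes "x \<in> U" "y \<noteq> 0"
  shows "(\<Sum>\<beta>\<in>UNIV. ccoeff L \<alpha> \<beta> \<mu> x y * vc \<beta> x y) = cnonlin_conn L \<alpha> \<mu> x y"
proof -
  have d: "(\<Sum>\<beta>\<in>UNIV. vc \<beta> x y * delta_z L \<mu> (\<lambda>x y. Gmat L x y $ \<beta> $ \<tau>) x y) = DZ \<mu> (DVb \<tau> (cplx L)) x y" for \<tau>
  proof -
    have "(\<Sum>\<beta>\<in>UNIV. vc \<beta> x y * delta_z L \<mu> (\<lambda>x y. Gmat L x y $ \<beta> $ \<tau>) x y) =
        DZ \<mu> (DVb \<tau> (cplx L)) x y -
        (\<Sum>\<beta>\<in>UNIV. \<Sum>\<gamma>\<in>UNIV. cnonlin_conn L \<gamma> \<mu> x y * (vc \<beta> x y * DV \<beta> (DV \<gamma> (DVb \<tau> (cplx L))) x y))"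
      by (simp add: delta_z_Gmat[OF assms] right_diff_distrib sum_subtractf complex_Euler_second(2)[OF assms]
          sum_distrib_left mult.left_commute)
    also have "(\<Sum>\<beta>\<in>UNIV. \<Sum>\<gamma>\<in>UNIV. cnonlin_conn L \<gamma> \<mu> x y * (vc \<beta> x y * DV \<beta> (DV \<gamma> (DVb \<tau> (cplx L))) x y)) =
        (\<Sum>\<gamma>\<in>UNIV. cnonlin_conn L \<gamma> \<mu> x y * (\<Sum>\<beta>\<in>UNIV. vc \<beta> x y * DV \<beta> (DV \<gamma> (DVb \<tau> (cplx L))) x y))"
      by (subst sum.swap) (simp add: sum_distrib_left)
    finally show ?thesis by (simp add: complex_Euler_second(1)[OF assms])
  qed
  have "(\<Sum>\<beta>\<in>UNIV. ccoeff L \<alpha> \<beta> \<mu> x y * vc \<beta> x y) =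
      (\<Sum>\<beta>\<in>UNIV. \<Sum>\<tau>\<in>UNIV. Ginv L \<tau> \<alpha> x y * (vc \<beta> x y * delta_z L \<mu> (\<lambda>x y. Gmat L x y $ \<beta> $ \<tau>) x y))"
    by (simp add: ccoeff_def sum_distrib_left sum_distrib_right mult_ac)
  also have "\<dots> = (\<Sum>\<tau>\<in>UNIV. Ginv L \<tau> \<alpha> x y * (\<Sum>\<beta>\<in>UNIV. vc \<beta> x y * delta_z L \<mu> (\<lambda>x y. Gmat L x y $ \<beta> $ \<tau>) x y))"
    by (subst sum.swap) (simp add: sum_distrib_left)
  also have "\<dots> = cnonlin_conn L \<alpha> \<mu> x y"
    by (simp add: d cnonlin_conn_eq[OF assms])
  finally show ?thesis .
qed

text \<open>By the conjugate Euler relation both sides are sums of second derivatives of \<open>L\<close> times conjugate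
  coordinates; on the right the Levi matrix cancels its inverse.\<close>

lemma complex_horizontal_L:
  assumes "x \<in> U" "y \<noteq> 0"
  shows "DZ \<mu> (cplx L) x y = (\<Sum>\<alpha>\<in>UNIV. cnonlin_conn L \<alpha> \<mu> x y * DV \<alpha> (cplx L) x y)"
proof -
  have p: "(x, y) \<in> slit U" using assms by simp
  have DV: "DV \<alpha> (cplx L) x y = (\<Sum>\<sigma>\<in>UNIV. vcb \<sigma> x y * DV \<alpha> (DVb \<sigma> (cplx L)) x y)" for \<alpha>
    using conjugate_Euler(2)[OF assms, of \<alpha>] Wirtinger_commute(3)[OF sm_cplx p] by simp
  have "(\<Sum>\<alpha>\<in>UNIV. cnonlin_conn L \<alpha> \<mu> x y * DV \<alpha> (cplx L) x y) =
      (\<Sum>\<alpha>\<in>UNIV. \<Sum>\<tau>\<in>UNIV. \<Sum>\<sigma>\<in>UNIV. DZ \<mu> (DVb \<tau> (cplx L)) x y * vcb \<sigma> x y *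
        (Ginv L \<tau> \<alpha> x y * DV \<alpha> (DVb \<sigma> (cplx L)) x y))"
    by (simp add: DV cnonlin_conn_eq[OF assms] sum_distrib_left sum_distrib_right mult_ac)
  also have "\<dots> = (\<Sum>\<tau>\<in>UNIV. \<Sum>\<sigma>\<in>UNIV. DZ \<mu> (DVb \<tau> (cplx L)) x y * vcb \<sigma> x y *
        (\<Sum>\<alpha>\<in>UNIV. Ginv L \<tau> \<alpha> x y * DV \<alpha> (DVb \<sigma> (cplx L)) x y))"
    unfolding sum_distrib_left by (subst sum.swap) (intro sum.cong refl sum.swap)
  also have "\<dots> = (\<Sum>\<tau>\<in>UNIV. DZ \<mu> (DVb \<tau> (cplx L)) x y * vcb \<tau> x y)"
    by (simp add: Ginv_Gmat[OF assms] if_distrib cong: if_cong)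
  also have "\<dots> = DZ \<mu> (cplx L) x y"
    using conjugate_Euler(1)[OF assms, of \<mu>] Wirtinger_commute(2)[OF sm_cplx p]
    by (simp add: mult.commute)
  finally show ?thesis by simp
qed

text \<open>Functions that agree on one fibre have the same fibre derivatives there. This allows coefficients that are
  given on a single fibre, with no regularity in the base point.\<close>

lemma fibre_Wirtinger_cong:
  fixes f g :: "'n cfun"
  assumes f: "sm f" and g: "sm g" and p: "x \<in> U" "y \<noteq> 0" and eq: "\<And>y. y \<noteq> 0 \<Longrightarrow> f x y = g x y"
  shows "DV \<alpha> f x y = DV \<alpha> g x y" "DVb \<alpha> f x y = DVb \<alpha> g x y"
proof -
  have d: "((\<lambda>y. f x y) has_derivative (\<lambda>w. Dy w f x y)) (at y)" if "sm f" for f :: "'n cfun"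
    using PD_chain[OF PD_has_derivative[OF that] Pair_has_derivative refl] p by simp
  have "((\<lambda>y. f x y) has_derivative (\<lambda>w. Dy w g x y)) (at y)"
    by (rule has_derivative_transform_within_open[OF d[OF g], of "- {0}"]) (use p eq in auto)
  from has_derivative_unique[OF d[OF f] this]
  have "Dy w f x y = Dy w g x y" for w by metis
  then show "DV \<alpha> f x y = DV \<alpha> g x y" "DVb \<alpha> f x y = DVb \<alpha> g x y"
    by (simp_all add: DV_def DVb_def CD_def)
qed

text \<open>The hypothesis says that a nonlinear connection with values linear in \<open>v\<close> annihilates \<open>L\<close>. Its derivative in the
  conjugate of \<open>v\<close> identifies it with the complex nonlinear connection, and one more derivative, in \<open>v\<close>,
  identifies \<open>C\<close> with the connection coefficients.\<close>

lemma ccoeff_determined: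
  assumes x: "x \<in> U"
    and C: "\<And>y \<mu>. y \<noteq> 0 \<Longrightarrow> DZ \<mu> (cplx L) x y = (\<Sum>\<alpha>\<in>UNIV. (\<Sum>\<beta>\<in>UNIV. C \<alpha> \<beta> \<mu> * vc \<beta> x y) * DV \<alpha> (cplx L) x y)"
    and y: "y \<noteq> 0"
  shows "ccoeff L \<alpha> \<beta> \<mu> x y = C \<alpha> \<beta> \<mu>"
proof -
  let ?N = "\<lambda>\<alpha> \<mu> x y. \<Sum>\<beta>\<in>UNIV. C \<alpha> \<beta> \<mu> * vc \<beta> x y"
  have smN: "sm (?N \<alpha> \<mu>)" for \<alpha> \<mu>
    by (intro sm_sum sm_mult sm_const sm_vc)
  have CDN: "CD h k (?N \<alpha> \<mu>) x y = (\<Sum>\<beta>\<in>UNIV. C \<alpha> \<beta> \<mu> * CD h k (vc \<beta>) x y)" if "y \<noteq> 0" for h k \<alpha> \<mu> y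
  proof -
    have p: "(x, y) \<in> slit U" using x that by simp
    have c0: "CD h k (\<lambda>x y. c) x y = 0" for c by (simp add: CD_def PD_const)
    have "CD h k (?N \<alpha> \<mu>) x y = (\<Sum>\<beta>\<in>UNIV. CD h k (\<lambda>x y. C \<alpha> \<beta> \<mu> * vc \<beta> x y) x y)"
      by (rule CD_sum[OF _ p]) (intro sm_mult sm_const sm_vc)
    then show ?thesis by (simp add: CD_mult[OF sm_const sm_vc p] c0)
  qed
  have prod: "CD h k (\<lambda>x y. \<Sum>\<alpha>\<in>UNIV. ?N \<alpha> \<mu> x y * f \<alpha> x y) x y =
      (\<Sum>\<alpha>\<in>UNIV. ?N \<alpha> \<mu> x y * CD h k (f \<alpha>) x y + (\<Sum>\<beta>\<in>UNIV. C \<alpha> \<beta> \<mu> * CD h k (vc \<beta>) x y) * f \<alpha> x y)"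
    if "y \<noteq> 0" "\<And>\<alpha>. sm (f \<alpha>)" for h k \<mu> y and f :: "'n \<Rightarrow> 'n cfun"
  proof -
    have p: "(x, y) \<in> slit U" using x that by simp
    have "CD h k (\<lambda>x y. \<Sum>\<alpha>\<in>UNIV. ?N \<alpha> \<mu> x y * f \<alpha> x y) x y = (\<Sum>\<alpha>\<in>UNIV. CD h k (\<lambda>x y. ?N \<alpha> \<mu> x y * f \<alpha> x y) x y)"
      by (rule CD_sum[OF _ p]) (intro sm_mult smN that)
    then show ?thesis by (simp add: CD_mult[OF smN that(2) p] CDN[OF that(1)])
  qed
  have prodVb: "DVb \<tau> (\<lambda>x y. \<Sum>\<alpha>\<in>UNIV. ?N \<alpha> \<mu> x y * f \<alpha> x y) x y = (\<Sum>\<alpha>\<in>UNIV. ?N \<alpha> \<mu> x y * DVb \<tau> (f \<alpha>) x y)"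
    if "y \<noteq> 0" "\<And>\<alpha>. sm (f \<alpha>)" for \<tau> \<mu> y and f :: "'n \<Rightarrow> 'n cfun"
  proof -
    have "DVb \<tau> (\<lambda>x y. \<Sum>\<alpha>\<in>UNIV. ?N \<alpha> \<mu> x y * f \<alpha> x y) x y = (\<Sum>\<alpha>\<in>UNIV. ?N \<alpha> \<mu> x y * DVb \<tau> (f \<alpha>) x y
        + (\<Sum>\<beta>\<in>UNIV. C \<alpha> \<beta> \<mu> * DVb \<tau> (vc \<beta>) x y) * f \<alpha> x y)"
      unfolding DVb_def by (rule prod[OF that])
    then show ?thesis by (simp add: derivatives_vc)
  qed
  have prodV: "DV \<gamma> (\<lambda>x y. \<Sum>\<alpha>\<in>UNIV. ?N \<alpha> \<mu> x y * f \<alpha> x y) x y =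
      (\<Sum>\<alpha>\<in>UNIV. ?N \<alpha> \<mu> x y * DV \<gamma> (f \<alpha>) x y + C \<alpha> \<gamma> \<mu> * f \<alpha> x y)"
    if "y \<noteq> 0" "\<And>\<alpha>. sm (f \<alpha>)" for \<gamma> \<mu> y and f :: "'n \<Rightarrow> 'n cfun"
  proof -
    have "DV \<gamma> (\<lambda>x y. \<Sum>\<alpha>\<in>UNIV. ?N \<alpha> \<mu> x y * f \<alpha> x y) x y = (\<Sum>\<alpha>\<in>UNIV. ?N \<alpha> \<mu> x y * DV \<gamma> (f \<alpha>) x y
        + (\<Sum>\<beta>\<in>UNIV. C \<alpha> \<beta> \<mu> * DV \<gamma> (vc \<beta>) x y) * f \<alpha> x y)"
      unfolding DV_def by (rule prod[OF that])
    then show ?thesis by (simp add: derivatives_vc if_distrib cong: if_cong)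
  qed
  have 1: "DZ \<mu> (DVb \<tau> (cplx L)) x y = (\<Sum>\<alpha>\<in>UNIV. ?N \<alpha> \<mu> x y * DV \<alpha> (DVb \<tau> (cplx L)) x y)" if y: "y \<noteq> 0" for y \<mu> \<tau>
  proof -
    have p: "(x, y) \<in> slit U" using x y by simp
    have "DVb \<tau> (DZ \<mu> (cplx L)) x y = DVb \<tau> (\<lambda>x y. \<Sum>\<alpha>\<in>UNIV. ?N \<alpha> \<mu> x y * DV \<alpha> (cplx L) x y) x y"
    proof (rule fibre_Wirtinger_cong(2)[where f = "DZ \<mu> (cplx L)" and
          g = "\<lambda>x y. \<Sum>\<alpha>\<in>UNIV. ?N \<alpha> \<mu> x y * DV \<alpha> (cplx L) x y"])
      show "sm (\<lambda>x y. \<Sum>\<alpha>\<in>UNIV. ?N \<alpha> \<mu> x y * DV \<alpha> (cplx L) x y)"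
        by (intro sm_sum sm_mult smN sm_vc sm_const sm_Wirtinger sm_cplx)
    qed (use x y C in \<open>auto intro: sm_cplx\<close>)
    also have "\<dots> = (\<Sum>\<alpha>\<in>UNIV. ?N \<alpha> \<mu> x y * DVb \<tau> (DV \<alpha> (cplx L)) x y)"
      by (rule prodVb[OF y]) (intro sm_Wirtinger sm_cplx)
    finally show ?thesis
      by (simp only: Wirtinger_commute(2,3)[OF sm_cplx p])
  qed
  have 2: "DV \<beta> (DZ \<mu> (DVb \<tau> (cplx L))) x y = (\<Sum>\<alpha>\<in>UNIV. ?N \<alpha> \<mu> x y * DV \<beta> (DV \<alpha> (DVb \<tau> (cplx L))) x y
      + C \<alpha> \<beta> \<mu> * DV \<alpha> (DVb \<tau> (cplx L)) x y)" for \<beta> \<mu> \<tau>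
  proof -
    have "DV \<beta> (DZ \<mu> (DVb \<tau> (cplx L))) x y = DV \<beta> (\<lambda>x y. \<Sum>\<alpha>\<in>UNIV. ?N \<alpha> \<mu> x y * DV \<alpha> (DVb \<tau> (cplx L)) x y) x y"
    proof (rule fibre_Wirtinger_cong(1)[where f = "DZ \<mu> (DVb \<tau> (cplx L))" and
          g = "\<lambda>x y. \<Sum>\<alpha>\<in>UNIV. ?N \<alpha> \<mu> x y * DV \<alpha> (DVb \<tau> (cplx L)) x y"])
      show "sm (\<lambda>x y. \<Sum>\<alpha>\<in>UNIV. ?N \<alpha> \<mu> x y * DV \<alpha> (DVb \<tau> (cplx L)) x y)"
        by (intro sm_sum sm_mult smN sm_vc sm_const sm_Wirtinger sm_cplx)
    qed (use x y 1 in \<open>auto intro: sm_cplx\<close>)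
    also have "\<dots> = (\<Sum>\<alpha>\<in>UNIV. ?N \<alpha> \<mu> x y * DV \<beta> (DV \<alpha> (DVb \<tau> (cplx L))) x y
        + C \<alpha> \<beta> \<mu> * DV \<alpha> (DVb \<tau> (cplx L)) x y)"
      by (rule prodV[OF y]) (intro sm_Wirtinger sm_cplx)
    finally show ?thesis .
  qed
  have N: "cnonlin_conn L \<alpha> \<mu> x y = ?N \<alpha> \<mu> x y" for \<alpha> \<mu>
  proof -
    have "cnonlin_conn L \<alpha> \<mu> x y =
        (\<Sum>\<tau>\<in>UNIV. \<Sum>\<gamma>\<in>UNIV. ?N \<gamma> \<mu> x y * (Ginv L \<tau> \<alpha> x y * DV \<gamma> (DVb \<tau> (cplx L)) x y))"
      unfolding cnonlin_conn_eq[OF x y] 1[OF y] by (subst sum_distrib_left) (simp add: mult.left_commute)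
    also have "\<dots> = (\<Sum>\<gamma>\<in>UNIV. ?N \<gamma> \<mu> x y * (\<Sum>\<tau>\<in>UNIV. Ginv L \<tau> \<alpha> x y * DV \<gamma> (DVb \<tau> (cplx L)) x y))"
      by (subst sum.swap) (simp add: sum_distrib_left[of "?N _ _ _ _"])
    also have "\<dots> = ?N \<alpha> \<mu> x y"
      by (simp add: Ginv_Gmat[OF x y] if_distrib cong: if_cong)
    finally show ?thesis .
  qed
  have "delta_z L \<mu> (\<lambda>x y. Gmat L x y $ \<beta> $ \<tau>) x y = (\<Sum>\<gamma>\<in>UNIV. C \<gamma> \<beta> \<mu> * DV \<gamma> (DVb \<tau> (cplx L)) x y)" for \<tau>
    unfolding delta_z_Gmat[OF x y] 2 N by (simp add: sum.distrib)
  then have "ccoeff L \<alpha> \<beta> \<mu> x y =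
      (\<Sum>\<tau>\<in>UNIV. \<Sum>\<gamma>\<in>UNIV. C \<gamma> \<beta> \<mu> * (Ginv L \<tau> \<alpha> x y * DV \<gamma> (DVb \<tau> (cplx L)) x y))"
    by (simp add: ccoeff_def sum_distrib_left mult.left_commute)
  also have "\<dots> = (\<Sum>\<gamma>\<in>UNIV. C \<gamma> \<beta> \<mu> * (\<Sum>\<tau>\<in>UNIV. Ginv L \<tau> \<alpha> x y * DV \<gamma> (DVb \<tau> (cplx L)) x y))"
    by (subst sum.swap) (simp add: sum_distrib_left)
  also have "\<dots> = C \<alpha> \<beta> \<mu>"
    by (simp add: Ginv_Gmat[OF x y] if_distrib cong: if_cong)
  finally show ?thesis .
qed

subsection \<open>Real and complex horizontal lifts\<close>

lemma real_part_derivative: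
  assumes "x \<in> U" "y \<noteq> 0"
  shows "Dy w L x y = 2 * Re (\<Sum>\<alpha>\<in>UNIV. z_of w $ \<alpha> * DV \<alpha> (cplx L) x y)"
    and "Dx w L x y = 2 * Re (\<Sum>\<alpha>\<in>UNIV. z_of w $ \<alpha> * DZ \<alpha> (cplx L) x y)"
proof -
  have p: "(x, y) \<in> slit U" using assms by simp
  show "Dy w L x y = 2 * Re (\<Sum>\<alpha>\<in>UNIV. z_of w $ \<alpha> * DV \<alpha> (cplx L) x y)"
    unfolding Wirtinger_alt[OF sm_cplx p] PD_cplx[OF assms] linear_axis_expansion[OF linear_Dy[OF smooth_L p], of w] sum_UNIV_Plus
    by (simp add: sum_distrib_left sum.distrib[symmetric] algebra_simps add_divide_distrib)
  show "Dx w L x y = 2 * Re (\<Sum>\<alpha>\<in>UNIV. z_of w $ \<alpha> * DZ \<alpha> (cplx L) x y)"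
    unfolding Wirtinger_alt[OF sm_cplx p] PD_cplx[OF assms] linear_axis_expansion[OF linear_Dx[OF smooth_L p], of w] sum_UNIV_Plus
    by (simp add: sum_distrib_left sum.distrib[symmetric] algebra_simps add_divide_distrib)
qed

text \<open>Real derivatives are twice the real parts of complex ones, and a complex number \<open>d\<close> vanishes if
  the real parts of all its complex multiples do.\<close>

lemma horizontal_real_iff_complex:
  assumes p: "x \<in> U" "y \<noteq> 0"
  shows "(\<forall>u. Dx u L x y = Dy (x_of (M *v z_of u)) L x y) \<longleftrightarrow>
    (\<forall>\<mu>. DZ \<mu> (cplx L) x y = (\<Sum>\<alpha>\<in>UNIV. M $ \<alpha> $ \<mu> * DV \<alpha> (cplx L) x y))"
proof -
  define d where "d = (\<lambda>\<mu>. DZ \<mu> (cplx L) x y - (\<Sum>\<alpha>\<in>UNIV. M $ \<alpha> $ \<mu> * DV \<alpha> (cplx L) x y))"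
  have swap: "(\<Sum>\<alpha>\<in>UNIV. (M *v v) $ \<alpha> * DV \<alpha> (cplx L) x y) =
      (\<Sum>\<mu>\<in>UNIV. v $ \<mu> * (\<Sum>\<alpha>\<in>UNIV. M $ \<alpha> $ \<mu> * DV \<alpha> (cplx L) x y))" for v
    by (simp add: matrix_vector_mult_def sum_distrib_left sum_distrib_right mult_ac) (rule sum.swap)
  have diff: "Dx u L x y - Dy (x_of (M *v z_of u)) L x y = 2 * Re (\<Sum>\<mu>\<in>UNIV. z_of u $ \<mu> * d \<mu>)" for u
    unfolding real_part_derivative[OF p] z_of_x_of swap d_def
    by (simp add: right_diff_distrib sum_subtractf del: z_of_nth)
  have "Dx u L x y = Dy (x_of (M *v z_of u)) L x y \<longleftrightarrow> Re (\<Sum>\<mu>\<in>UNIV. z_of u $ \<mu> * d \<mu>) = 0" for u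
    using diff[of u] by (intro iffI) linarith+
  then have "(\<forall>u. Dx u L x y = Dy (x_of (M *v z_of u)) L x y) \<longleftrightarrow> (\<forall>u. Re (\<Sum>\<mu>\<in>UNIV. z_of u $ \<mu> * d \<mu>) = 0)"
    by (simp only:)
  also have "\<dots> \<longleftrightarrow> (\<forall>\<mu>. d \<mu> = 0)"
  proof safe
    fix \<mu> assume a: "\<forall>u. Re (\<Sum>\<mu>\<in>UNIV. z_of u $ \<mu> * d \<mu>) = 0"
    have "Re (c * d \<mu>) = 0" for c
    proof -
      have "(\<Sum>\<nu>\<in>UNIV. (if \<nu> = \<mu> then c else 0) * d \<nu>) = c * d \<mu>"
        by (simp add: if_distrib[of "\<lambda>a. a * _"] cong: if_cong)
      then show ?thesis
        using a[rule_format, of "x_of (axis \<mu> c)"] by (simp add: axis_def del: z_of_nth)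
    qed
    from this[of 1] this[of \<i>] show "d \<mu> = 0" by (simp add: complex_eq_iff)
  qed simp
  finally show ?thesis by (simp add: d_def)
qed

end

section \<open>Liouville's theorem for homogeneous maps\<close>

lemma bounded_holomorphic_constant_on_line:
  fixes h :: "complex^'n::finite \<Rightarrow> complex^'m::finite"
  assumes hol: "holomorphic_map_on S h" and B: "\<And>v. v \<in> S \<Longrightarrow> norm (h v) \<le> B"
    and line: "\<And>\<zeta>. v + \<zeta> *s w \<in> S"
  shows "h (v + w) = h v"
proof -
  have "h (v + w) $ i = h v $ i" for i
  proof -
    define g where "g = (\<lambda>\<zeta>. h (v + \<zeta> *s w) $ i)"
    have "g holomorphic_on UNIV"
      using complex_differentiable_on_line[OF holomorphic_map_on_nth[OF hol] line]
      unfolding g_def holomorphic_on_open[OF open_UNIV] by blast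
    moreover have "norm (g \<zeta>) \<le> B" for \<zeta>
      using B[OF line] Finite_Cartesian_Product.norm_nth_le[of "h (v + \<zeta> *s w)" i] unfolding g_def by (rule order_trans[rotated])
    then have "bounded (range g)" unfolding bounded_iff by blast
    ultimately have "g constant_on UNIV" by (rule Liouville_theorem)
    then have "g 1 = g 0" unfolding constant_on_def by (metis UNIV_I)
    then show ?thesis by (simp add: g_def)
  qed
  then show ?thesis by (simp add: vec_eq_iff)
qed

text \<open>The map is bounded by its maximum on the unit sphere, so it is constant on complex lines that avoid the
  origin. A vector with nonzero coordinate \<open>i\<close> and a nonzero one with zero coordinate \<open>i\<close> lie on such a
  line, and at most three of these steps join any two vectors.\<close>

lemma homogeneous_holomorphic_constant:
  fixes h :: "complex^'n::finite \<Rightarrow> complex^'m::finite"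
  assumes n: "CARD('n) \<ge> 2" and hol: "holomorphic_map_on (- {0}) h"
    and hom: "\<And>v t. v \<noteq> 0 \<Longrightarrow> 0 < t \<Longrightarrow> h (t *\<^sub>R v) = h v"
    and v: "v \<noteq> 0" and w: "w \<noteq> 0"
  shows "h v = h w"
proof -
  have "continuous_on (sphere 0 1) h"
    using hol by (auto intro!: continuous_at_imp_continuous_on has_derivative_continuous holomorphic_map_onD(1)[OF hol])
  then have "bounded (h ` sphere 0 1)"
    by (intro compact_imp_bounded compact_continuous_image compact_sphere)
  then obtain B where B: "\<And>v. norm v = 1 \<Longrightarrow> norm (h v) \<le> B"
    by (fastforce simp: bounded_iff)
  have B': "norm (h v) \<le> B" if "v \<in> - {0}" for v
    using B[of "(1 / norm v) *\<^sub>R v"] hom[of v "1 / norm v"] that by auto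
  have step: "h a = h u" if "a $ i \<noteq> 0" "u $ i = 0" "u \<noteq> 0" for a u i
  proof -
    have "a + \<zeta> *s (u - a) \<in> - {0}" for \<zeta>
    proof
      assume "a + \<zeta> *s (u - a) \<in> {0}"
      then have z: "a + \<zeta> *s (u - a) = 0" by simp
      then have "(a + \<zeta> *s (u - a)) $ i = 0" by simp
      then have "a $ i * (1 - \<zeta>) = 0" using that by (simp add: algebra_simps)
      then have "\<zeta> = 1" using that by simp
      with z show False using that by simp
    qed
    from bounded_holomorphic_constant_on_line[OF hol B' this] show ?thesis by simp
  qed
  have ex: "\<exists>j. j \<noteq> i" for i :: 'n
  proof (rule ccontr)
    assume "\<nexists>j. j \<noteq> i"
    then have "UNIV = {i}" by auto
    then have "CARD('n) = card {i}" by (rule arg_cong)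
    with n show False by simp
  qed
  obtain i where i: "v $ i \<noteq> 0" using v by (auto simp: vec_eq_iff)
  obtain k where k: "w $ k \<noteq> 0" using w by (auto simp: vec_eq_iff)
  obtain j where j: "j \<noteq> i" using ex by blast
  show ?thesis
  proof (cases "i = k")
    case True
    with step[OF i, of "axis j 1"] step[OF k, of "axis j 1"] j show ?thesis by (simp add: axis_def vec_eq_iff)
  next
    case False
    have "h v = h (axis k 1)" using step[OF i, of "axis k 1"] False by (simp add: axis_def vec_eq_iff)
    moreover have "h w = h (axis i 1)" using step[OF k, of "axis i 1"] False by (simp add: axis_def vec_eq_iff)
    moreover have "h (axis k 1) = h (axis i 1)" using step[of "axis k 1" k "axis i 1"] False by (simp add: axis_def vec_eq_iff)
    ultimately show ?thesis by simp
  qed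
qed

section \<open>Homogeneity and continuity of the nonlinear connection\<close>

context finsler
begin

lemma Euler_S:
  assumes "x \<in> U" "y \<noteq> 0"
  shows "Dy y (Dy b S) x y = Dy b S x y" "Dy y (Dy a (Dy b S)) x y = 0"
proof -
  have 1: "Dy y (Dy b S) x y = 1 *\<^sub>R Dy b S x y" if "x \<in> U" "y \<noteq> 0" for x y b
    using Euler_derivative_vector[OF smooth_S _ that, of 2 0 b] N_fibre by (simp add: N_def scaleR_2)
  then show "Dy y (Dy b S) x y = Dy b S x y" using assms by simp
  show "Dy y (Dy a (Dy b S)) x y = 0"
    using Euler_derivative_vector[OF sm_PD[OF smooth_S] 1 assms, of 0 a] by simp
qed

text \<open>By Euler's relation the radial derivative vanishes.\<close>

lemma S_second_derivative_homogeneous: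
  assumes x: "x \<in> U" and y: "y \<noteq> 0" and t: "0 < t"
  shows "Dy a (Dy b S) x (t *\<^sub>R y) = Dy a (Dy b S) x y"
proof -
  have sm2: "sm (Dy a (Dy b S))" by (intro sm_PD smooth_S)
  have "((\<lambda>t. Dy a (Dy b S) x (t *\<^sub>R y)) has_derivative (\<lambda>_. 0)) (at t within {0<..})" if "t \<in> {0<..}" for t
  proof -
    have "((\<lambda>t::real. case_prod (Dy a (Dy b S)) (x, t *\<^sub>R y)) has_derivative
        (\<lambda>k. PD (0, k *\<^sub>R y) (Dy a (Dy b S)) x (t *\<^sub>R y))) (at t)"
      by (rule PD_chain[OF PD_has_derivative[OF sm2]])
         (use that x y in \<open>auto intro!: derivative_eq_intros\<close>)
    moreover have "PD (0, k *\<^sub>R y) (Dy a (Dy b S)) x (t *\<^sub>R y) = 0" for k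
    proof -
      have "k *\<^sub>R y = (k / t) *\<^sub>R (t *\<^sub>R y)" using that by simp
      then have "PD (0, k *\<^sub>R y) (Dy a (Dy b S)) x (t *\<^sub>R y) = (k / t) *\<^sub>R Dy (t *\<^sub>R y) (Dy a (Dy b S)) x (t *\<^sub>R y)"
        using linear_scale[OF linear_Dy[OF sm2], of x "t *\<^sub>R y" "k / t" "t *\<^sub>R y"] that x y by simp
      then show ?thesis using Euler_S(2)[OF x, of "t *\<^sub>R y"] that y by simp
    qed
    ultimately show ?thesis by (simp add: has_derivative_at_withinI)
  qed
  then have "\<exists>c. \<forall>t\<in>{0<..}. Dy a (Dy b S) x (t *\<^sub>R y) = c"
    by (intro has_derivative_zero_constant) (auto simp: convex_real_interval)
  then have "Dy a (Dy b S) x (t *\<^sub>R y) = Dy a (Dy b S) x (1 *\<^sub>R y)"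
    using t by (metis greaterThan_iff zero_less_one)
  then show ?thesis by simp
qed

lemma N_homogeneous:
  assumes "x \<in> U" "y \<noteq> 0" "0 < t"
  shows "N b x (t *\<^sub>R y) = t *\<^sub>R N b x y"
proof -
  have "N b x (t *\<^sub>R y) = Dy (t *\<^sub>R y) (Dy b S) x (t *\<^sub>R y)"
    unfolding N_def by (rule Euler_S(1)[symmetric]) (use assms in auto)
  also have "\<dots> = Dy (t *\<^sub>R y) (Dy b S) x y"
    by (rule S_second_derivative_homogeneous[OF assms])
  also have "\<dots> = t *\<^sub>R N b x y"
    using linear_scale[OF linear_Dy[OF sm_PD[OF smooth_S]], of x y] assms by (simp add: Euler_S(1) N_def)
  finally show ?thesis .
qed

lemma continuous_on_N: "continuous_on (slit U) (\<lambda>(x, y). N u x y)"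
  using smooth_on_continuous_on[OF sm_PD[OF smooth_S, of "(0, u)"]] by (simp add: N_def)

lemma norm_N_le:
  assumes "x \<in> U" "y \<noteq> 0"
  shows "norm (N u x y) \<le> (\<Sum>j\<in>UNIV. norm (N (axis j 1) x y)) * norm u"
proof -
  have "norm (N u x y) \<le> (\<Sum>j\<in>UNIV. norm (u $ j *\<^sub>R N (axis j 1) x y))"
    unfolding linear_axis_expansion[OF linear_N[OF assms], of u] by (rule norm_sum)
  also have "\<dots> \<le> (\<Sum>j\<in>UNIV. norm u * norm (N (axis j 1) x y))"
    by (intro sum_mono) (simp add: component_le_norm_cart mult_right_mono)
  finally show ?thesis by (simp add: sum_distrib_left mult.commute)
qed

end

section \<open>Kaehler-Berwald metrics in a coordinate domain\<close>

lemma complex_linearI: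
  fixes g :: "complex^'n::finite \<Rightarrow> complex^'m::finite"
  assumes "linear g" "\<And>v. g (\<i> *s v) = \<i> *s g v"
  shows "g (c *s v) = c *s g v"
proof -
  have split: "c *s v = Re c *\<^sub>R v + Im c *\<^sub>R (\<i> *s v)" for c and v :: "complex^'k::finite"
    by (simp add: vec_eq_iff complex_eq_iff)
  show ?thesis
    unfolding split[of c v] split[of c "g v"]
    by (simp add: linear_add[OF assms(1)] linear_scale[OF assms(1)] assms(2))
qed

lemma complex_linear_axis_expansion:
  fixes g :: "complex^'n::finite \<Rightarrow> complex^'m::finite"
  assumes "linear g" "\<And>v. g (\<i> *s v) = \<i> *s g v"
  shows "g v = (\<Sum>\<beta>\<in>UNIV. v $ \<beta> *s g (axis \<beta> 1))"
proof -
  have "g v = g (\<Sum>\<beta>\<in>UNIV. v $ \<beta> *s axis \<beta> 1)" by (simp add: basis_expansion)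
  also have "\<dots> = (\<Sum>\<beta>\<in>UNIV. v $ \<beta> *s g (axis \<beta> 1))"
    by (simp add: linear_sum[OF assms(1)] complex_linearI[OF assms])
  finally show ?thesis .
qed

context complex_finsler
begin

text \<open>The coefficients define a complex bilinear form on the fibre whose lift annihilates \<open>L\<close>; it is symmetric by the
  Kaehler condition, so it is the Cartan connection.\<close>

lemma Berwald_imp_cartan_complex_linear:
  assumes x: "x \<in> U" and y: "y \<noteq> 0"
    and Berwald: "\<And>y' \<alpha> \<beta> \<mu>. y' \<noteq> 0 \<Longrightarrow> ccoeff L \<alpha> \<beta> \<mu> x y' = ccoeff L \<alpha> \<beta> \<mu> x y"
    and Kaehler: "\<And>\<alpha> \<beta> \<mu>. ccoeff L \<alpha> \<beta> \<mu> x y = ccoeff L \<alpha> \<mu> \<beta> x y"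
  shows "cartan (Jop V) u x y = Jop (cartan V u x y)"
proof -
  define C where "C = (\<lambda>v w. \<chi> \<alpha>. \<Sum>\<mu>\<in>UNIV. \<Sum>\<beta>\<in>UNIV. ccoeff L \<alpha> \<beta> \<mu> x y * v $ \<beta> * w $ \<mu>)"
  have sym: "C v w = C w v" for v w
    unfolding C_def vec_eq_iff vec_lambda_beta
    by (subst sum.swap) (simp add: mult_ac Kaehler[of _ _ "_::'n"] cong: sum.cong)
  have lin: "linear (\<lambda>v. x_of (C (z_of v) (z_of u)))" for u
    by (intro linear_compose[OF _ linear_x_of, unfolded o_def] linear_compose[OF linear_z_of, unfolded o_def])
       (simp add: linear_iff C_def vec_eq_iff sum_distrib_left sum.distrib algebra_simps scaleR_conv_of_real[where 'a = complex])
  have hor: "Dx u L x y' = Dy (x_of (C (z_of y') (z_of u))) L x y'" if y': "y' \<noteq> 0" for y' u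
  proof -
    define M where "M = (\<chi> \<alpha> \<mu>. \<Sum>\<beta>\<in>UNIV. ccoeff L \<alpha> \<beta> \<mu> x y * vc \<beta> x y')"
    have "\<forall>\<mu>. DZ \<mu> (cplx L) x y' = (\<Sum>\<alpha>\<in>UNIV. M $ \<alpha> $ \<mu> * DV \<alpha> (cplx L) x y')"
      unfolding complex_horizontal_L[OF x y'] ccoeff_contraction[OF x y', symmetric] M_def vec_lambda_beta Berwald[OF y'] by simp
    then have "Dx u L x y' = Dy (x_of (M *v z_of u)) L x y'"
      using horizontal_real_iff_complex[OF x y', of M] by blast
    moreover have "M *v z_of u = C (z_of y') (z_of u)"
      by (simp add: M_def C_def vec_eq_iff matrix_vector_mult_def vc_def sum_distrib_right del: z_of_nth)
    ultimately show ?thesis by simp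
  qed
  have cartan: "cartan V u x y = x_of (C (z_of V) (z_of u))" for V u
    by (rule symmetric_form_cartan[where C = "\<lambda>v w. x_of (C (z_of v) (z_of w))", OF x lin _ hor y])
       (simp add: sym)
  have "C (\<i> *s v) w = \<i> *s C v w" for v w
    by (simp add: C_def vec_eq_iff sum_distrib_left mult_ac)
  then show ?thesis
    by (simp add: cartan z_of_Jop x_of_ii)
qed

text \<open>The spray is holomorphic on the punctured fibre, so that its second fibre derivatives
  are homogeneous of degree \<open>0\<close> and holomorphic, hence constant.\<close>

lemma N_complex_linear_imp_S_quadratic:
  assumes n: "CARD('n) \<ge> 2" and x: "x \<in> U"
    and J: "\<And>y u. y \<noteq> 0 \<Longrightarrow> N (Jop u) x y = Jop (N u x y)"
    and y: "y \<noteq> 0" "y' \<noteq> 0"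
  shows "Dy a (Dy b S) x y = Dy a (Dy b S) x y'"
proof -
  have d: "((\<lambda>v. z_of (g x (x_of v))) has_derivative (\<lambda>w. z_of (Dy (x_of w) g x (x_of v)))) (at v)"
    if "v \<in> - {0}" "sm g" for v and g :: "real^('n + 'n) \<Rightarrow> real^('n + 'n) \<Rightarrow> real^('n + 'n)"
  proof -
    have "((\<lambda>v. (x, x_of v)) has_derivative (\<lambda>w. (0, x_of w))) (at v)"
      by (intro has_derivative_Pair has_derivative_const bounded_linear_imp_has_derivative bounded_linear_x_of)
    from PD_chain[OF PD_has_derivative[OF that(2)] this refl]
    show ?thesis
      using that(1) x by (intro bounded_linear.has_derivative[OF bounded_linear_z_of]) simp
  qed
  have fd: "frechet_derivative (\<lambda>v. z_of (g x (x_of v))) (at v) w = z_of (Dy (x_of w) g x (x_of v))"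
    if "v \<in> - {0}" "sm g" for v w and g :: "real^('n + 'n) \<Rightarrow> real^('n + 'n) \<Rightarrow> real^('n + 'n)"
    using frechet_derivative_at[OF d[OF that]] by metis
  have o: "open (- {0 :: complex^'n})" by (intro open_Compl closed_singleton)
  have cong: "holomorphic_map_on (- {0}) f" if h: "holomorphic_map_on (- {0}) g" and eq: "\<And>v. v \<in> - {0} \<Longrightarrow> g v = f v"
    for f g :: "complex^'n \<Rightarrow> complex^'n"
    unfolding holomorphic_map_on_def
  proof
    fix z :: "complex^'n" assume z: "z \<in> - {0}"
    have "(f has_derivative frechet_derivative g (at z)) (at z)"
      by (rule has_derivative_transform_within_open[OF holomorphic_map_onD(1)[OF h z] o z eq])
    with holomorphic_map_onD(2)[OF h z]
    show "\<exists>D. (f has_derivative D) (at z) \<and> (\<forall>c v. D (c *s v) = c *s D v)" by blast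
  qed
  have h0: "holomorphic_map_on (- {0}) (\<lambda>v. z_of (S x (x_of v)))"
    unfolding holomorphic_map_on_def
  proof
    fix v :: "complex^'n" assume v: "v \<in> - {0}"
    have "z_of (Dy (x_of (c *s w)) S x (x_of v)) = c *s z_of (Dy (x_of w) S x (x_of v))" for c w
    proof (rule complex_linearI)
      show "linear (\<lambda>w. z_of (Dy (x_of w) S x (x_of v)))"
        using has_derivative_linear[OF d[OF v smooth_S]] .
      show "z_of (Dy (x_of (\<i> *s w)) S x (x_of v)) = \<i> *s z_of (Dy (x_of w) S x (x_of v))" for w
        using J[of "x_of v" "x_of w"] v by (simp add: N_def x_of_ii z_of_Jop)
    qed
    then show "\<exists>D. ((\<lambda>v. z_of (S x (x_of v))) has_derivative D) (at v) \<and> (\<forall>c w. D (c *s w) = c *s D w)"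
      using d[OF v smooth_S] by blast
  qed
  have h1: "holomorphic_map_on (- {0}) (\<lambda>v. z_of (Dy b S x (x_of v)))"
    by (rule cong[OF holomorphic_map_on_frechet_derivative[OF h0 o, of "z_of b"]]) (simp add: fd[OF _ smooth_S])
  have h2: "holomorphic_map_on (- {0}) (\<lambda>v. z_of (Dy a (Dy b S) x (x_of v)))"
    by (rule cong[OF holomorphic_map_on_frechet_derivative[OF h1 o, of "z_of a"]])
       (simp add: fd[OF _ sm_PD[OF smooth_S]])
  have "z_of (Dy a (Dy b S) x (x_of (z_of y))) = z_of (Dy a (Dy b S) x (x_of (z_of y')))"
  proof (rule homogeneous_holomorphic_constant[OF n h2])
    fix v :: "complex^'n" and t :: real assume "v \<noteq> 0" "0 < t"
    then show "z_of (Dy a (Dy b S) x (x_of (t *\<^sub>R v))) = z_of (Dy a (Dy b S) x (x_of v))"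
      using S_second_derivative_homogeneous[OF x, of "x_of v" t] by (simp add: linear_scale[OF linear_x_of])
  qed (use y in simp_all)
  then show ?thesis by (metis x_of_z_of)
qed

text \<open>The constant second fibre derivatives of the spray form a symmetric complex bilinear form \<open>B\<close> with
  \<open>N u x y = B y u\<close>; its lift annihilates \<open>L\<close>, so its coefficients are those of the complex connection.\<close>

lemma N_complex_linear_imp_Berwald:
  assumes n: "CARD('n) \<ge> 2" and x: "x \<in> U"
    and J: "\<And>y u. y \<noteq> 0 \<Longrightarrow> N (Jop u) x y = Jop (N u x y)"
  obtains C where "\<And>\<alpha> \<beta> \<mu>. C \<alpha> \<beta> \<mu> = C \<alpha> \<mu> \<beta>" "\<And>y \<alpha> \<beta> \<mu>. y \<noteq> 0 \<Longrightarrow> ccoeff L \<alpha> \<beta> \<mu> x y = C \<alpha> \<beta> \<mu>"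
proof -
  obtain y0 :: "real^('n + 'n)" where y0: "y0 \<noteq> 0"
    by (metis axis_eq_0_iff zero_neq_one)
  define B where "B = (\<lambda>v w. z_of (Dy (x_of v) (Dy (x_of w) S) x y0))"
  have N: "z_of (N u x y) = B (z_of y) (z_of u)" if y: "y \<noteq> 0" for u y
    using N_complex_linear_imp_S_quadratic[OF n x J y0 y, of y u] Euler_S(1)[OF x y, of u]
    by (simp add: N_def B_def)
  have sym: "B v w = B w v" for v w
    unfolding B_def using PD_commute[OF smooth_S, of x y0 "(0, x_of v)"] x y0 by simp
  have lin: "linear (\<lambda>v. B v w)" for w
    unfolding B_def
    by (intro linear_compose[OF _ linear_z_of, unfolded o_def]
        linear_compose[OF linear_x_of, of "\<lambda>v. Dy v (Dy (x_of w) S) x y0", unfolded o_def] linear_Dy sm_PD smooth_S)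
       (use x y0 in simp)
  have ii: "B v (\<i> *s w) = \<i> *s B v w" for v w
  proof (cases "v = 0")
    case True
    then show ?thesis using linear_0[OF lin] by simp
  next
    case False
    then show ?thesis
      using N[of "x_of v" "x_of w"] N[of "x_of v" "Jop (x_of w)"] J[of "x_of v" "x_of w"] by (simp add: z_of_Jop)
  qed
  define C where "C = (\<lambda>\<alpha> \<beta> \<mu>. B (axis \<beta> 1) (axis \<mu> 1) $ \<alpha>)"
  have B: "B v w $ \<alpha> = (\<Sum>\<mu>\<in>UNIV. (\<Sum>\<beta>\<in>UNIV. C \<alpha> \<beta> \<mu> * v $ \<beta>) * w $ \<mu>)" for v w \<alpha>
  proof -
    have 1: "B v w = (\<Sum>\<beta>\<in>UNIV. v $ \<beta> *s B (axis \<beta> 1) w)" for v w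
      by (rule complex_linear_axis_expansion[OF lin]) (metis sym ii)
    have 2: "B v w = (\<Sum>\<mu>\<in>UNIV. w $ \<mu> *s B v (axis \<mu> 1))" for v w
      using 1[of w v] by (simp add: sym)
    have "B v w = (\<Sum>\<mu>\<in>UNIV. w $ \<mu> *s (\<Sum>\<beta>\<in>UNIV. v $ \<beta> *s B (axis \<beta> 1) (axis \<mu> 1)))"
      by (subst 2, subst 1) (rule refl)
    then show ?thesis
      by (simp add: C_def sum_component mult.commute)
  qed
  show ?thesis
  proof (rule that[of C])
    show "C \<alpha> \<beta> \<mu> = C \<alpha> \<mu> \<beta>" for \<alpha> \<beta> \<mu> unfolding C_def by (simp only: sym)
    fix y :: "real^('n + 'n)" and \<alpha> \<beta> \<mu> assume y: "y \<noteq> 0"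
    show "ccoeff L \<alpha> \<beta> \<mu> x y = C \<alpha> \<beta> \<mu>"
    proof (rule ccoeff_determined[OF x _ y])
      fix y :: "real^('n + 'n)" and \<mu> assume y: "y \<noteq> 0"
      define M where "M = (\<chi> \<alpha> \<mu>. \<Sum>\<beta>\<in>UNIV. C \<alpha> \<beta> \<mu> * vc \<beta> x y)"
      have "N u x y = x_of (M *v z_of u)" for u
      proof -
        have "M *v z_of u = B (z_of y) (z_of u)"
          by (simp add: M_def vec_eq_iff B matrix_vector_mult_def vc_def del: z_of_nth)
        then show ?thesis using N[OF y, of u] by (metis x_of_z_of)
      qed
      then have "\<forall>u. Dx u L x y = Dy (x_of (M *v z_of u)) L x y"
        using horizontal_L[OF x y] by simp
      then show "DZ \<mu> (cplx L) x y = (\<Sum>\<alpha>\<in>UNIV. (\<Sum>\<beta>\<in>UNIV. C \<alpha> \<beta> \<mu> * vc \<beta> x y) * DV \<alpha> (cplx L) x y)"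
        unfolding horizontal_real_iff_complex[OF x y] by (simp add: M_def)
    qed
  qed
qed

end

section \<open>Change of coordinates\<close>

text \<open>The map \<open>\<phi>\<close> is an isometry from the part of the source over \<open>V\<close> into the target.\<close>

locale finsler_change = finsler U L + target: finsler U' L'
  for U U' :: "(real^'i::finite) set" and L L' +
  fixes V :: "(real^'i) set" and \<phi> :: "real^'i \<Rightarrow> real^'i"
  assumes open_V: "open V" and V: "V \<subseteq> U" "\<phi> ` V \<subseteq> U'"
    and smooth_\<phi>: "smooth_on V \<phi>"
    and bij_\<phi>: "\<And>x. x \<in> V \<Longrightarrow> bij (frechet_derivative \<phi> (at x))"
    and isometry: "\<And>x y. x \<in> V \<Longrightarrow> y \<noteq> 0 \<Longrightarrow> L x y = L' (\<phi> x) (frechet_derivative \<phi> (at x) y)"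
begin

definition D1 :: "real^'i \<Rightarrow> real^'i \<Rightarrow> real^'i" where
  "D1 x = frechet_derivative \<phi> (at x)"

definition D2 :: "real^'i \<Rightarrow> real^'i \<Rightarrow> real^'i \<Rightarrow> real^'i" where
  "D2 x a b = frechet_derivative (\<lambda>x. D1 x a) (at x) b"

lemma D1_has_derivative: "x \<in> V \<Longrightarrow> (\<phi> has_derivative D1 x) (at x)"
  unfolding D1_def by (rule smooth_on_has_derivative[OF smooth_\<phi> open_V])

lemma linear_D1: "x \<in> V \<Longrightarrow> linear (D1 x)"
  using D1_has_derivative has_derivative_linear by blast

lemma D2_has_derivative: "x \<in> V \<Longrightarrow> ((\<lambda>x. D1 x a) has_derivative D2 x a) (at x)"
  unfolding D2_def[abs_def] D1_def
  by (rule smooth_on_has_derivative[OF smooth_on_frechet_derivative[OF smooth_\<phi> open_V] open_V])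

lemma D2_sym: "x \<in> V \<Longrightarrow> D2 x a b = D2 x b a"
  unfolding D2_def D1_def by (rule second_derivative_symmetric[OF smooth_\<phi> open_V])

lemma D1_nonzero: "x \<in> V \<Longrightarrow> y \<noteq> 0 \<Longrightarrow> D1 x y \<noteq> 0"
  using bij_\<phi>[of x] linear_0[OF linear_D1[of x]] unfolding D1_def bij_def inj_def by metis

lemma in_slits: "x \<in> V \<Longrightarrow> y \<noteq> 0 \<Longrightarrow> (x, y) \<in> slit U \<and> (\<phi> x, D1 x y) \<in> slit U'"
  using V D1_nonzero by auto

lemma bundle_map_has_derivative:
  assumes x: "x \<in> V"
  shows "((\<lambda>q. D1 (fst q) (snd q)) has_derivative (\<lambda>k. D2 x y (fst k) + D1 x (snd k))) (at (x, y))"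
proof -
  have "((\<lambda>q. \<Sum>j\<in>UNIV. (snd q $ j) *\<^sub>R D1 (fst q) (axis j 1)) has_derivative
      (\<lambda>k. \<Sum>j\<in>UNIV. (y $ j) *\<^sub>R D2 x (axis j 1) (fst k) + (snd k $ j) *\<^sub>R D1 x (axis j 1))) (at (x, y))"
  proof (intro has_derivative_sum)
    fix j
    have "((\<lambda>q. D1 (fst q) (axis j 1)) has_derivative (\<lambda>k. D2 x (axis j 1) (fst k))) (at (x, y))"
      by (rule has_derivative_compose[where f = fst, OF _ D2_has_derivative[of "fst (x, y)"], simplified])
         (use x in \<open>auto intro!: derivative_eq_intros\<close>)
    moreover have "((\<lambda>q. snd q $ j) has_derivative (\<lambda>k. snd k $ j)) (at (x, y))"
      by (intro has_derivative_vec_nth has_derivative_snd has_derivative_ident)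
    ultimately show "((\<lambda>q. (snd q $ j) *\<^sub>R D1 (fst q) (axis j 1)) has_derivative
      (\<lambda>k. (y $ j) *\<^sub>R D2 x (axis j 1) (fst k) + (snd k $ j) *\<^sub>R D1 x (axis j 1))) (at (x, y))"
      using has_derivative_scaleR by fastforce
  qed
  moreover have "(\<Sum>j\<in>UNIV. (y $ j) *\<^sub>R D2 x (axis j 1) (fst k) + (snd k $ j) *\<^sub>R D1 x (axis j 1)) = D2 x y (fst k) + D1 x (snd k)" for k
  proof -
    have "(\<lambda>a. D2 x a b) = D2 x b" for b using D2_sym[OF x] by (simp add: fun_eq_iff)
    then have "linear (\<lambda>a. D2 x a b)" for b
      using has_derivative_linear[OF D2_has_derivative[OF x, of b]] by simp
    from linear_axis_expansion[OF this, of y] linear_axis_expansion[OF linear_D1[OF x], of "snd k"]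
    show ?thesis by (simp add: sum.distrib)
  qed
  ultimately have d: "((\<lambda>q. \<Sum>j\<in>UNIV. (snd q $ j) *\<^sub>R D1 (fst q) (axis j 1)) has_derivative
      (\<lambda>k. D2 x y (fst k) + D1 x (snd k))) (at (x, y))" by simp
  show ?thesis
  proof (rule has_derivative_transform_within_open[OF d, of "V \<times> UNIV"])
    fix q assume "q \<in> V \<times> (UNIV :: (real^'i) set)"
    then show "(\<Sum>j\<in>UNIV. (snd q $ j) *\<^sub>R D1 (fst q) (axis j 1)) = D1 (fst q) (snd q)"
      using linear_axis_expansion[OF linear_D1, of "fst q" "snd q"] by auto
  qed (use x open_V in \<open>auto intro: open_Times\<close>)
qed

definition \<Phi> :: "(real^'i) \<times> (real^'i) \<Rightarrow> (real^'i) \<times> (real^'i)" where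
  "\<Phi> q = (\<phi> (fst q), D1 (fst q) (snd q))"

lemma \<Phi>_has_derivative:
  assumes x: "x \<in> V"
  shows "(\<Phi> has_derivative (\<lambda>k. (D1 x (fst k), D2 x y (fst k) + D1 x (snd k)))) (at (x, y))"
proof -
  have "((\<lambda>q. \<phi> (fst q)) has_derivative (\<lambda>k. D1 x (fst k))) (at (x, y))"
    by (rule has_derivative_compose[where f = fst, OF _ D1_has_derivative[of "fst (x, y)"], simplified])
       (use x in \<open>auto intro!: derivative_eq_intros\<close>)
  then show ?thesis
    unfolding \<Phi>_def[abs_def] by (intro has_derivative_Pair bundle_map_has_derivative x)
qed

lemma open_slit_V: "open (slit V :: ((real^'i) \<times> (real^'i)) set)"
  by (rule open_slit[OF open_V])

lemma PD_L:
  assumes "x \<in> V" "y \<noteq> 0"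
  shows "PD k L x y = PD (D1 x (fst k), D2 x y (fst k) + D1 x (snd k)) L' (\<phi> x) (D1 x y)"
proof (rule PD_eqI)
  have "((\<lambda>q. case_prod L' (\<Phi> q)) has_derivative
      (\<lambda>k. PD (D1 x (fst k), D2 x y (fst k) + D1 x (snd k)) L' (\<phi> x) (D1 x y))) (at (x, y))"
    by (rule PD_chain[OF target.PD_has_derivative[OF target.smooth_L] \<Phi>_has_derivative])
       (use assms in_slits in \<open>auto simp: \<Phi>_def\<close>)
  then show "(case_prod L has_derivative
      (\<lambda>k. PD (D1 x (fst k), D2 x y (fst k) + D1 x (snd k)) L' (\<phi> x) (D1 x y))) (at (x, y))"
    by (rule has_derivative_transform_within_open[OF _ open_slit_V])
       (use assms isometry in \<open>auto simp: \<Phi>_def D1_def\<close>)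
qed

lemma Dy_L: "x \<in> V \<Longrightarrow> y \<noteq> 0 \<Longrightarrow> Dy w L x y = Dy (D1 x w) L' (\<phi> x) (D1 x y)"
  using linear_0[OF has_derivative_linear[OF D2_has_derivative[of x y]]] linear_0[OF linear_D1[of x]]
  by (simp add: PD_L)

lemma PD_Dy_L:
  assumes "x \<in> V" "y \<noteq> 0"
  shows "PD k (Dy w L) x y = PD (D1 x (fst k), D2 x y (fst k) + D1 x (snd k)) (Dy (D1 x w) L') (\<phi> x) (D1 x y)
    + Dy (D2 x w (fst k)) L' (\<phi> x) (D1 x y)"
proof (rule PD_eqI)
  have E: "((\<lambda>q. (0::real^'i, D1 (fst q) w)) has_derivative (\<lambda>k. (0, D2 x w (fst k)))) (at (x, y))"
    by (intro has_derivative_Pair has_derivative_const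
        has_derivative_compose[where f = fst, OF _ D2_has_derivative[of "fst (x, y)"], simplified])
       (use assms in \<open>auto intro!: derivative_eq_intros\<close>)
  have "((\<lambda>q. PD (0, D1 (fst q) w) L' (fst (\<Phi> q)) (snd (\<Phi> q))) has_derivative
      (\<lambda>k. PD (D1 x (fst k), D2 x y (fst k) + D1 x (snd k)) (PD (0, D1 (fst (x, y)) w) L') (\<phi> x) (D1 x y)
        + PD (0, D2 x w (fst k)) L' (\<phi> x) (D1 x y))) (at (x, y))"
    by (rule target.PD_composite_has_derivative[OF target.smooth_L _ _ \<Phi>_has_derivative E])
       (use assms in_slits in \<open>auto simp: \<Phi>_def\<close>)
  then show "(case_prod (Dy w L) has_derivative
      (\<lambda>k. PD (D1 x (fst k), D2 x y (fst k) + D1 x (snd k)) (Dy (D1 x w) L') (\<phi> x) (D1 x y)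
        + Dy (D2 x w (fst k)) L' (\<phi> x) (D1 x y))) (at (x, y))"
    unfolding fst_conv
    by (rule has_derivative_transform_within_open[OF _ open_slit_V])
       (use assms Dy_L in \<open>auto simp: \<Phi>_def\<close>)
qed

text \<open>The Euler-Lagrange expression, which is \<open>2 g (x'' + 2 S)\<close>, transforms as a covector, while the acceleration
  picks up the second derivative of \<open>\<phi>\<close>.\<close>

lemma spray_change:
  assumes p: "x \<in> V" "y \<noteq> 0"
  shows "finsler.S L' (\<phi> x) (D1 x y) = D1 x (S x y) - (1 / 2) *\<^sub>R D2 x y y"
proof -
  let ?x' = "\<phi> x" and ?y' = "D1 x y"
  have pU: "x \<in> U" "?x' \<in> U'" "?y' \<noteq> 0" using in_slits[OF p] p by auto
  note lin = linear_0[OF has_derivative_linear[OF D2_has_derivative[OF p(1)]]] linear_0[OF linear_D1[OF p(1)]]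
  have "2 *\<^sub>R D1 x (S x y) = 2 *\<^sub>R target.S ?x' ?y' + D2 x y y"
  proof (rule target.nondegenerate[OF pU(2,3)])
    fix w'
    obtain w where w: "w' = D1 x w" using bij_\<phi>[OF p(1)] unfolding D1_def bij_def surj_def by blast
    have split: "PD (a, b + c) f ?x' ?y' = PD (a, c) f ?x' ?y' + Dy b f ?x' ?y'" if "target.sm f" for a b c and f :: "'i rfun"
      using linear_add[OF target.linear_PD[OF that], of ?x' ?y' "(a, c)" "(0, b)"] pU by (simp add: add.commute)
    have "Dy w' (Dy (2 *\<^sub>R D1 x (S x y)) L') ?x' ?y' = 2 * Dy (D1 x (S x y)) (Dy w' L') ?x' ?y'"
      using target.PD_commute[OF target.smooth_L, of ?x' ?y' "(0, w')"] pU
      by (simp add: linear_scale[OF target.linear_Dy[OF target.sm_PD[OF target.smooth_L]]])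
    also have "\<dots> = 2 * Dy (S x y) (Dy w L) x y"
      using PD_Dy_L[OF p, of "(0, S x y)" w] lin
        linear_0[OF target.linear_Dy[OF target.smooth_L, of ?x' ?y']] pU by (simp add: w)
    also have "\<dots> = Dx y (Dy w L) x y - Dx w L x y"
      using S_characterization[OF pU(1) p(2), of w] PD_commute[OF smooth_L, of x y "(0, w)"] pU p by simp
    also have "\<dots> = Dx ?y' (Dy w' L') ?x' ?y' - Dx w' L' ?x' ?y' + Dy (D2 x y y) (Dy w' L') ?x' ?y'"
      using PD_Dy_L[OF p, of "(y, 0)" w] PD_L[OF p, of "(w, 0)"] D2_sym[OF p(1), of w y] lin
        split[OF target.sm_PD[OF target.smooth_L], of ?y' "D2 x y y" 0 "(0, w')"]
        split[OF target.smooth_L, of w' "D2 x y w" 0]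
      by (simp add: w)
    also have "\<dots> = 2 * Dy w' (Dy (target.S ?x' ?y') L') ?x' ?y' + Dy w' (Dy (D2 x y y) L') ?x' ?y'"
      using target.S_characterization[OF pU(2,3), of w'] target.PD_commute[OF target.smooth_L, of ?x' ?y' "(0, w')"] pU by simp
    also have "\<dots> = Dy w' (Dy (2 *\<^sub>R target.S ?x' ?y' + D2 x y y) L') ?x' ?y'"
      by (simp add: linear_scale[OF target.linear_PD_snd[OF pU(2,3)]] linear_add[OF target.linear_PD_snd[OF pU(2,3)]])
    finally show "Dy w' (Dy (2 *\<^sub>R D1 x (S x y)) L') ?x' ?y' = Dy w' (Dy (2 *\<^sub>R target.S ?x' ?y' + D2 x y y) L') ?x' ?y'" .
  qed
  then have "(1 / 2) *\<^sub>R (2 *\<^sub>R D1 x (S x y)) = (1 / 2) *\<^sub>R (2 *\<^sub>R target.S ?x' ?y' + D2 x y y)" by simp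
  then show ?thesis by (simp add: scaleR_add_right eq_diff_eq)
qed

text \<open>The fibre derivative of the transformation law of the spray.\<close>

lemma nonlinear_connection_change:
  assumes p: "x \<in> V" "y \<noteq> 0"
  shows "finsler.N L' (D1 x u) (\<phi> x) (D1 x y) = D1 x (N u x y) - D2 x y u"
proof -
  have pU: "x \<in> U" "\<phi> x \<in> U'" "D1 x y \<noteq> 0" using in_slits[OF p] p by auto
  have D1: "(D1 x has_derivative D1 x) (at z)" for z
    by (rule bounded_linear_imp_has_derivative) (use linear_D1[OF p(1)] in \<open>simp add: linear_conv_bounded_linear\<close>)
  have linD2: "linear (\<lambda>a. D2 x a b)" "linear (\<lambda>b. D2 x a b)" for a b
  proof -
    have "(\<lambda>a. D2 x a b) = D2 x b" using D2_sym[OF p(1)] by (simp add: fun_eq_iff)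
    then show "linear (\<lambda>a. D2 x a b)" "linear (\<lambda>b. D2 x a b)"
      using has_derivative_linear[OF D2_has_derivative[OF p(1), of b]]
        has_derivative_linear[OF D2_has_derivative[OF p(1), of a]] by simp_all
  qed
  have bil: "bounded_bilinear (D2 x)"
    using linD2 by (simp add: bilinear_conv_bounded_bilinear[symmetric] bilinear_def)
  have "((\<lambda>y. (\<phi> x, D1 x y)) has_derivative (\<lambda>u. (0, D1 x u))) (at y)"
    by (intro has_derivative_Pair has_derivative_const D1)
  from PD_chain[OF target.PD_has_derivative[OF target.smooth_S] this refl] pU
  have 1: "((\<lambda>y. target.S (\<phi> x) (D1 x y)) has_derivative (\<lambda>u. target.N (D1 x u) (\<phi> x) (D1 x y))) (at y)"
    by (simp add: target.N_def)
  have "((\<lambda>y. S x y) has_derivative (\<lambda>u. N u x y)) (at y)"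
    using PD_chain[OF PD_has_derivative[OF smooth_S] Pair_has_derivative refl] pU p by (simp add: N_def)
  from has_derivative_compose[OF this D1]
  have 2: "((\<lambda>y. D1 x (S x y) - (1 / 2) *\<^sub>R D2 x y y) has_derivative
      (\<lambda>u. D1 x (N u x y) - (1 / 2) *\<^sub>R (D2 x y u + D2 x u y))) (at y)"
    by (intro has_derivative_diff has_derivative_scaleR_right bounded_bilinear.FDERIV[OF bil] has_derivative_ident)
  have "((\<lambda>y. target.S (\<phi> x) (D1 x y)) has_derivative
      (\<lambda>u. D1 x (N u x y) - (1 / 2) *\<^sub>R (D2 x y u + D2 x u y))) (at y)"
    by (rule has_derivative_transform_within_open[OF 2, of "- {0}"]) (use p spray_change in auto)
  from fun_cong[OF has_derivative_unique[OF 1 this], of u] D2_sym[OF p(1), of u y]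
  show ?thesis by (simp add: scaleR_2[symmetric])
qed

end

section \<open>Charts and tangent vectors\<close>

locale cmanifold =
  fixes A :: "('m::{t2_space,second_countable_topology}, 'n::finite) cchart set"
  assumes manifold: "complex_manifold A"
begin

abbreviation W :: "('m, 'n) cchart \<Rightarrow> ('m, 'n) cchart \<Rightarrow> (complex^'n) set" where
  "W c d \<equiv> snd c ` (fst c \<inter> fst d)"

abbreviation TD :: "('m, 'n) cchart \<Rightarrow> ('m, 'n) cchart \<Rightarrow> 'm \<Rightarrow> complex^'n \<Rightarrow> complex^'n" where
  "TD c d p \<equiv> frechet_derivative (transition c d) (at (snd c p))"

lemma chart:
  assumes "c \<in> A"
  shows "open (fst c)" "open (snd c ` fst c)" "continuous_on (fst c) (snd c)"
    "continuous_on (snd c ` fst c) (inv_into (fst c) (snd c))"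
    "p \<in> fst c \<Longrightarrow> inv_into (fst c) (snd c) (snd c p) = p"
  using manifold assms by (auto simp: complex_manifold_def is_cchart_def homeomorphism_def)

lemma inv_chart:
  assumes "c \<in> A" "z \<in> snd c ` fst c"
  shows "inv_into (fst c) (snd c) z \<in> fst c" "snd c (inv_into (fst c) (snd c) z) = z"
  using assms by (auto intro: inv_into_into f_inv_into_f)

lemma W_alt: "c \<in> A \<Longrightarrow> W c d = {z \<in> snd c ` fst c. inv_into (fst c) (snd c) z \<in> fst d}"
  by (auto simp: chart(5))

lemma open_W:
  assumes "c \<in> A" "d \<in> A"
  shows "open (W c d)"
proof -
  have "W c d = snd c ` fst c \<inter> inv_into (fst c) (snd c) -` fst d"
    using W_alt[OF assms(1)] by auto
  then show ?thesis
    using continuous_open_preimage[OF chart(4,2)[OF assms(1)] chart(1)[OF assms(2)]] by simp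
qed

lemma transition_chart: "c \<in> A \<Longrightarrow> p \<in> fst c \<Longrightarrow> transition c d (snd c p) = snd d p"
  by (simp add: transition_def chart(5))

lemma transition_holomorphic: "c \<in> A \<Longrightarrow> d \<in> A \<Longrightarrow> holomorphic_map_on (W c d) (transition c d)"
  using manifold by (auto simp: complex_manifold_def)

lemma TD_has_derivative:
  assumes "c \<in> A" "d \<in> A" "p \<in> fst c" "p \<in> fst d"
  shows "(transition c d has_derivative TD c d p) (at (snd c p))" "TD c d p (a *s v) = a *s TD c d p v"
  using holomorphic_map_onD[OF transition_holomorphic[OF assms(1,2)]] assms by auto

lemma TD_cocycle:
  assumes "c \<in> A" "d \<in> A" "e \<in> A" "p \<in> fst c" "p \<in> fst d" "p \<in> fst e"
  shows "TD d e p (TD c d p v) = TD c e p v"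
proof -
  have comp: "((\<lambda>z. transition d e (transition c d z)) has_derivative (\<lambda>v. TD d e p (TD c d p v))) (at (snd c p))"
    by (rule has_derivative_compose[OF TD_has_derivative(1)[OF assms(1,2,4,5)]])
       (use TD_has_derivative(1)[OF assms(2,3,5,6)] transition_chart[OF assms(1,4)] in simp)
  have "(transition c e has_derivative (\<lambda>v. TD d e p (TD c d p v))) (at (snd c p))"
  proof (rule has_derivative_transform_within_open[OF comp, of "W c d"])
    show "open (W c d)" by (rule open_W[OF assms(1,2)])
    fix z assume "z \<in> W c d"
    then obtain q where "z = snd c q" "q \<in> fst c" "q \<in> fst d" by auto
    then show "transition d e (transition c d z) = transition c e z"
      using assms by (simp add: transition_chart)
  qed (use assms in auto)
  from frechet_derivative_at[OF this] show ?thesis by (simp add: fun_eq_iff)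
qed

lemma TD_refl:
  assumes "c \<in> A" "p \<in> fst c"
  shows "TD c c p v = v"
proof -
  have "(transition c c has_derivative (\<lambda>v. v)) (at (snd c p))"
  proof (rule has_derivative_transform_within_open[OF has_derivative_ident, of "W c c"])
    show "z = transition c c z" if "z \<in> W c c" for z
      using that assms(1) by (auto simp: transition_chart[OF assms(1), of _ c])
  qed (use assms open_W[of c c] in auto)
  from frechet_derivative_at[OF this] show ?thesis by (simp add: fun_eq_iff)
qed

definition RD :: "('m, 'n) cchart \<Rightarrow> ('m, 'n) cchart \<Rightarrow> 'm \<Rightarrow> real^('n + 'n) \<Rightarrow> real^('n + 'n)" where
  "RD c d p y = x_of (TD c d p (z_of y))"

lemma real_transition_has_derivative:
  assumes "c \<in> A" "d \<in> A" "p \<in> fst c" "p \<in> fst d"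
  shows "((\<lambda>x. x_of (transition c d (z_of x))) has_derivative RD c d p) (at (x_of (snd c p)))"
proof -
  have "(z_of has_derivative z_of) (at (x_of (snd c p)))" "(x_of has_derivative x_of) (at z)" for z :: "complex^'n"
    by (rule bounded_linear_imp_has_derivative, rule bounded_linear_z_of bounded_linear_x_of)+
  from has_derivative_compose[OF has_derivative_compose[OF this(1), of "transition c d" "TD c d p"] this(2)]
    TD_has_derivative(1)[OF assms]
  show ?thesis by (simp add: RD_def[abs_def])
qed

lemma real_transition_derivative:
  assumes "c \<in> A" "d \<in> A" "p \<in> fst c" "p \<in> fst d"
  shows "frechet_derivative (\<lambda>x. x_of (transition c d (z_of x))) (at (x_of (snd c p))) = RD c d p"
  by (rule frechet_derivative_at[OF real_transition_has_derivative[OF assms], symmetric])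

lemma linear_RD: "c \<in> A \<Longrightarrow> d \<in> A \<Longrightarrow> p \<in> fst c \<Longrightarrow> p \<in> fst d \<Longrightarrow> linear (RD c d p)"
  using real_transition_has_derivative has_derivative_linear by blast

lemma RD_Jop: "c \<in> A \<Longrightarrow> d \<in> A \<Longrightarrow> p \<in> fst c \<Longrightarrow> p \<in> fst d \<Longrightarrow> RD c d p (Jop y) = Jop (RD c d p y)"
  by (simp add: RD_def z_of_Jop TD_has_derivative(2) x_of_ii)

lemma RD_cocycle:
  "c \<in> A \<Longrightarrow> d \<in> A \<Longrightarrow> e \<in> A \<Longrightarrow> p \<in> fst c \<Longrightarrow> p \<in> fst d \<Longrightarrow> p \<in> fst e \<Longrightarrow> RD d e p (RD c d p y) = RD c e p y"
  by (simp add: RD_def TD_cocycle)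

lemma RD_refl: "c \<in> A \<Longrightarrow> p \<in> fst c \<Longrightarrow> RD c c p y = y"
  by (simp add: RD_def TD_refl)

lemma TR_iff: "\<eta> \<in> TR A p \<longleftrightarrow>
    (\<forall>c\<in>A. \<forall>d\<in>A. p \<in> fst c \<inter> fst d \<longrightarrow> \<eta> d = RD c d p (\<eta> c)) \<and> (\<forall>c. \<not> (c \<in> A \<and> p \<in> fst c) \<longrightarrow> \<eta> c = 0)"
  by (simp add: TR_def real_transition_derivative)

lemma TR_D:
  assumes "\<eta> \<in> TR A p"
  shows "c \<in> A \<Longrightarrow> d \<in> A \<Longrightarrow> p \<in> fst c \<Longrightarrow> p \<in> fst d \<Longrightarrow> RD c d p (\<eta> c) = \<eta> d"
    "\<not> (c \<in> A \<and> p \<in> fst c) \<Longrightarrow> \<eta> c = 0"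
proof -
  note * = assms[unfolded TR_iff]
  show "RD c d p (\<eta> c) = \<eta> d" if "c \<in> A" "d \<in> A" "p \<in> fst c" "p \<in> fst d"
    by (rule conjunct1[OF *, rule_format, symmetric]) (use that in auto)
  show "\<eta> c = 0" if "\<not> (c \<in> A \<and> p \<in> fst c)"
    by (rule conjunct2[OF *, rule_format]) (rule that)
qed

lemma TR_I:
  assumes "\<And>c d. c \<in> A \<Longrightarrow> d \<in> A \<Longrightarrow> p \<in> fst c \<Longrightarrow> p \<in> fst d \<Longrightarrow> RD c d p (\<eta> c) = \<eta> d"
    "\<And>c. \<not> (c \<in> A \<and> p \<in> fst c) \<Longrightarrow> \<eta> c = 0"
  shows "\<eta> \<in> TR A p"
  unfolding TR_iff
proof (intro conjI ballI allI impI)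
  fix c d assume "c \<in> A" "d \<in> A" "p \<in> fst c \<inter> fst d"
  then show "\<eta> d = RD c d p (\<eta> c)" by (intro assms(1)[symmetric]) auto
qed (rule assms(2))

lemma TR_add: "\<eta> \<in> TR A p \<Longrightarrow> \<eta>' \<in> TR A p \<Longrightarrow> (\<lambda>c. \<eta> c + \<eta>' c) \<in> TR A p"
  by (rule TR_I) (simp_all add: linear_add[OF linear_RD] TR_D)

lemma TR_Jop: "\<eta> \<in> TR A p \<Longrightarrow> (\<lambda>c. Jop (\<eta> c)) \<in> TR A p"
  by (rule TR_I) (simp_all add: RD_Jop TR_D linear_0[OF linear_Jop])

text \<open>A tangent vector is determined by its components in a single chart.\<close>

lemma TR_zero:
  assumes "\<eta> \<in> TR A p" "c \<in> A" "p \<in> fst c" "\<eta> c = 0"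
  shows "\<eta> = (\<lambda>_. 0)"
proof
  fix d
  show "\<eta> d = 0"
  proof (cases "d \<in> A \<and> p \<in> fst d")
    case True
    then have "\<eta> d = RD c d p 0" using TR_D(1)[OF assms(1), of c d] assms by simp
    with True show ?thesis using assms linear_0[OF linear_RD] by simp
  next
    case False
    with TR_D(2)[OF assms(1)] show ?thesis by blast
  qed
qed

lemma RD_family_in_TR:
  assumes "c \<in> A" "p \<in> fst c"
  shows "(\<lambda>d. if d \<in> A \<and> p \<in> fst d then RD c d p v else 0) \<in> TR A p"
  by (rule TR_I) (use assms in \<open>auto simp: RD_cocycle\<close>)

lemma vec10_in_T10:
  assumes "c \<in> A" "p \<in> fst c"
  shows "vec10 A p c v \<in> T10 A p"
  using assms by (auto simp: T10_def vec10_def TD_cocycle)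

lemma vec10_change:
  assumes "c \<in> A" "d \<in> A" "p \<in> fst c" "p \<in> fst d"
  shows "vec10 A p d (TD c d p v) = vec10 A p c v"
  using assms by (auto simp: vec10_def TD_cocycle fun_eq_iff)

lemma vec10_scale:
  assumes "c \<in> A" "p \<in> fst c"
  shows "vec10 A p c (a *s v) = (\<lambda>d. a *s vec10 A p c v d)"
  using assms by (auto simp: vec10_def TD_has_derivative(2) fun_eq_iff)

definition U :: "('m, 'n) cchart \<Rightarrow> (real^('n + 'n)) set" where
  "U c = {x. z_of x \<in> snd c ` fst c}"

lemma slit_dom_eq: "slit_dom c = slit (U c)"
  by (auto simp: slit_dom_def U_def slit_def)

lemma open_preimage_z_of: "open S \<Longrightarrow> open {x. z_of x \<in> S}"
  using open_vimage[of S z_of] linear_continuous_on[OF bounded_linear_z_of, of UNIV]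
  by (simp add: vimage_def)

lemma open_U: "c \<in> A \<Longrightarrow> open (U c)"
  unfolding U_def by (rule open_preimage_z_of[OF chart(2)])

lemma in_U: "p \<in> fst c \<Longrightarrow> x_of (snd c p) \<in> U c"
  by (simp add: U_def)

lemma U_point:
  assumes "c \<in> A" "x \<in> U c"
  obtains p where "p \<in> fst c" "x = x_of (snd c p)" "inv_into (fst c) (snd c) (z_of x) = p"
  using assms that[of "inv_into (fst c) (snd c) (z_of x)"] inv_chart[OF assms(1), of "z_of x"]
  by (metis U_def mem_Collect_eq x_of_z_of)

lemma local_F_point:
  assumes "c \<in> A" "p \<in> fst c"
  shows "local_F A F c (x_of (snd c p)) y = F p (vec10 A p c (z_of y))"
  using assms by (simp add: local_F_def Let_def chart(5))

lemma local_F_change: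
  assumes "c \<in> A" "d \<in> A" "p \<in> fst c" "p \<in> fst d"
  shows "local_F A F d (x_of (snd d p)) (RD c d p y) = local_F A F c (x_of (snd c p)) y"
  using assms by (simp add: local_F_point RD_def vec10_change)

lemma local_F_scale:
  assumes F: "strongly_convex_finsler A F" and c: "c \<in> A" and x: "x \<in> U c"
  shows "local_F A F c x (x_of (a *s z_of y)) = cmod a * local_F A F c x y"
proof -
  obtain p where p: "p \<in> fst c" "x = x_of (snd c p)" using U_point[OF c x] by blast
  show ?thesis
    using F vec10_in_T10[OF c p(1), of "z_of y"] unfolding strongly_convex_finsler_def
    by (simp add: p local_F_point[OF c p(1)] vec10_scale[OF c p(1)])
qed

lemma complex_finsler_local_L:
  assumes F: "strongly_convex_finsler A F" and c: "c \<in> A"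
  shows "complex_finsler (U c) (local_L A F c)"
proof
  show "open (U c)" by (rule open_U[OF c])
  have o: "open (slit (U c) :: ((real^('n + 'n)) \<times> (real^('n + 'n))) set)" by (rule open_slit[OF open_U[OF c]])
  have "smooth_on (slit (U c)) (case_prod (local_F A F c))"
    using F c unfolding strongly_convex_finsler_def slit_dom_eq by auto
  from smooth_on_mult[OF this this o]
  show "smooth_on (slit (U c)) (case_prod (local_L A F c))"
    by (simp add: case_prod_unfold local_L_def power2_eq_square)
  fix x y :: "real^('n + 'n)" assume x: "x \<in> U c" and y: "y \<noteq> 0"
  show "local_L A F c x (t *\<^sub>R y) = t\<^sup>2 * local_L A F c x y" if "0 < t" for t
  proof -
    have "x_of (of_real t *s z_of y) = t *\<^sub>R y" by (simp add: vec_eq_Plus_iff)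
    with local_F_scale[OF F c x, of "of_real t" y] that show ?thesis
      by (simp add: local_L_def power_mult_distrib)
  qed
  show "local_L A F c x (cos \<theta> *\<^sub>R y + sin \<theta> *\<^sub>R Jop y) = local_L A F c x y" for \<theta>
  proof -
    have "x_of (cis \<theta> *s z_of y) = cos \<theta> *\<^sub>R y + sin \<theta> *\<^sub>R Jop y"
      by (simp add: vec_eq_Plus_iff)
    with local_F_scale[OF F c x, of "cis \<theta>" y] show ?thesis
      by (simp add: local_L_def)
  qed
  show "0 < u \<bullet> (gmat (local_L A F c) x y *v u)" if "u \<noteq> 0" for u
  proof -
    have "\<forall>(x, y)\<in>slit (U c). \<forall>u. u \<noteq> 0 \<longrightarrow> 0 < u \<bullet> (gmat (local_L A F c) x y *v u)"
      using F c unfolding strongly_convex_finsler_def slit_dom_eq by blast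
    from bspec[OF this, of "(x, y)"] x y that show ?thesis by simp
  qed
qed

definition \<phi> :: "('m, 'n) cchart \<Rightarrow> ('m, 'n) cchart \<Rightarrow> real^('n + 'n) \<Rightarrow> real^('n + 'n)" where
  "\<phi> c d x = x_of (transition c d (z_of x))"

lemma smooth_real_transition:
  assumes "c \<in> A" "d \<in> A"
  shows "smooth_on {x. z_of x \<in> W c d} (\<phi> c d)"
proof -
  note o = open_W[OF assms]
  have "smooth_on {x. z_of x \<in> W c d} (\<lambda>x. transition c d (z_of x))"
    by (rule smooth_on_compose_linear[OF linear_z_of holomorphic_map_on_imp_smooth_on[OF transition_holomorphic[OF assms] o] o])
  then show ?thesis
    unfolding \<phi>_def[abs_def]
    by (rule smooth_on_bounded_linear[OF bounded_linear_x_of]) (rule open_preimage_z_of[OF o])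
qed

lemma \<phi>_chart: "c \<in> A \<Longrightarrow> p \<in> fst c \<Longrightarrow> \<phi> c d (x_of (snd c p)) = x_of (snd d p)"
  by (simp add: \<phi>_def transition_chart)

lemma finsler_change_local_L:
  assumes F: "strongly_convex_finsler A F" and c: "c \<in> A" "d \<in> A"
  shows "finsler_change (U c) (U d) (local_L A F c) (local_L A F d) {x. z_of x \<in> W c d} (\<phi> c d)"
proof -
  interpret c: complex_finsler "U c" "local_L A F c" by (rule complex_finsler_local_L[OF F c(1)])
  interpret d: complex_finsler "U d" "local_L A F d" by (rule complex_finsler_local_L[OF F c(2)])
  have pt: "\<exists>p. p \<in> fst c \<and> p \<in> fst d \<and> x = x_of (snd c p)" if "z_of x \<in> W c d" for x
  proof -
    from that obtain p where p: "z_of x = snd c p" "p \<in> fst c" "p \<in> fst d" by auto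
    then have "x = x_of (snd c p)" using x_of_z_of[of x] by (simp only:)
    with p show ?thesis by blast
  qed
  show ?thesis
  proof
    show "open {x. z_of x \<in> W c d}" by (rule open_preimage_z_of[OF open_W[OF c]])
    show "{x. z_of x \<in> W c d} \<subseteq> U c" by (auto simp: U_def)
    show "\<phi> c d ` {x. z_of x \<in> W c d} \<subseteq> U d"
    proof (rule image_subsetI)
      fix x :: "real^('n + 'n)" assume "x \<in> {x. z_of x \<in> W c d}"
      then obtain p where "p \<in> fst c" "p \<in> fst d" "x = x_of (snd c p)" using pt by blast
      then show "\<phi> c d x \<in> U d" using \<phi>_chart[OF c(1)] in_U by simp
    qed
    show "smooth_on {x. z_of x \<in> W c d} (\<phi> c d)" by (rule smooth_real_transition[OF c])
    fix x assume "x \<in> {x. z_of x \<in> W c d}"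
    then obtain p where p: "p \<in> fst c" "p \<in> fst d" "x = x_of (snd c p)" using pt by blast
    have D: "frechet_derivative (\<phi> c d) (at x) = RD c d p"
      using real_transition_derivative[OF c p(1,2)] by (simp add: \<phi>_def[abs_def] p)
    show "bij (frechet_derivative (\<phi> c d) (at x))"
      unfolding D
      by (rule bij_betw_byWitness[where f' = "RD d c p"])
         (use c p in \<open>auto simp: RD_cocycle RD_refl\<close>)
    show "local_L A F c x y = local_L A F d (\<phi> c d x) (frechet_derivative (\<phi> c d) (at x) y)" if "y \<noteq> 0" for y
      unfolding D unfolding p(3) \<phi>_chart[OF c(1) p(1)] local_L_def local_F_change[OF c p(1,2)] ..
  qed
qed

end

section \<open>Linear differential equations on the unit interval\<close>

text \<open>Existence for coefficients of norm at most \<open>1/2\<close>: the Picard operator is then a contraction on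
  the whole interval.\<close>

lemma linear_ode_exists:
  fixes M :: "real \<Rightarrow> 'a::euclidean_space \<Rightarrow> 'a" and v0 :: 'a
  assumes cont: "\<And>v. continuous_on {0..1} (\<lambda>t. M t v)"
    and lin: "\<And>t. t \<in> {0..1} \<Longrightarrow> linear (M t)"
    and bound: "\<And>t v. t \<in> {0..1} \<Longrightarrow> norm (M t v) \<le> norm v / 2"
  obtains V where "V 0 = v0" "\<And>t. t \<in> {0..1} \<Longrightarrow> (V has_vector_derivative M t (V t)) (at t within {0..1})"
proof -
  have cM: "continuous_on {0..1} (\<lambda>s. M s (f s))" if "continuous_on {0..1} f" for f :: "real \<Rightarrow> 'a"
  proof -
    have "continuous_on {0..1} (\<lambda>s. \<Sum>b\<in>Basis. (f s \<bullet> b) *\<^sub>R M s b)"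
      by (intro continuous_intros that cont)
    moreover have "(\<Sum>b\<in>Basis. (f s \<bullet> b) *\<^sub>R M s b) = M s (f s)" if "s \<in> {0..1}" for s
    proof -
      have "M s (f s) = M s (\<Sum>b\<in>Basis. (f s \<bullet> b) *\<^sub>R b)" by (simp only: euclidean_representation)
      then show ?thesis by (simp add: linear_sum[OF lin[OF that]] linear_scale[OF lin[OF that]])
    qed
    ultimately show ?thesis by (rule continuous_on_eq)
  qed
  \<comment> \<open>The Banach space consists of bounded functions on the whole line, so arguments are clamped to the interval.\<close>
  define cl :: "real \<Rightarrow> real" where "cl = (\<lambda>t. max 0 (min 1 t))"
  have cl: "cl t \<in> {0..1}" "continuous_on UNIV cl" "s \<in> {0..1} \<Longrightarrow> cl s = s" for t s
    by (auto simp: cl_def intro!: continuous_intros)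
  have cf: "continuous_on X (apply_bcontfun f)" for X and f :: "real \<Rightarrow>\<^sub>C 'a"
    by simp
  define P where "P = (\<lambda>(f :: real \<Rightarrow>\<^sub>C 'a) t. v0 + integral {0..cl t} (\<lambda>s. M s (apply_bcontfun f s)))"
  have int: "(\<lambda>s. M s (apply_bcontfun f s)) integrable_on {0..t}" if "t \<in> {0..1}" for f t
    by (rule integrable_continuous_real, rule continuous_on_subset[OF cM[OF cf]]) (use that in auto)
  have P: "P f \<in> bcontfun" for f
  proof -
    have c: "continuous_on {0..1} (\<lambda>u. v0 + integral {0..u} (\<lambda>s. M s (apply_bcontfun f s)))"
      by (intro continuous_intros indefinite_integral_continuous_1 int) simp
    have "continuous_on UNIV (P f)"
      unfolding P_def by (rule continuous_on_compose2[OF c cl(2)]) (use cl(1) in auto)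
    moreover have "bounded (range (P f))"
    proof (rule bounded_subset)
      show "bounded ((\<lambda>u. v0 + integral {0..u} (\<lambda>s. M s (apply_bcontfun f s))) ` {0..1})"
        by (rule compact_imp_bounded[OF compact_continuous_image[OF c]]) simp
      show "range (P f) \<subseteq> (\<lambda>u. v0 + integral {0..u} (\<lambda>s. M s (apply_bcontfun f s))) ` {0..1}"
        unfolding P_def using cl(1) by blast
    qed
    ultimately show ?thesis by (simp add: bcontfun_def)
  qed
  define Q where "Q = (\<lambda>f. Bcontfun (P f))"
  have Q: "apply_bcontfun (Q f) = P f" for f
    unfolding Q_def by (rule Bcontfun_inverse[OF P])
  have "dist (Q f) (Q g) \<le> 1 / 2 * dist f g" for f g
  proof (rule dist_bound)
    fix t
    have "dist (Q f t) (Q g t) = norm (integral {0..cl t} (\<lambda>s. M s (apply_bcontfun f s - apply_bcontfun g s)))"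
    proof -
      have "integral {0..cl t} (\<lambda>s. M s (apply_bcontfun f s)) - integral {0..cl t} (\<lambda>s. M s (apply_bcontfun g s)) =
          integral {0..cl t} (\<lambda>s. M s (apply_bcontfun f s) - M s (apply_bcontfun g s))"
        by (rule integral_diff[OF int[OF cl(1)] int[OF cl(1)], symmetric])
      also have "\<dots> = integral {0..cl t} (\<lambda>s. M s (apply_bcontfun f s - apply_bcontfun g s))"
        by (rule integral_cong) (use cl(1)[of t] linear_diff[OF lin] in auto)
      finally show ?thesis by (simp add: Q P_def dist_norm)
    qed
    also have "\<dots> \<le> (dist f g / 2) * (cl t - 0)"
    proof (rule integral_bound)
      show "continuous_on {0..cl t} (\<lambda>s. M s (apply_bcontfun f s - apply_bcontfun g s))"
        by (rule continuous_on_subset[OF cM]) (use cl(1)[of t] in \<open>auto intro!: continuous_intros cf\<close>)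
      fix s assume "s \<in> {0..cl t}"
      then have s: "s \<in> {0..1}" using cl(1)[of t] by auto
      show "norm (M s (apply_bcontfun f s - apply_bcontfun g s)) \<le> dist f g / 2"
        using bound[OF s, of "apply_bcontfun f s - apply_bcontfun g s"] dist_bounded[of f s g]
        by (simp add: dist_norm)
    qed (use cl(1)[of t] in auto)
    also have "\<dots> \<le> dist f g / 2 * 1"
      by (rule mult_left_mono) (use cl(1)[of t] in auto)
    finally show "dist (Q f t) (Q g t) \<le> 1 / 2 * dist f g" by simp
  qed
  then obtain f where f: "Q f = f"
    using banach_fix_type[of "1/2" Q] by auto
  have V: "apply_bcontfun f t = v0 + integral {0..t} (\<lambda>s. M s (apply_bcontfun f s))" if "t \<in> {0..1}" for t
    using fun_cong[OF Q[of f], of t] cl(3)[OF that] unfolding f by (simp add: P_def)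
  show ?thesis
  proof (rule that[of "apply_bcontfun f"])
    show "apply_bcontfun f 0 = v0" using V[of 0] by simp
    fix t :: real assume t: "t \<in> {0..1}"
    have "((\<lambda>t. v0 + integral {0..t} (\<lambda>s. M s (apply_bcontfun f s))) has_vector_derivative
        M t (apply_bcontfun f t)) (at t within {0..1})"
      using has_vector_derivative_add[OF has_vector_derivative_const
          integral_has_vector_derivative[OF cM[OF cf] t], of v0] by simp
    then show "(apply_bcontfun f has_vector_derivative M t (apply_bcontfun f t)) (at t within {0..1})"
      by (rule has_vector_derivative_transform[OF t, rotated]) (rule V)
  qed
qed

text \<open>Uniqueness, by Gronwall's argument applied to the squared norm.\<close>

lemma linear_ode_unique:
  fixes f :: "real \<Rightarrow> 'a::real_inner"
  assumes ab: "0 \<le> a" "a \<le> b" "b \<le> 1"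
    and f: "\<And>t. t \<in> {a..b} \<Longrightarrow> \<exists>D. (f has_vector_derivative D) (at t within {0..1}) \<and> norm D \<le> K * norm (f t)"
  shows "f a = 0 \<longleftrightarrow> f b = 0"
proof -
  \<comment> \<open>For \<open>s = 1\<close> the squared norm times \<open>exp (2 K t)\<close> increases, for \<open>s = -1\<close> its product with
    \<open>exp (- 2 K t)\<close> decreases.\<close>
  have mono: "exp (2 * s * K * a) * (s * (f a \<bullet> f a)) \<le> exp (2 * s * K * b) * (s * (f b \<bullet> f b))" if s: "s = 1 \<or> s = -1" for s
  proof (rule DERIV_nonneg_imp_increasing_open[OF ab(2)])
    have "continuous_on {a..b} f"
      unfolding continuous_on_eq_continuous_within
    proof
      fix t assume t: "t \<in> {a..b}"
      then obtain D where "(f has_vector_derivative D) (at t within {0..1})" using f by blast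
      then show "continuous (at t within {a..b}) f"
        using ab by (intro has_vector_derivative_continuous[OF has_vector_derivative_within_subset]) auto
    qed
    then show "continuous_on {a..b} (\<lambda>t. exp (2 * s * K * t) * (s * (f t \<bullet> f t)))"
      by (intro continuous_intros)
    fix t assume t: "a < t" "t < b"
    then obtain D where D: "(f has_vector_derivative D) (at t within {0..1})" "norm D \<le> K * norm (f t)"
      using f[of t] by auto
    have "at t within {0..1} = at t" using t ab by (intro at_within_interior) auto
    then have "(f has_derivative (\<lambda>h. h *\<^sub>R D)) (at t)" using D(1) by (simp add: has_vector_derivative_def)
    then have "((\<lambda>t. f t \<bullet> f t) has_derivative (\<lambda>h. f t \<bullet> (h *\<^sub>R D) + (h *\<^sub>R D) \<bullet> f t)) (at t)"
      by (intro has_derivative_inner)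
    then have g: "((\<lambda>t. f t \<bullet> f t) has_real_derivative 2 * (f t \<bullet> D)) (at t)"
      by (simp add: has_field_derivative_def inner_commute[of D] algebra_simps)
        (simp add: fun_eq_iff has_derivative_eq_rhs mult.commute mult.left_commute)
    have "((\<lambda>t. exp (2 * s * K * t) * (s * (f t \<bullet> f t))) has_real_derivative
        exp (2 * s * K * t) * (2 * (s * s) * K * (f t \<bullet> f t) + s * (2 * (f t \<bullet> D)))) (at t)"
      by (auto intro!: derivative_eq_intros g simp: algebra_simps)
    moreover have "0 \<le> exp (2 * s * K * t) * (2 * (s * s) * K * (f t \<bullet> f t) + s * (2 * (f t \<bullet> D)))"
    proof (rule mult_nonneg_nonneg)
      have "\<bar>f t \<bullet> D\<bar> \<le> norm (f t) * norm D" by (rule Cauchy_Schwarz_ineq2)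
      also have "\<dots> \<le> norm (f t) * (K * norm (f t))" by (rule mult_left_mono[OF D(2)]) simp
      also have "\<dots> = K * (f t \<bullet> f t)" by (simp add: dot_square_norm power2_eq_square)
      finally have "\<bar>f t \<bullet> D\<bar> \<le> K * (f t \<bullet> f t)" .
      then show "0 \<le> 2 * (s * s) * K * (f t \<bullet> f t) + s * (2 * (f t \<bullet> D))" using s by auto
    qed simp
    ultimately show "\<exists>y. ((\<lambda>t. exp (2 * s * K * t) * (s * (f t \<bullet> f t))) has_real_derivative y) (at t) \<and> 0 \<le> y"
      by blast
  qed
  show ?thesis
  proof
    assume "f a = 0"
    with mono[of "-1"] have "exp (- (2 * K * b)) * (f b \<bullet> f b) \<le> 0" by simp
    then have "f b \<bullet> f b \<le> 0" by (simp add: mult_le_0_iff)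
    then show "f b = 0" by (metis inner_eq_zero_iff inner_ge_zero order_antisym)
  next
    assume "f b = 0"
    with mono[of 1] have "exp (2 * K * a) * (f a \<bullet> f a) \<le> 0" by simp
    then have "f a \<bullet> f a \<le> 0" by (simp add: mult_le_0_iff)
    then show "f a = 0" by (metis inner_eq_zero_iff inner_ge_zero order_antisym)
  qed
qed

section \<open>Smooth curves on the unit interval\<close>

lemma at_within_unit_interval: "t \<in> {0..1::real} \<Longrightarrow> at t within {0..1} \<noteq> bot"
  by (simp add: trivial_limit_within islimpt_Icc)

text \<open>A relatively open subset of the unit interval is locally the unit interval.\<close>

lemma at_within_relatively_open:
  assumes T: "T = {0..1} \<inter> Op" "open Op" and t: "t \<in> T"
  shows "at t within T = at t within {0..1::real}"
  by (rule at_within_nhd[of t Op]) (use T t in auto)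

lemma frechet_derivative_relatively_open:
  fixes f :: "real \<Rightarrow> 'b::real_normed_vector"
  assumes T: "T = {0..1} \<inter> Op" "open Op" and t: "t \<in> T"
    and f: "(f has_vector_derivative D) (at t within T)"
  shows "frechet_derivative f (at t within T) h = h *\<^sub>R D"
proof -
  have "(f has_derivative frechet_derivative f (at t within T)) (at t within T)"
    using f unfolding frechet_derivative_works[symmetric] by (rule differentiableI_vector)
  moreover from has_derivative_linear[OF this]
  have lin: "frechet_derivative f (at t within T) = (\<lambda>h. h *\<^sub>R frechet_derivative f (at t within T) 1)"
  proof (intro ext)
    fix h :: real
    show "frechet_derivative f (at t within T) h = h *\<^sub>R frechet_derivative f (at t within T) 1"
      using linear_scale[OF \<open>linear _\<close>, of h 1] by (simp only: real_scaleR_def mult_1_right)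
  qed
  ultimately have "(f has_vector_derivative frechet_derivative f (at t within T) 1) (at t within T)"
    unfolding has_vector_derivative_def by metis
  then have "frechet_derivative f (at t within T) 1 = D"
    using f at_within_unit_interval[of t] T t
    unfolding at_within_relatively_open[OF T t] by (intro vector_derivative_unique_within) auto
  with lin show ?thesis by metis
qed

lemma smooth_on_affine_curve:
  fixes f :: "'a::euclidean_space \<Rightarrow> 'b::real_normed_vector"
  assumes f: "smooth_on S f" and S: "open S"
  shows "smooth_on {t \<in> {0..1}. x + t *\<^sub>R w \<in> S} (\<lambda>t. f (x + t *\<^sub>R w))"
proof -
  define Op where "Op = (\<lambda>t::real. x + t *\<^sub>R w) -` S"
  have Op: "open Op" unfolding Op_def by (intro open_vimage S continuous_intros)
  define T where "T = {t \<in> {0..1}. x + t *\<^sub>R w \<in> S}"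
  have T: "T = {0..1} \<inter> Op" by (auto simp: T_def Op_def)
  have d: "((\<lambda>t. f (x + t *\<^sub>R w)) has_vector_derivative frechet_derivative f (at (x + t *\<^sub>R w)) w) (at t within T)"
    if "smooth_on S f" "t \<in> T" for f :: "'a \<Rightarrow> 'b" and t
  proof -
    have D: "(f has_derivative frechet_derivative f (at (x + t *\<^sub>R w))) (at (x + t *\<^sub>R w))"
      by (rule smooth_on_has_derivative[OF that(1) S]) (use that(2) in \<open>simp add: T_def\<close>)
    have "((\<lambda>t::real. x + t *\<^sub>R w) has_derivative (\<lambda>h. h *\<^sub>R w)) (at t within T)"
      by (auto intro!: derivative_eq_intros)
    from has_derivative_compose[OF this D] show ?thesis
      by (simp add: has_vector_derivative_def linear_scale[OF has_derivative_linear[OF D]])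
  qed
  have "Ck_on k T (\<lambda>t. f (x + t *\<^sub>R w))" for k
    using f
  proof (induction k arbitrary: f)
    case 0
    then show ?case
      using d[OF 0] by (auto simp: continuous_on_eq_continuous_within intro: has_vector_derivative_continuous)
  next
    case (Suc k)
    have "(\<lambda>t. f (x + t *\<^sub>R w)) differentiable_on T"
      using d[OF Suc.prems] by (auto simp: differentiable_on_def intro: differentiableI_vector)
    moreover have "Ck_on k T (\<lambda>t. frechet_derivative (\<lambda>t. f (x + t *\<^sub>R w)) (at t within T) h)" for h
    proof -
      have "smooth_on S (\<lambda>z. h *\<^sub>R frechet_derivative f (at z) w)"
        by (intro smooth_on_scaleR smooth_on_const smooth_on_frechet_derivative Suc.prems S)
      from Suc.IH[OF this] show ?thesis
        by (rule Ck_on_cong) (simp add: frechet_derivative_relatively_open[OF T Op _ d[OF Suc.prems]])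
    qed
    ultimately show ?case by simp
  qed
  then show ?thesis by (simp add: smooth_on_def T_def)
qed

section \<open>Parallel vector fields\<close>

locale finsler_manifold = cmanifold A for A :: "('m::{t2_space,second_countable_topology}, 'n::finite) cchart set" +
  fixes F :: "('m, 'n) finsler_fun"
  assumes F: "strongly_convex_finsler A F"
begin

abbreviation Lc :: "('m, 'n) cchart \<Rightarrow> ('n + 'n) rfun" where
  "Lc \<equiv> local_L A F"

lemma complex_finsler_chart: "c \<in> A \<Longrightarrow> complex_finsler (U c) (Lc c)"
  by (rule complex_finsler_local_L[OF F])

lemma finsler_chart: "c \<in> A \<Longrightarrow> finsler (U c) (Lc c)"
  using complex_finsler_chart by (simp add: complex_finsler_def)

abbreviation Nc :: "('m, 'n) cchart \<Rightarrow> real^('n + 'n) \<Rightarrow> real^('n + 'n) \<Rightarrow> real^('n + 'n) \<Rightarrow> real^('n + 'n)" where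
  "Nc c \<equiv> finsler.N (Lc c)"

context
  fixes \<sigma> :: "real \<Rightarrow> 'm"
  assumes \<sigma>: "smooth_regular_curve A \<sigma>"
begin

lemma velocity_nonzero: "c \<in> A \<Longrightarrow> t \<in> {0..1} \<Longrightarrow> \<sigma> t \<in> fst c \<Longrightarrow> velocity c \<sigma> t \<noteq> 0"
  using \<sigma> unfolding smooth_regular_curve_def by blast

lemma curve_in_U: "\<sigma> t \<in> fst c \<Longrightarrow> curve_coord c \<sigma> t \<in> U c"
  unfolding curve_coord_def by (rule in_U)

text \<open>The Cartan coefficients are evaluated at the velocity and contracted with it, so they enter only through \<open>N\<close>.\<close>

lemma parallel_along_iff: "parallel_along A F \<sigma> V \<longleftrightarrow>
    (\<forall>t\<in>{0..1}. V t \<in> TR A (\<sigma> t)) \<and>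
    (\<forall>c\<in>A. \<forall>t\<in>{0..1}. \<sigma> t \<in> fst c \<longrightarrow> ((\<lambda>s. V s c) has_vector_derivative
       - Nc c (V t c) (curve_coord c \<sigma> t) (velocity c \<sigma> t)) (at t within {0..1}))"
proof -
  have *: "(\<forall>k. D $ k + (\<Sum>l\<in>UNIV. \<Sum>j\<in>UNIV. v $ l *
        cartan_h (Lc c) k l j (curve_coord c \<sigma> t) (velocity c \<sigma> t) * velocity c \<sigma> t $ j) = 0) \<longleftrightarrow>
      D = - Nc c v (curve_coord c \<sigma> t) (velocity c \<sigma> t)"
    if c: "c \<in> A" and t: "t \<in> {0..1}" "\<sigma> t \<in> fst c" for D v c t
  proof -
    interpret finsler "U c" "Lc c" by (rule finsler_chart[OF c])
    have "Nc c v (curve_coord c \<sigma> t) (velocity c \<sigma> t) =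
        cartan v (velocity c \<sigma> t) (curve_coord c \<sigma> t) (velocity c \<sigma> t)"
      by (rule cartan_contraction[OF curve_in_U[OF t(2)] velocity_nonzero[OF c t], symmetric])
    then show ?thesis
      by (simp add: vec_eq_iff cartan_def eq_neg_iff_add_eq_0)
  qed
  show ?thesis
    unfolding parallel_along_def
    by (intro arg_cong2[where f = conj] refl ball_cong imp_cong) (simp only: *, blast)
qed

lemma parallel_add:
  assumes "parallel_along A F \<sigma> V" "parallel_along A F \<sigma> V'"
  shows "parallel_along A F \<sigma> (\<lambda>t c. V t c + V' t c)"
  unfolding parallel_along_iff
proof (intro conjI ballI impI)
  fix t :: real assume t: "t \<in> {0..1}"
  show "(\<lambda>c. V t c + V' t c) \<in> TR A (\<sigma> t)"
    using assms t unfolding parallel_along_iff by (intro TR_add) auto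
  fix c assume c: "c \<in> A" "\<sigma> t \<in> fst c"
  interpret finsler "U c" "Lc c" by (rule finsler_chart[OF c(1)])
  have "((\<lambda>s. V s c + V' s c) has_vector_derivative
      - N (V t c) (curve_coord c \<sigma> t) (velocity c \<sigma> t) + - N (V' t c) (curve_coord c \<sigma> t) (velocity c \<sigma> t)) (at t within {0..1})"
    using assms t c unfolding parallel_along_iff by (intro has_vector_derivative_add) auto
  then show "((\<lambda>s. V s c + V' s c) has_vector_derivative
      - N (V t c + V' t c) (curve_coord c \<sigma> t) (velocity c \<sigma> t)) (at t within {0..1})"
    by (simp add: linear_add[OF linear_N[OF curve_in_U[OF c(2)] velocity_nonzero[OF c(1) t c(2)]]])
qed

lemma parallel_Jop:
  assumes V: "parallel_along A F \<sigma> V"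
    and J: "\<And>c t u. c \<in> A \<Longrightarrow> t \<in> {0..1} \<Longrightarrow> \<sigma> t \<in> fst c \<Longrightarrow>
      Nc c (Jop u) (curve_coord c \<sigma> t) (velocity c \<sigma> t) = Jop (Nc c u (curve_coord c \<sigma> t) (velocity c \<sigma> t))"
  shows "parallel_along A F \<sigma> (\<lambda>t c. Jop (V t c))"
  unfolding parallel_along_iff
proof (intro conjI ballI impI)
  fix t :: real assume t: "t \<in> {0..1}"
  show "(\<lambda>c. Jop (V t c)) \<in> TR A (\<sigma> t)"
    using V t unfolding parallel_along_iff by (intro TR_Jop) auto
  fix c assume c: "c \<in> A" "\<sigma> t \<in> fst c"
  have "((\<lambda>s. V s c) has_vector_derivative - Nc c (V t c) (curve_coord c \<sigma> t) (velocity c \<sigma> t)) (at t within {0..1})"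
    using V t c unfolding parallel_along_iff by blast
  from bounded_linear.has_vector_derivative[OF bounded_linear_Jop this]
  show "((\<lambda>s. Jop (V s c)) has_vector_derivative - Nc c (Jop (V t c)) (curve_coord c \<sigma> t) (velocity c \<sigma> t)) (at t within {0..1})"
    by (simp add: J[OF c(1) t c(2)] linear_neg[OF linear_Jop])
qed

lemma curve_relatively_open:
  assumes "c \<in> A"
  obtains Op where "open Op" "{t \<in> {0..1}. \<sigma> t \<in> fst c} = {0..1} \<inter> Op"
proof -
  have "continuous_on {0..1} \<sigma>" using \<sigma> unfolding smooth_regular_curve_def by blast
  then obtain Op where "open Op" "Op \<inter> {0..1} = \<sigma> -` fst c \<inter> {0..1}"
    using chart(1)[OF assms] unfolding continuous_on_open_invariant by blast
  moreover have "{t \<in> {0..1}. \<sigma> t \<in> fst c} = \<sigma> -` fst c \<inter> {0..1}" by auto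
  ultimately show ?thesis by (intro that[of Op]) (simp_all only: Int_commute)
qed

lemma curve_derivative:
  assumes c: "c \<in> A"
  defines "T \<equiv> {t \<in> {0..1}. \<sigma> t \<in> fst c}"
  shows "t \<in> T \<Longrightarrow> (curve_coord c \<sigma> has_vector_derivative velocity c \<sigma> t) (at t within {0..1})"
    and "continuous_on T (curve_coord c \<sigma>)" "continuous_on T (velocity c \<sigma>)"
proof -
  obtain Op where Op: "open Op" "T = {0..1} \<inter> Op"
    using curve_relatively_open[OF c] unfolding T_def by blast
  have sm: "smooth_on T (curve_coord c \<sigma>)"
    using \<sigma> c unfolding smooth_regular_curve_def T_def by blast
  then have C1: "curve_coord c \<sigma> differentiable_on T"
    "continuous_on T (\<lambda>t. frechet_derivative (curve_coord c \<sigma>) (at t within T) 1)"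
    unfolding smooth_on_def by (metis Ck_on.simps(1,2))+
  show "continuous_on T (curve_coord c \<sigma>)" by (rule differentiable_imp_continuous_on[OF C1(1)])
  have d: "(curve_coord c \<sigma> has_vector_derivative velocity c \<sigma> t) (at t within {0..1})" if t: "t \<in> T" for t
    using C1(1) t unfolding velocity_def differentiable_on_def at_within_relatively_open[OF Op(2,1) t, symmetric]
    by (simp add: vector_derivative_works[symmetric])
  then show "t \<in> T \<Longrightarrow> (curve_coord c \<sigma> has_vector_derivative velocity c \<sigma> t) (at t within {0..1})" .
  have "frechet_derivative (curve_coord c \<sigma>) (at t within T) 1 = velocity c \<sigma> t" if t: "t \<in> T" for t
    using frechet_derivative_relatively_open[OF Op(2,1) t, of "curve_coord c \<sigma>" "velocity c \<sigma> t" 1] d[OF t]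
    unfolding at_within_relatively_open[OF Op(2,1) t] by simp
  then show "continuous_on T (velocity c \<sigma>)"
    by (rule continuous_on_eq[OF C1(2)])
qed

text \<open>In a chart parallel fields solve a linear equation with locally bounded coefficients, so the zeros of a parallel
  field form an open and closed set of times.\<close>

lemma parallel_unique:
  assumes V: "parallel_along A F \<sigma> V" and s: "s \<in> {0..1}" and t: "t \<in> {0..1}" and 0: "V s = (\<lambda>_. 0)"
  shows "V t = (\<lambda>_. 0)"
proof (rule connected_induction_simple[of "{0..1::real}" s t "\<lambda>t. V t = (\<lambda>_. 0)"])
  fix a :: real assume a: "a \<in> {0..1}"
  have "\<sigma> a \<in> (\<Union>c\<in>A. fst c)" using manifold unfolding complex_manifold_def by auto
  then obtain c where c: "c \<in> A" "\<sigma> a \<in> fst c" by blast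
  interpret finsler "U c" "Lc c" by (rule finsler_chart[OF c(1)])
  define T where "T = {t \<in> {0..1}. \<sigma> t \<in> fst c}"
  obtain Op where Op: "open Op" "T = {0..1} \<inter> Op"
    using curve_relatively_open[OF c(1)] unfolding T_def by blast
  have aT: "a \<in> T" using a c by (simp add: T_def)
  define m where "m = (\<lambda>t. \<Sum>j\<in>UNIV. norm (N (axis j 1) (curve_coord c \<sigma> t) (velocity c \<sigma> t)))"
  have inU: "curve_coord c \<sigma> t \<in> U c" "velocity c \<sigma> t \<noteq> 0" if "t \<in> T" for t
    using curve_in_U velocity_nonzero[OF c(1)] that by (auto simp: T_def)
  have "continuous_on T m"
    unfolding m_def
  proof (intro continuous_on_sum continuous_on_norm)
    fix j
    have "continuous_on T (\<lambda>t. case (curve_coord c \<sigma> t, velocity c \<sigma> t) of (x, y) \<Rightarrow> N (axis j 1) x y)"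
      by (rule continuous_on_compose2[OF continuous_on_N])
         (use curve_derivative(2,3)[OF c(1), folded T_def] inU in \<open>auto intro!: continuous_on_Pair\<close>)
    then show "continuous_on T (\<lambda>t. N (axis j 1) (curve_coord c \<sigma> t) (velocity c \<sigma> t))" by simp
  qed
  then obtain d1 where d1: "0 < d1" "\<And>t. t \<in> T \<Longrightarrow> dist t a < d1 \<Longrightarrow> dist (m t) (m a) < 1"
    using aT unfolding continuous_on_iff by (meson zero_less_one)
  obtain d2 where d2: "0 < d2" "ball a d2 \<subseteq> Op"
    using Op aT openE by blast
  define d where "d = min d1 d2"
  have main: "V t1 = (\<lambda>_. 0) \<longleftrightarrow> V t2 = (\<lambda>_. 0)" if t: "t1 \<in> {0..1} \<inter> ball a d" "t2 \<in> {0..1} \<inter> ball a d" "t1 \<le> t2" for t1 t2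
  proof -
    have zero: "V t = (\<lambda>_. 0) \<longleftrightarrow> V t c = 0" if "t \<in> T" for t
      using TR_zero[of "V t" "\<sigma> t" c] V c(1) that unfolding parallel_along_iff T_def by auto
    have inT: "t \<in> T \<and> dist t a < d1" if "t \<in> {t1..t2}" for t
    proof -
      have "t \<in> {0..1}" "dist t a < d" using that t by (auto simp: dist_real_def)
      moreover from this have "t \<in> Op" using d2(2) by (auto simp: d_def dist_commute)
      ultimately show ?thesis using Op(2) by (auto simp: d_def)
    qed
    have "V t1 c = 0 \<longleftrightarrow> V t2 c = 0"
    proof (rule linear_ode_unique[where K = "m a + 1"])
      fix t assume "t \<in> {t1..t2}"
      then have t: "t \<in> T" "dist t a < d1" using inT by auto
      have "m t \<le> m a + 1" using d1(2)[OF t] by (simp add: dist_real_def)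
      then have "norm (- N (V t c) (curve_coord c \<sigma> t) (velocity c \<sigma> t)) \<le> (m a + 1) * norm (V t c)"
        using norm_N_le[OF inU[OF t(1)], of "V t c"] mult_right_mono[of "m t" "m a + 1" "norm (V t c)"]
        by (simp add: m_def)
      moreover have "((\<lambda>s. V s c) has_vector_derivative - N (V t c) (curve_coord c \<sigma> t) (velocity c \<sigma> t)) (at t within {0..1})"
        using V t(1) c(1) unfolding parallel_along_iff T_def by blast
      ultimately show "\<exists>D. ((\<lambda>s. V s c) has_vector_derivative D) (at t within {0..1}) \<and> norm D \<le> (m a + 1) * norm (V t c)"
        by blast
    qed (use t in auto)
    then show ?thesis using zero inT[of t1] inT[of t2] t(3) by simp
  qed
  have "openin (top_of_set {0..1}) ({0..1} \<inter> ball a d)"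
    by (simp add: openin_open_Int)
  moreover have "a \<in> {0..1} \<inter> ball a d" using a d1 d2 by (simp add: d_def)
  moreover have "\<forall>x\<in>{0..1} \<inter> ball a d. \<forall>y\<in>{0..1} \<inter> ball a d. V x = (\<lambda>_. 0) \<longrightarrow> V y = (\<lambda>_. 0)"
    using main by (metis linear)
  ultimately show "\<exists>T. openin (top_of_set {0..1}) T \<and> a \<in> T \<and> (\<forall>x\<in>T. \<forall>y\<in>T. V x = (\<lambda>_. 0) \<longrightarrow> V y = (\<lambda>_. 0))"
    by blast
qed (use s t 0 in auto)

end

subsection \<open>Types\<close>

lemma type_iff:
  "Jop (z :: complex^('n + 'n)) = \<i> *s z \<longleftrightarrow> Jop (\<chi> j. Re (z $ j)) + (\<chi> j. Im (z $ j)) = (0 :: real^('n + 'n))"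
  "Jop (z :: complex^('n + 'n)) = - \<i> *s z \<longleftrightarrow> Jop (\<chi> j. Im (z $ j)) + (\<chi> j. Re (z $ j)) = (0 :: real^('n + 'n))"
proof -
  have 1: "- b = \<i> * a \<and> a = \<i> * b \<longleftrightarrow> - Re b + Im a = 0 \<and> Re a + Im b = 0" for a b
    unfolding complex_eq_iff by simp linarith
  have 2: "- b = - \<i> * a \<and> a = - \<i> * b \<longleftrightarrow> - Im b + Re a = 0 \<and> Im a + Re b = 0" for a b
    unfolding complex_eq_iff by simp linarith
  show "Jop z = \<i> *s z \<longleftrightarrow> Jop (\<chi> j. Re (z $ j)) + (\<chi> j. Im (z $ j)) = (0 :: real^('n + 'n))"
    unfolding vec_eq_Plus_iff all_conj_distrib[symmetric] using 1[of "z $ Inr _" "z $ Inl _"] by simp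
  show "Jop z = - \<i> *s z \<longleftrightarrow> Jop (\<chi> j. Im (z $ j)) + (\<chi> j. Re (z $ j)) = (0 :: real^('n + 'n))"
    unfolding vec_eq_Plus_iff all_conj_distrib[symmetric] using 2[of "z $ Inr _" "z $ Inl _"] by simp
qed

lemma type10_iff: "Z \<in> type10 A p \<longleftrightarrow> Z \<in> TC A p \<and> (\<lambda>c. Jop (Re_part Z c) + Im_part Z c) = (\<lambda>_. 0)"
  unfolding type10_def Re_part_def[abs_def] Im_part_def[abs_def] fun_eq_iff type_iff by auto

lemma type01_iff: "Z \<in> type01 A p \<longleftrightarrow> Z \<in> TC A p \<and> (\<lambda>c. Jop (Im_part Z c) + Re_part Z c) = (\<lambda>_. 0)"
  unfolding type01_def Re_part_def[abs_def] Im_part_def[abs_def] fun_eq_iff type_iff by auto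

text \<open>A complexified field with real part \<open>V1\<close> and imaginary part \<open>V2\<close> has type \<open>(1,0)\<close> when \<open>J V1 + V2 = 0\<close>
  and type \<open>(0,1)\<close> when \<open>J V2 + V1 = 0\<close>. Both sums are parallel, so they vanish along the whole curve if
  they vanish at one time.\<close>

lemma J_preserves_imp_types_preserved:
  assumes \<sigma>: "smooth_regular_curve A \<sigma>" and J: "J_preserves_parallel_along A F \<sigma>"
  shows "types_preserved_along A F \<sigma>"
  unfolding types_preserved_along_def
proof (intro ballI allI impI)
  fix s t :: real and Z W'
  assume s: "s \<in> {0..1}" and t: "t \<in> {0..1}" and tr: "complex_parallel_transport A F \<sigma> s t Z W'"
  obtain V1 V2 where V1: "parallel_along A F \<sigma> V1" "V1 s = Re_part Z" "V1 t = Re_part W'"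
    and V2: "parallel_along A F \<sigma> V2" "V2 s = Im_part Z" "V2 t = Im_part W'"
    using tr unfolding complex_parallel_transport_def parallel_transport_def by blast
  have TC: "W' \<in> TC A (\<sigma> t)"
  proof -
    have "V1 t \<in> TR A (\<sigma> t)" "V2 t \<in> TR A (\<sigma> t)"
      using V1(1) V2(1) t unfolding parallel_along_def by blast+
    then show ?thesis unfolding TC_def V1(3) V2(3) by simp
  qed
  have J': "parallel_along A F \<sigma> (\<lambda>t c. Jop (V t c))" if "parallel_along A F \<sigma> V" for V
    using J that unfolding J_preserves_parallel_along_def by blast
  note u1 = parallel_unique[OF \<sigma> parallel_add[OF \<sigma> J'[OF V1(1)] V2(1)] s t]
    and u2 = parallel_unique[OF \<sigma> parallel_add[OF \<sigma> J'[OF V2(1)] V1(1)] s t]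
  show "(Z \<in> type10 A (\<sigma> s) \<longrightarrow> W' \<in> type10 A (\<sigma> t)) \<and> (Z \<in> type01 A (\<sigma> s) \<longrightarrow> W' \<in> type01 A (\<sigma> t))"
    unfolding type10_iff type01_iff using TC u1 u2 by (simp add: V1(2,3) V2(2,3))
qed

end

section \<open>Parallel fields along coordinate segments\<close>

context finsler_manifold
begin

context
  fixes c :: "('m, 'n) cchart" and x0 w :: "real^('n + 'n)" and \<sigma> :: "real \<Rightarrow> 'm"
  assumes c: "c \<in> A" and w: "w \<noteq> 0" and seg: "\<And>t. t \<in> {0..1} \<Longrightarrow> x0 + t *\<^sub>R w \<in> U c"
  defines "\<sigma> \<equiv> \<lambda>t. inv_into (fst c) (snd c) (z_of (x0 + t *\<^sub>R w))"
begin

lemma segment_point: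
  assumes "t \<in> {0..1}"
  shows "\<sigma> t \<in> fst c" "snd c (\<sigma> t) = z_of (x0 + t *\<^sub>R w)" "x_of (snd c (\<sigma> t)) = x0 + t *\<^sub>R w"
  using inv_chart[OF c, of "z_of (x0 + t *\<^sub>R w)"] seg[OF assms] by (simp_all add: \<sigma>_def U_def)

lemma segment_in_overlap:
  "t \<in> {0..1} \<Longrightarrow> z_of (x0 + t *\<^sub>R w) \<in> W c d \<longleftrightarrow> \<sigma> t \<in> fst d"
  unfolding W_alt[OF c] using seg[of t] by (simp add: U_def \<sigma>_def)

lemma segment_coord: "t \<in> {0..1} \<Longrightarrow> curve_coord d \<sigma> t = \<phi> c d (x0 + t *\<^sub>R w)"
  using segment_point[of t] \<phi>_chart[OF c, of "\<sigma> t" d] by (simp add: curve_coord_def)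

context
  fixes d :: "('m, 'n) cchart"
  assumes d: "d \<in> A"
begin

interpretation FC: finsler_change "U c" "U d" "Lc c" "Lc d" "{x. z_of x \<in> W c d}" "\<phi> c d"
  by (rule finsler_change_local_L[OF F c d])

lemma segment_domain:
  "{t \<in> {0..1}. \<sigma> t \<in> fst d} = {t \<in> {0..1}. x0 + t *\<^sub>R w \<in> {x. z_of x \<in> W c d}}"
  unfolding mem_Collect_eq by (intro Collect_cong conj_cong refl segment_in_overlap[symmetric])

lemma segment_relatively_open:
  obtains Op where "open Op" "{t \<in> {0..1}. \<sigma> t \<in> fst d} = {0..1} \<inter> Op"
proof (rule that)
  show "open ((\<lambda>t::real. x0 + t *\<^sub>R w) -` {x. z_of x \<in> W c d})"
    by (intro open_vimage FC.open_V continuous_intros)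
  show "{t \<in> {0..1}. \<sigma> t \<in> fst d} = {0..1} \<inter> (\<lambda>t::real. x0 + t *\<^sub>R w) -` {x. z_of x \<in> W c d}"
    unfolding segment_domain by (simp only: vimage_def Int_def mem_Collect_eq)
qed

lemma segment_D1: "t \<in> {0..1} \<Longrightarrow> \<sigma> t \<in> fst d \<Longrightarrow> FC.D1 (x0 + t *\<^sub>R w) = RD c d (\<sigma> t)"
  unfolding FC.D1_def
  using real_transition_derivative[OF c d segment_point(1), of t] segment_point(3)[of t]
  by (simp add: \<phi>_def[abs_def])

lemma segment_derivative: "((\<lambda>t. x0 + t *\<^sub>R w) has_vector_derivative w) (at t within X)"
  by (auto intro!: derivative_eq_intros)

lemma segment_coord_derivative:
  assumes t: "t \<in> {0..1}" "\<sigma> t \<in> fst d"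
  shows "(curve_coord d \<sigma> has_vector_derivative RD c d (\<sigma> t) w) (at t within {0..1})"
proof -
  have "((\<lambda>t. \<phi> c d (x0 + t *\<^sub>R w)) has_derivative (\<lambda>h. FC.D1 (x0 + t *\<^sub>R w) (h *\<^sub>R w))) (at t within {0..1})"
    by (rule has_derivative_compose[OF segment_derivative[unfolded has_vector_derivative_def] FC.D1_has_derivative])
       (use t segment_in_overlap in simp)
  then have "((\<lambda>t. \<phi> c d (x0 + t *\<^sub>R w)) has_vector_derivative RD c d (\<sigma> t) w) (at t within {0..1})"
    using linear_scale[OF linear_RD[OF c d segment_point(1)[OF t(1)] t(2)]]
    by (simp add: has_vector_derivative_def segment_D1[OF t])
  then show ?thesis
    by (rule has_vector_derivative_transform[OF t(1), rotated]) (rule segment_coord)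
qed

lemma segment_velocity:
  assumes "t \<in> {0..1}" "\<sigma> t \<in> fst d"
  shows "velocity d \<sigma> t = RD c d (\<sigma> t) w" "velocity d \<sigma> t \<noteq> 0"
proof -
  show v: "velocity d \<sigma> t = RD c d (\<sigma> t) w"
    unfolding velocity_def
    by (rule vector_derivative_within[OF at_within_unit_interval[OF assms(1)] segment_coord_derivative[OF assms]])
  have "RD d c (\<sigma> t) (RD c d (\<sigma> t) w) = w"
    using RD_cocycle[OF c d c segment_point(1) _ segment_point(1)] RD_refl[OF c segment_point(1)] assms by simp
  then show "velocity d \<sigma> t \<noteq> 0"
    using v w linear_0[OF linear_RD[OF d c assms(2) segment_point(1)[OF assms(1)]]] by metis
qed

text \<open>The derivative of the transition map along the segment produces the second derivative that occurs in the
  transformation law of the nonlinear connection.\<close>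

lemma segment_parallel_change:
  assumes t: "t \<in> {0..1}" "\<sigma> t \<in> fst d"
    and V: "(V has_vector_derivative - Nc c (V t) (x0 + t *\<^sub>R w) w) (at t within {0..1})"
  shows "((\<lambda>s. if \<sigma> s \<in> fst d then RD c d (\<sigma> s) (V s) else 0) has_vector_derivative
    - Nc d (RD c d (\<sigma> t) (V t)) (curve_coord d \<sigma> t) (velocity d \<sigma> t)) (at t within {0..1})"
proof -
  obtain Op where Op: "open Op" "{t \<in> {0..1}. \<sigma> t \<in> fst d} = {0..1} \<inter> Op"
    by (rule segment_relatively_open)
  let ?T = "{t \<in> {0..1}. \<sigma> t \<in> fst d}" and ?x = "x0 + t *\<^sub>R w"
  have tT: "t \<in> ?T" using t by simp
  have x: "?x \<in> {x. z_of x \<in> W c d}" using t segment_in_overlap by simp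
  have "((\<lambda>s. (x0 + s *\<^sub>R w, V s)) has_derivative (\<lambda>h. (h *\<^sub>R w, h *\<^sub>R - Nc c (V t) ?x w))) (at t within {0..1})"
    using segment_derivative V unfolding has_vector_derivative_def by (intro has_derivative_Pair)
  from has_derivative_compose[OF this FC.bundle_map_has_derivative[OF x]]
  have "((\<lambda>s. FC.D1 (x0 + s *\<^sub>R w) (V s)) has_derivative
      (\<lambda>h. FC.D2 ?x (V t) (h *\<^sub>R w) + FC.D1 ?x (h *\<^sub>R - Nc c (V t) ?x w))) (at t within {0..1})"
    by simp
  moreover have "FC.D2 ?x (V t) (h *\<^sub>R w) + FC.D1 ?x (h *\<^sub>R - Nc c (V t) ?x w) =
      h *\<^sub>R - Nc d (FC.D1 ?x (V t)) (\<phi> c d ?x) (FC.D1 ?x w)" for h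
    unfolding FC.nonlinear_connection_change[OF x w] FC.D2_sym[OF x, of w]
    using linear_scale[OF has_derivative_linear[OF FC.D2_has_derivative[OF x]], of "V t" h w]
      linear_scale[OF FC.linear_D1[OF x], of h "- Nc c (V t) ?x w"] linear_neg[OF FC.linear_D1[OF x]]
    by (simp add: algebra_simps)
  ultimately have "((\<lambda>s. FC.D1 (x0 + s *\<^sub>R w) (V s)) has_vector_derivative
      - Nc d (FC.D1 ?x (V t)) (\<phi> c d ?x) (FC.D1 ?x w)) (at t within ?T)"
    unfolding has_vector_derivative_def at_within_relatively_open[OF Op(2,1) tT] by simp
  then have "((\<lambda>s. FC.D1 (x0 + s *\<^sub>R w) (V s)) has_vector_derivative
      - Nc d (RD c d (\<sigma> t) (V t)) (curve_coord d \<sigma> t) (velocity d \<sigma> t)) (at t within ?T)"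
    by (simp only: segment_D1[OF t] segment_velocity(1)[OF t] segment_coord[OF t(1)])
  then have "((\<lambda>s. if \<sigma> s \<in> fst d then RD c d (\<sigma> s) (V s) else 0) has_vector_derivative
      - Nc d (RD c d (\<sigma> t) (V t)) (curve_coord d \<sigma> t) (velocity d \<sigma> t)) (at t within ?T)"
    by (rule has_vector_derivative_transform[OF tT, rotated]) (auto simp: segment_D1)
  then show ?thesis
    unfolding at_within_relatively_open[OF Op(2,1) tT] .
qed

lemma segment_smooth: "smooth_on {t \<in> {0..1}. \<sigma> t \<in> fst d} (curve_coord d \<sigma>)"
proof -
  show ?thesis
    unfolding segment_domain
    by (rule smooth_on_cong[OF smooth_on_affine_curve[OF FC.smooth_\<phi> FC.open_V]]) (auto simp: segment_coord)
qed

end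

lemma segment_regular: "smooth_regular_curve A \<sigma>"
  unfolding smooth_regular_curve_def
proof (intro conjI ballI impI)
  have "continuous_on {0..1} (\<lambda>t. z_of (x0 + t *\<^sub>R w))"
    by (intro bounded_linear.continuous_on[OF bounded_linear_z_of] continuous_intros)
  then show "continuous_on {0..1} \<sigma>"
    unfolding \<sigma>_def
    by (rule continuous_on_compose2[OF chart(4)[OF c]]) (use seg in \<open>auto simp: U_def\<close>)
qed (use segment_smooth segment_velocity(2) in blast)+

lemma segment_parallel_exists:
  assumes bound: "\<And>t u. t \<in> {0..1} \<Longrightarrow> norm (Nc c u (x0 + t *\<^sub>R w) w) \<le> norm u / 2"
  obtains V where "parallel_along A F \<sigma> V" "V 0 c = v0"
proof -
  interpret finsler "U c" "Lc c" by (rule finsler_chart[OF c])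
  obtain f where f: "f 0 = v0" "\<And>t. t \<in> {0..1} \<Longrightarrow> (f has_vector_derivative - N (f t) (x0 + t *\<^sub>R w) w) (at t within {0..1})"
  proof (rule linear_ode_exists[of "\<lambda>t u. - N u (x0 + t *\<^sub>R w) w" v0])
    fix u
    have "continuous_on {0..1} (\<lambda>t. case (x0 + t *\<^sub>R w, w) of (x, y) \<Rightarrow> N u x y)"
      by (rule continuous_on_compose2[OF continuous_on_N]) (use seg w in \<open>auto intro!: continuous_intros\<close>)
    then show "continuous_on {0..1} (\<lambda>t. - N u (x0 + t *\<^sub>R w) w)"
      by (intro continuous_intros) simp
  next
    show "linear (\<lambda>u. - N u (x0 + t *\<^sub>R w) w)" if "t \<in> {0..1}" for t
      by (rule linear_compose_neg[OF linear_N[OF seg[OF that] w]])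
  qed (use bound in auto)
  define V where "V = (\<lambda>t d. if d \<in> A \<and> \<sigma> t \<in> fst d then RD c d (\<sigma> t) (f t) else 0)"
  have "parallel_along A F \<sigma> V"
    unfolding parallel_along_iff[OF segment_regular]
  proof (intro conjI ballI impI)
    fix t :: real assume t: "t \<in> {0..1}"
    show "V t \<in> TR A (\<sigma> t)"
      unfolding V_def by (rule RD_family_in_TR[OF c segment_point(1)[OF t]])
    fix d assume d: "d \<in> A" "\<sigma> t \<in> fst d"
    from segment_parallel_change[OF d(1) t d(2) f(2)[OF t]]
    show "((\<lambda>s. V s d) has_vector_derivative - Nc d (V t d) (curve_coord d \<sigma> t) (velocity d \<sigma> t)) (at t within {0..1})"
      using d by (simp add: V_def)
  qed
  moreover have "V 0 c = v0"
    using c segment_point(1)[of 0] f(1) by (simp add: V_def RD_refl)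
  ultimately show ?thesis by (rule that)
qed

text \<open>The parallel fields with initial values \<open>e\<close> and \<open>- J e\<close> are the real and imaginary part of a field that
  starts, and hence stays, of type \<open>(1,0)\<close>; compare derivatives at time \<open>0\<close>.\<close>

lemma segment_types_preserved:
  assumes bound: "\<And>t u. t \<in> {0..1} \<Longrightarrow> norm (Nc c u (x0 + t *\<^sub>R w) w) \<le> norm u / 2"
    and types: "types_preserved_along A F \<sigma>"
  shows "Nc c (Jop e) x0 w = Jop (Nc c e x0 w)"
proof -
  interpret finsler "U c" "Lc c" by (rule finsler_chart[OF c])
  obtain V1 where V1: "parallel_along A F \<sigma> V1" "V1 0 c = e"
    using segment_parallel_exists[OF bound] by blast
  obtain V2 where V2: "parallel_along A F \<sigma> V2" "V2 0 c = - Jop e"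
    using segment_parallel_exists[OF bound] by blast
  have TR: "V1 t \<in> TR A (\<sigma> t)" "V2 t \<in> TR A (\<sigma> t)" if "t \<in> {0..1}" for t
    using V1(1) V2(1) that unfolding parallel_along_def by blast+
  define Z where "Z = (\<lambda>t d. \<chi> j. Complex (V1 t d $ j) (V2 t d $ j))"
  have parts: "Re_part (Z t) = V1 t" "Im_part (Z t) = V2 t" for t
    by (auto simp: Z_def Re_part_def Im_part_def fun_eq_iff vec_eq_iff)
  have 0: "(0::real) \<in> {0..1}" by simp
  have "(\<lambda>d. Jop (V1 0 d) + V2 0 d) = (\<lambda>_. 0)"
    by (rule TR_zero[OF TR_add[OF TR_Jop[OF TR(1)[OF 0]] TR(2)[OF 0]] c segment_point(1)[OF 0]])
       (simp add: V1(2) V2(2))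
  then have Z0: "Z 0 \<in> type10 A (\<sigma> 0)"
    using TR[OF 0] by (simp add: type10_iff TC_def parts)
  have J: "Jop (V1 t c) + V2 t c = 0" if t: "t \<in> {0..1}" for t
  proof -
    have "complex_parallel_transport A F \<sigma> 0 t (Z 0) (Z t)"
      using V1(1) V2(1) unfolding complex_parallel_transport_def parallel_transport_def parts by blast
    then have "Z t \<in> type10 A (\<sigma> t)"
      using types Z0 t 0 unfolding types_preserved_along_def by blast
    then have "(\<lambda>d. Jop (V1 t d) + V2 t d) = (\<lambda>_. 0)" unfolding type10_iff parts by blast
    from fun_cong[OF this] show ?thesis .
  qed
  have pt: "\<sigma> 0 \<in> fst c" "curve_coord c \<sigma> 0 = x0" "velocity c \<sigma> 0 = w"
    using segment_point[OF 0] segment_velocity(1)[OF c 0] RD_refl[OF c] by (auto simp: curve_coord_def)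
  have d1: "((\<lambda>s. V1 s c) has_vector_derivative - N e x0 w) (at 0 within {0..1})"
    and d2: "((\<lambda>s. V2 s c) has_vector_derivative - N (- Jop e) x0 w) (at 0 within {0..1})"
    using V1 V2 0 c pt unfolding parallel_along_iff[OF segment_regular] by metis+
  have "((\<lambda>s. Jop (V1 s c) + V2 s c) has_vector_derivative Jop (- N e x0 w) + - N (- Jop e) x0 w) (at 0 within {0..1})"
    by (intro has_vector_derivative_add bounded_linear.has_vector_derivative[OF bounded_linear_Jop] d1 d2)
  moreover have "((\<lambda>s. Jop (V1 s c) + V2 s c) has_vector_derivative 0) (at 0 within {0..1})"
    by (rule has_vector_derivative_transform[OF 0 J has_vector_derivative_const])
  ultimately have "Jop (- N e x0 w) + - N (- Jop e) x0 w = 0"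
    by (rule vector_derivative_unique_within[OF at_within_unit_interval[OF 0]])
  moreover have "x0 \<in> U c" using seg[OF 0] by simp
  ultimately show ?thesis
    by (simp add: linear_neg[OF linear_Jop] linear_neg[OF linear_N[OF _ w]])
qed

end

text \<open>A sufficiently short and slow segment satisfies the norm bound; homogeneity of the nonlinear
  connection removes the scaling of the velocity.\<close>

lemma types_preserved_imp_N_complex_linear:
  assumes types: "\<And>\<sigma>. smooth_regular_curve A \<sigma> \<Longrightarrow> types_preserved_along A F \<sigma>"
    and c: "c \<in> A" and x: "x \<in> U c" and y: "y \<noteq> 0"
  shows "Nc c (Jop u) x y = Jop (Nc c u x y)"
proof -
  interpret finsler "U c" "Lc c" by (rule finsler_chart[OF c])
  define m where "m = (\<lambda>x. \<Sum>j\<in>UNIV. norm (N (axis j 1) x y))"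
  have "continuous_on (U c) m"
    unfolding m_def
  proof (intro continuous_on_sum continuous_on_norm)
    fix j
    have "continuous_on (U c) (\<lambda>x. case (x, y) of (x, y) \<Rightarrow> N (axis j 1) x y)"
      by (rule continuous_on_compose2[OF continuous_on_N]) (use y in \<open>auto intro!: continuous_intros\<close>)
    then show "continuous_on (U c) (\<lambda>x. N (axis j 1) x y)" by simp
  qed
  then obtain d1 where d1: "0 < d1" "\<And>x'. x' \<in> U c \<Longrightarrow> dist x' x < d1 \<Longrightarrow> dist (m x') (m x) < 1"
    using x unfolding continuous_on_iff by (meson zero_less_one)
  obtain d2 where d2: "0 < d2" "ball x d2 \<subseteq> U c"
    using open_U x openE by blast
  define d where "d = min d1 d2"
  have d: "0 < d" using d1 d2 by (simp add: d_def)
  have m0: "0 \<le> m x" by (simp add: m_def sum_nonneg)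
  define e where "e = min (d / (2 * norm y)) (1 / (2 * (m x + 1)))"
  have e: "0 < e" "e * norm y < d" "e * (m x + 1) \<le> 1 / 2"
  proof -
    show "0 < e" using d y m0 by (simp add: e_def add_nonneg_pos)
    have "e * norm y \<le> d / (2 * norm y) * norm y" by (intro mult_right_mono) (simp_all add: e_def)
    also have "\<dots> < d" using d y by simp
    finally show "e * norm y < d" .
    have "e * (m x + 1) \<le> 1 / (2 * (m x + 1)) * (m x + 1)" using m0 by (intro mult_right_mono) (simp_all add: e_def)
    also have "\<dots> = 1 / 2" using m0 by (simp add: field_simps add_nonneg_eq_0_iff)
    finally show "e * (m x + 1) \<le> 1 / 2" .
  qed
  have near: "dist (x + t *\<^sub>R (e *\<^sub>R y)) x < d" if "t \<in> {0..1}" for t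
  proof -
    have "dist (x + t *\<^sub>R (e *\<^sub>R y)) x = t * (e * norm y)" using that e(1) by (simp add: dist_norm)
    also have "\<dots> \<le> 1 * (e * norm y)" using that e(1) by (intro mult_right_mono) auto
    finally show ?thesis using e(2) by simp
  qed
  have seg: "x + t *\<^sub>R (e *\<^sub>R y) \<in> U c" if "t \<in> {0..1}" for t
    using near[OF that] d2(2) by (auto simp: d_def dist_commute)
  have bound: "norm (N u (x + t *\<^sub>R (e *\<^sub>R y)) (e *\<^sub>R y)) \<le> norm u / 2" if t: "t \<in> {0..1}" for t u
  proof -
    let ?x = "x + t *\<^sub>R (e *\<^sub>R y)"
    have "m ?x \<le> m x + 1"
      using d1(2)[OF seg[OF t]] near[OF t] by (simp add: d_def dist_real_def)
    then have "norm (N u ?x y) \<le> (m x + 1) * norm u"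
      using norm_N_le[OF seg[OF t] y, of u] mult_right_mono[of "m ?x" "m x + 1" "norm u"] by (simp add: m_def)
    then have "e * norm (N u ?x y) \<le> e * ((m x + 1) * norm u)"
      using e(1) by simp
    also have "\<dots> \<le> 1 / 2 * norm u"
      unfolding mult.assoc[symmetric] by (rule mult_right_mono[OF e(3)]) simp
    finally show ?thesis
      using N_homogeneous[OF seg[OF t] y e(1), of u] e(1) by simp
  qed
  have ey: "e *\<^sub>R y \<noteq> 0" using e(1) y by simp
  have "N (Jop u) x (e *\<^sub>R y) = Jop (N u x (e *\<^sub>R y))"
    by (rule segment_types_preserved[OF c ey seg bound types[OF segment_regular[OF c ey seg]]])
  then have "e *\<^sub>R N (Jop u) x y = e *\<^sub>R Jop (N u x y)"
    by (simp add: N_homogeneous[OF x y e(1)] linear_scale[OF linear_Jop])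
  then show ?thesis using e(1) by simp
qed

section \<open>The equivalences\<close>

lemma vert_comp_horizontal:
  assumes c: "c \<in> A" and X: "X \<in> horizontal_space (Lc c) x y"
  shows "vert_comp (Lc c) x y X = 0"
proof -
  have l: "linear (vert_comp (Lc c) x y)"
    by (simp add: linear_iff vert_comp_def vec_eq_iff sum.distrib sum_distrib_left algebra_simps)
  have "subspace {X. vert_comp (Lc c) x y X = 0}"
    by (simp add: subspace_def linear_0[OF l] linear_add[OF l] linear_scale[OF l])
  moreover have "range (\<lambda>j. (axis j 1, \<chi> k. - nonlin_conn (Lc c) k j x y)) \<subseteq> {X. vert_comp (Lc c) x y X = 0}"
    by (auto simp: vert_comp_def vec_eq_iff axis_def if_distrib cong: if_cong)
  ultimately show ?thesis
    using X span_minimal unfolding horizontal_space_def by blast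
qed

lemma cartan_nabla_horizontal:
  assumes "c \<in> A" "X \<in> horizontal_space (Lc c) x y"
  shows "cartan_nabla (Lc c) x y X Y = frechet_derivative Y (at (x, y)) X + finsler.cartan (Lc c) (Y (x, y)) (fst X) x y"
  using finsler_chart[OF assms(1)]
  by (simp add: cartan_nabla_def vert_comp_horizontal[OF assms] finsler.cartan_def vec_eq_iff sum_distrib_left mult_ac)

lemma Kaehler_Berwald_imp_J_horizontally_parallel:
  assumes KB: "strongly_convex_kahler_berwald A F"
  shows "J_horizontally_parallel A F"
  unfolding J_horizontally_parallel_def
proof (intro ballI allI impI, clarify)
  fix a b and Wo :: "((real^('n + 'n)) \<times> (real^('n + 'n))) set"
    and Y :: "(real^('n + 'n)) \<times> (real^('n + 'n)) \<Rightarrow> real^('n + 'n)" and x y u v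
  assume c: "(a, b) \<in> A" and Wo: "open Wo" "Wo \<subseteq> slit_dom (a, b)" "smooth_on Wo Y" and p: "(x, y) \<in> Wo"
    and X: "(u, v) \<in> horizontal_space (Lc (a, b)) x y"
  let ?c = "(a, b)" and ?X = "(u, v)"
  interpret complex_finsler "U ?c" "Lc ?c" by (rule complex_finsler_chart[OF c])
  have xy: "x \<in> U ?c" "y \<noteq> 0" using p Wo(2) unfolding slit_dom_eq by auto
  have "ccoeff (Lc ?c) \<alpha> \<beta> \<mu> x y' = ccoeff (Lc ?c) \<alpha> \<beta> \<mu> x y" if "y' \<noteq> 0" for \<alpha> \<beta> \<mu> y'
    using KB c xy that unfolding strongly_convex_kahler_berwald_def complex_berwald_def slit_dom_eq in_slit by blast
  moreover have "ccoeff (Lc ?c) \<alpha> \<beta> \<mu> x y = ccoeff (Lc ?c) \<alpha> \<mu> \<beta> x y" for \<alpha> \<beta> \<mu>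
    using KB c xy unfolding strongly_convex_kahler_berwald_def kahler_finsler_def slit_dom_eq by fastforce
  ultimately have J: "cartan (Jop V) u x y = Jop (cartan V u x y)" for V u
    by (rule Berwald_imp_cartan_complex_linear[OF xy])
  have "frechet_derivative (\<lambda>q. Jop (Y q)) (at (x, y)) = (\<lambda>h. Jop (frechet_derivative Y (at (x, y)) h))"
    by (rule frechet_derivative_at[OF bounded_linear.has_derivative[OF bounded_linear_Jop
          smooth_on_has_derivative[OF Wo(3,1) p]], symmetric])
  then show "nabla_J (Lc ?c) x y ?X Y = 0"
    unfolding nabla_J_def cartan_nabla_horizontal[OF c X] J by (simp add: linear_add[OF linear_Jop])
qed

text \<open>Constant sections and the horizontal lift of the base point \<open>y\<close> suffice, as the contraction of the
  Cartan connection with \<open>y\<close> is \<open>N\<close>.\<close>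

lemma J_horizontally_parallel_imp_N_complex_linear:
  assumes par: "J_horizontally_parallel A F" and c: "c \<in> A" and x: "x \<in> U c" and y: "y \<noteq> 0"
  shows "Nc c (Jop v) x y = Jop (Nc c v x y)"
proof -
  interpret finsler "U c" "Lc c" by (rule finsler_chart[OF c])
  define X where "X = (\<Sum>j\<in>UNIV. y $ j *\<^sub>R (axis j (1::real), \<chi> k. - nonlin_conn (Lc c) k j x y))"
  have X: "X \<in> horizontal_space (Lc c) x y"
    unfolding X_def horizontal_space_def by (intro span_sum span_scale span_base) auto
  have "fst X = (\<Sum>j\<in>UNIV. y $ j *\<^sub>R axis j 1)" by (simp add: X_def fst_sum)
  then have fst: "fst X = y" using basis_expansion[of y] by (simp add: scalar_mult_eq_scaleR)
  have "nabla_J (Lc c) x y X (\<lambda>_. v) = 0"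
  proof -
    have "open (slit_dom c) \<and> slit_dom c \<subseteq> slit_dom c \<and> smooth_on (slit_dom c) (\<lambda>_. v)"
      using open_region smooth_on_const[OF open_region, of v] by (simp add: slit_dom_eq)
    then have "\<forall>(x, y)\<in>slit_dom c. \<forall>X\<in>horizontal_space (Lc c) x y. nabla_J (Lc c) x y X (\<lambda>_. v) = 0"
      using par c unfolding J_horizontally_parallel_def by blast
    from bspec[OF this, of "(x, y)"] x y X show ?thesis by (simp add: slit_dom_eq)
  qed
  then have "cartan (Jop v) y x y = Jop (cartan v y x y)"
    unfolding nabla_J_def cartan_nabla_horizontal[OF c X] fst by simp
  then show ?thesis by (simp add: cartan_contraction[OF x y])
qed

lemma N_complex_linear_imp_J_preserves:
  assumes J: "\<And>c x y u. c \<in> A \<Longrightarrow> x \<in> U c \<Longrightarrow> y \<noteq> 0 \<Longrightarrow> Nc c (Jop u) x y = Jop (Nc c u x y)"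
    and \<sigma>: "smooth_regular_curve A \<sigma>"
  shows "J_preserves_parallel_along A F \<sigma>"
  unfolding J_preserves_parallel_along_def
proof (intro allI impI)
  fix V assume V: "parallel_along A F \<sigma> V"
  show "parallel_along A F \<sigma> (\<lambda>t c. Jop (V t c))"
    by (rule parallel_Jop[OF \<sigma> V J]) (use curve_in_U[OF \<sigma>] velocity_nonzero[OF \<sigma>] in auto)
qed

lemma N_complex_linear_imp_Kaehler_Berwald:
  assumes n: "CARD('n) \<ge> 2"
    and J: "\<And>c x y u. c \<in> A \<Longrightarrow> x \<in> U c \<Longrightarrow> y \<noteq> 0 \<Longrightarrow> Nc c (Jop u) x y = Jop (Nc c u x y)"
  shows "strongly_convex_kahler_berwald A F"
proof -
  have *: "\<exists>C. (\<forall>\<alpha> \<beta> \<mu>. C \<alpha> \<beta> \<mu> = C \<alpha> \<mu> \<beta>) \<and> (\<forall>y \<alpha> \<beta> \<mu>. y \<noteq> 0 \<longrightarrow> ccoeff (Lc c) \<alpha> \<beta> \<mu> x y = C \<alpha> \<beta> \<mu>)"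
    if c: "c \<in> A" and x: "x \<in> U c" for c x
  proof -
    interpret complex_finsler "U c" "Lc c" by (rule complex_finsler_chart[OF c])
    show ?thesis
      by (rule N_complex_linear_imp_Berwald[OF n x J[OF c x]]) blast+
  qed
  have "kahler_finsler A F"
    unfolding kahler_finsler_def
  proof (intro ballI, clarify)
    fix a b x y \<alpha> \<beta> \<mu> assume "(a, b) \<in> A" "(x, y) \<in> slit_dom (a, b)"
    then show "ccoeff (Lc (a, b)) \<alpha> \<beta> \<mu> x y = ccoeff (Lc (a, b)) \<alpha> \<mu> \<beta> x y"
      using *[of "(a, b)" x] unfolding slit_dom_eq by (metis in_slit)
  qed
  moreover have "complex_berwald A F"
    unfolding complex_berwald_def
  proof (intro ballI allI impI)
    fix c x y y' \<alpha> \<beta> \<mu> assume "c \<in> A" "(x, y) \<in> slit_dom c \<and> (x, y') \<in> slit_dom c"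
    then show "ccoeff (Lc c) \<alpha> \<beta> \<mu> x y = ccoeff (Lc c) \<alpha> \<beta> \<mu> x y'"
      using *[of c x] unfolding slit_dom_eq by (metis in_slit)
  qed
  ultimately show ?thesis
    using F by (simp add: strongly_convex_kahler_berwald_def)
qed

end

theorem theorem1p4:
  fixes A :: "('m::{t2_space,second_countable_topology}, 'n::finite) cchart set"
    and F :: "('m, 'n) finsler_fun"
  assumes "CARD('n) \<ge> 2"
    and "complex_manifold A"
    and "strongly_convex_finsler A F"
    and "weakly_kahler_finsler A F"
  shows
    "(strongly_convex_kahler_berwald A F \<longleftrightarrow>
        (\<forall>\<sigma>. smooth_regular_curve A \<sigma> \<longrightarrow> types_preserved_along A F \<sigma>)) \<and>
     (strongly_convex_kahler_berwald A F \<longleftrightarrow>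
        (\<forall>\<sigma>. smooth_regular_curve A \<sigma> \<longrightarrow> J_preserves_parallel_along A F \<sigma>)) \<and>
     (strongly_convex_kahler_berwald A F \<longleftrightarrow> J_horizontally_parallel A F)"
proof -
  interpret finsler_manifold A F
    by unfold_locales (rule assms)+
  have 14: "strongly_convex_kahler_berwald A F \<Longrightarrow> J_horizontally_parallel A F"
    by (rule Kaehler_Berwald_imp_J_horizontally_parallel)
  have 43: "J_horizontally_parallel A F \<Longrightarrow> smooth_regular_curve A \<sigma> \<Longrightarrow> J_preserves_parallel_along A F \<sigma>" for \<sigma>
    by (rule N_complex_linear_imp_J_preserves[OF J_horizontally_parallel_imp_N_complex_linear])
  have 32: "\<forall>\<sigma>. smooth_regular_curve A \<sigma> \<longrightarrow> J_preserves_parallel_along A F \<sigma> \<Longrightarrow>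
      \<forall>\<sigma>. smooth_regular_curve A \<sigma> \<longrightarrow> types_preserved_along A F \<sigma>"
    using J_preserves_imp_types_preserved by blast
  have 21: "\<forall>\<sigma>. smooth_regular_curve A \<sigma> \<longrightarrow> types_preserved_along A F \<sigma> \<Longrightarrow> strongly_convex_kahler_berwald A F"
    by (rule N_complex_linear_imp_Kaehler_Berwald[OF assms(1) types_preserved_imp_N_complex_linear]) blast
  show ?thesis using 14 43 32 21 by blast
qed

end
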